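(* Let $b_1,b_2>0$, $0<x_2<1$ with $b_2x_2=b_1(1-x_2)$. For real $\lambda$ let $r_k(\lambda)$, $k\ge 1$, be the reflection coefficient of $P_k$, $r(\lambda)$ the reflection coefficient of the half-infinite operator $P_\infty$, $F$ the Lyapunov function, and $f_\lambda$ the linear-fractional automorphism of the unit disk with $r_{k+1}(\lambda)=f_\lambda(r_k(\lambda))$ for all $k\ge1$ (all given in the context). Write $f_\lambda^{[k]}$ for the $k$-fold iterate of $f_\lambda$. (i) If $\lambda$ lies in a spectral gap, i.e. $|F(\lambda)|>1$, then $f_\lambda$ has two distinct fixed points $z_1\neq z_2$, of hyperbolic type: $|z_1|=|z_2|=1$. The sequence $r_k(\lambda)$ converges to $r(\lambda)$ as $k\to\infty$, where $r(\lambda)=\lim_{k\to\infty}f_\lambda^{[k]}(r_1(\lambda))$ is either $z_1$ or $z_2$. (ii) If $\lambda$ is a non-degenerate band edge, i.e. $F(\lambda)=\pm1$ and $F'(\lambda)\ne0$, then $f_\lambda$ has one (double) fixed point $z_1=z_2$, with $|z_1|=1$, and $r(\lambda)=z_1=\lim_{k\to\infty}r_k(\lambda)=\lim_{k\to\infty}f_\lambda^{[k]}(r_1(\lambda))$. (iii) If $\lambda=\lambda_0$ is a degenerate band edge, i.e. $F(\lambda_0)=\pm1$ and $F'(\lambda_0)=0$, then $r_k(\lambda_0)=0$ for all $k=1,2,3,\ldots$.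
   Context: Let $a:\mathbb{R}\to(0,\infty)$ be the $1$-periodic function with $a(x)=b_2^{-2}$ for $x\in[0,x_2)$ and $a(x)=b_1^{-2}$ for $x\in[x_2,1)$. Let $a_k(x)=a(x)$ for $x\in[0,k]$, $a_k(x)=b_1^{-2}$ otherwise; and $a_\infty(x)=a(x)$ for $x\ge0$, $a_\infty(x)=b_1^{-2}$ for $x<0$. Put $P_k=-\partial_xa_k\partial_x$, $P_\infty=-\partial_xa_\infty\partial_x$, $P=-\partial_xa\partial_x$. Solutions $\psi$ are required to have $\psi$ and (coefficient)$\cdot\partial_x\psi$ continuous. The coefficients $r_k(\lambda),t_k(\lambda)$ are defined by the solution of $P_k\psi=\lambda^2\psi$ with $\psi=e^{i\lambda b_1x}+r_ke^{-i\lambda b_1x}$ for $x<0$, $\psi=t_ke^{i\lambda b_1x}$ for $x>k$. For $\operatorname{Im}\lambda>0$, $r(\lambda)$ is defined by the solution of $P_\infty\psi=\lambda^2\psi$ with $\psi=e^{i\lambda b_1x}+re^{-i\lambda b_1x}$ for $x<0$ and $\psi=c\,\psi^+(\lambda,x)$ for $x>0$, where $\psi^+$ is the solution of $P\psi^+=\lambda^2\psi^+$ in $L^2(\mathbb{R}_+)$ with $\psi^+(\lambda,0)=1$; for real $\lambda$, $r(\lambda)$ is defined by continuity from the upper half plane. At $\lambda=0$ the coefficients are understood by continuity. With $\rho=\frac{b_1^2+b_2^2}{2b_1b_2}$ the Lyapunov function of $P$ is $F(\lambda)=\frac{\rho+1}{2}\cos\{\lambda(x_2b_2+(1-x_2)b_1)\}-\frac{\rho-1}{2}\cos\{\lambda(x_2b_2-(1-x_2)b_1)\}$,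 which under $b_2x_2=b_1(1-x_2)$ equals $(\rho+1)\cos^2(\lambda b_2x_2)-\rho$. Put $d=\frac{b_2-b_1}{b_2+b_1}$ and $\eta=e^{2i\lambda b_2x_2}$. Under $b_2x_2=b_1(1-x_2)$ one has $r_1=\frac{d(1-\eta)}{1-d^2\eta}$ and $r_{k+1}=f_\lambda(r_k)$, where $$f_\lambda(z)=\frac{d+\eta\,\frac{-d+\eta z}{1-d\eta z}}{1+d\eta\,\frac{-d+\eta z}{1-d\eta z}}.$$ *)

theory Defs
  imports "HOL-Complex_Analysis.Complex_Analysis"
begin

definition coeff_per :: "real \<Rightarrow> real \<Rightarrow> real \<Rightarrow> real \<Rightarrow> real" where
  "coeff_per b1 b2 x2 x = (if frac x < x2 then 1 / b2\<^sup>2 else 1 / b1\<^sup>2)"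

definition coeff_fin :: "real \<Rightarrow> real \<Rightarrow> real \<Rightarrow> nat \<Rightarrow> real \<Rightarrow> real" where
  "coeff_fin b1 b2 x2 k x = (if 0 \<le> x \<and> x \<le> real k then coeff_per b1 b2 x2 x else 1 / b1\<^sup>2)"

definition coeff_half :: "real \<Rightarrow> real \<Rightarrow> real \<Rightarrow> real \<Rightarrow> real" where
  "coeff_half b1 b2 x2 x = (if 0 \<le> x then coeff_per b1 b2 x2 x else 1 / b1\<^sup>2)"

text \<open>Solutions on \<open>I\<close> of \<open>- (a \<psi>')' = \<mu>\<^sup>2 \<psi>\<close> with \<open>\<psi>\<close> and the flux \<open>a \<psi>'\<close> continuous.
  The flux is given as a function \<open>\<phi>\<close> that is continuous on all of \<open>I\<close>; the differential equations
  are imposed at the points where \<open>a\<close> is continuous, so at a jump of \<open>a\<close> the value of \<open>\<phi>\<close> is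
  the common one-sided limit of \<open>a \<psi>'\<close>.\<close>

definition is_solution ::
  "(real \<Rightarrow> real) \<Rightarrow> complex \<Rightarrow> real set \<Rightarrow> (real \<Rightarrow> complex) \<Rightarrow> bool" where
  "is_solution a \<mu> I \<psi> \<longleftrightarrow>
     continuous_on I \<psi> \<and>
     (\<exists>\<phi>. continuous_on I \<phi> \<and>
        (\<forall>x\<in>I. isCont a x \<longrightarrow>
           (\<exists>\<psi>'. (\<psi> has_vector_derivative \<psi>') (at x within I) \<and> \<phi> x = of_real (a x) * \<psi>') \<and>
           (\<phi> has_vector_derivative (- (\<mu>\<^sup>2 * \<psi> x))) (at x within I)))"

definition plane_wave :: "real \<Rightarrow> complex \<Rightarrow> real \<Rightarrow> complex" where
  "plane_wave b \<mu> x = exp (\<i> * \<mu> * of_real b * of_real x)"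

definition is_scattering_fin ::
  "real \<Rightarrow> real \<Rightarrow> real \<Rightarrow> nat \<Rightarrow> real \<Rightarrow> complex \<Rightarrow> complex \<Rightarrow> bool" where
  "is_scattering_fin b1 b2 x2 k \<mu> r t \<longleftrightarrow>
     (\<exists>\<psi>. is_solution (coeff_fin b1 b2 x2 k) (of_real \<mu>) UNIV \<psi> \<and>
        (\<forall>x<0. \<psi> x = plane_wave b1 (of_real \<mu>) x + r * plane_wave b1 (- of_real \<mu>) x) \<and>
        (\<forall>x>real k. \<psi> x = t * plane_wave b1 (of_real \<mu>) x))"

text \<open>At \<open>\<mu> = 0\<close> the two plane waves coincide and do not determine the coefficient, hence the limit.\<close>

definition refl_fin :: "real \<Rightarrow> real \<Rightarrow> real \<Rightarrow> nat \<Rightarrow> real \<Rightarrow> complex" where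
  "refl_fin b1 b2 x2 k \<mu> =
     (let R = (\<lambda>\<nu>. THE r. \<exists>t. is_scattering_fin b1 b2 x2 k \<nu> r t)
      in if \<mu> = 0 then Lim (at 0) R else R \<mu>)"

definition is_decaying_solution ::
  "real \<Rightarrow> real \<Rightarrow> real \<Rightarrow> complex \<Rightarrow> (real \<Rightarrow> complex) \<Rightarrow> bool" where
  "is_decaying_solution b1 b2 x2 \<mu> \<psi> \<longleftrightarrow>
     is_solution (coeff_per b1 b2 x2) \<mu> {0..} \<psi> \<and>
     set_integrable lborel {0..} (\<lambda>x. (cmod (\<psi> x))\<^sup>2) \<and> \<psi> 0 = 1"

definition is_scattering_half ::
  "real \<Rightarrow> real \<Rightarrow> real \<Rightarrow> complex \<Rightarrow> complex \<Rightarrow> bool" where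
  "is_scattering_half b1 b2 x2 \<mu> r \<longleftrightarrow>
     (\<exists>\<psi> \<psi>\<^sub>p c. is_solution (coeff_half b1 b2 x2) \<mu> UNIV \<psi> \<and>
        is_decaying_solution b1 b2 x2 \<mu> \<psi>\<^sub>p \<and>
        (\<forall>x<0. \<psi> x = plane_wave b1 \<mu> x + r * plane_wave b1 (- \<mu>) x) \<and>
        (\<forall>x>0. \<psi> x = c * \<psi>\<^sub>p x))"

definition refl_half_upper :: "real \<Rightarrow> real \<Rightarrow> real \<Rightarrow> complex \<Rightarrow> complex" where
  "refl_half_upper b1 b2 x2 \<mu> = (THE r. is_scattering_half b1 b2 x2 \<mu> r)"

definition refl_half :: "real \<Rightarrow> real \<Rightarrow> real \<Rightarrow> real \<Rightarrow> complex" where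
  "refl_half b1 b2 x2 \<mu> =
     Lim (at (of_real \<mu>) within {\<nu>. Im \<nu> > 0}) (refl_half_upper b1 b2 x2)"

definition lyapunov :: "real \<Rightarrow> real \<Rightarrow> real \<Rightarrow> real \<Rightarrow> real" where
  "lyapunov b1 b2 x2 \<mu> =
     (let \<rho> = (b1\<^sup>2 + b2\<^sup>2) / (2 * b1 * b2)
      in (\<rho> + 1) / 2 * cos (\<mu> * (x2 * b2 + (1 - x2) * b1))
         - (\<rho> - 1) / 2 * cos (\<mu> * (x2 * b2 - (1 - x2) * b1)))"

text \<open>For real \<open>\<mu>\<close> we have \<open>\<bar>\<eta>\<bar> = 1\<close> and \<open>\<bar>d\<bar> < 1\<close>, so no denominator vanishes when \<open>cmod z \<le> 1\<close>.\<close>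

definition disk_map :: "real \<Rightarrow> real \<Rightarrow> real \<Rightarrow> real \<Rightarrow> complex \<Rightarrow> complex" where
  "disk_map b1 b2 x2 \<mu> z =
     (let d = complex_of_real ((b2 - b1) / (b2 + b1));
          \<eta> = exp (2 * \<i> * of_real (\<mu> * b2 * x2));
          w = (- d + \<eta> * z) / (1 - d * \<eta> * z)
      in (d + \<eta> * w) / (1 + d * \<eta> * w))"

end

theory Submission imports Defs begin

text \<open>In a layer where the coefficient is \<open>1 / b\<^sup>2\<close>, the combinations \<open>\<i> \<mu> \<psi> + b \<phi>\<close> and
  \<open>\<i> \<mu> \<psi> - b \<phi>\<close> of a solution and its flux are pure exponentials, so crossing one period acts on the
  pair of amplitudes by a matrix and on their quotient by the Moebius map \<open>f\<close>. Hence \<open>r\<^sub>k\<close> is the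
  \<open>k\<close>-th iterate of \<open>f\<close> at \<open>0\<close>. For \<open>Im \<mu> > 0\<close> the map sends the closed disk into itself; Brouwer's
  theorem gives a fixed point there, whose multiplier has modulus below \<open>1\<close>, which makes the
  corresponding solution square integrable. As the period matrix has determinant \<open>1\<close>, the Wronskian
  of two square integrable solutions is constant along the periods and tends to \<open>0\<close>; so this fixed
  point is the reflection coefficient of the half-infinite medium. For real \<open>\<mu>\<close> the fixed points are
  \<open>exp (- \<i> \<theta>) (cos \<theta> + \<i> s) / d\<close> with \<open>s\<^sup>2 = d\<^sup>2 - cos\<^sup>2 \<theta>\<close>. The bound on the multiplier passes to the
  limit \<open>Im \<mu> \<rightarrow> 0\<close> and selects the attracting one of them, to which the iterates converge.\<close>

subsection \<open>The Moebius map of one period\<close>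

text \<open>For a real frequency in a gap both fixed points lie on the unit circle, so
  \<open>cmod r \<le> 1\<close> cannot tell them apart, and \<open>r\<close> is known there only as
  a limit. What separates them is the factor by which the amplitudes change from one cell to the
  next. Its bound \<open>cmod (\<eta> * (1 - d\<^sup>2)) \<le> cmod (cell_den d \<eta> 1 z)\<close>
  is a closed condition and therefore survives the passage to the real axis. The source of the bound
  is the indefinite form |p|^2 - |q|^2 of the two amplitudes: an interface preserves it up to a
  constant factor, and a layer with \<open>cmod \<eta> < 1\<close> can only increase it from right
  to left. The quotient alone forgets the scale of the amplitudes, which is needed to build
  solutions and to prove decay; hence homogeneous coordinates accompany the Moebius map. Equal
  layers (\<open>d = 0\<close>) stand apart: the fixed point equation is no longer quadratic and the
  interfaces become points of continuity.\<close>

definition cell_num :: "complex \<Rightarrow> complex \<Rightarrow> complex \<Rightarrow> complex \<Rightarrow> complex" where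
  "cell_num d \<eta> p q = d * (1 - \<eta>) * p + \<eta> * (\<eta> - d\<^sup>2) * q"

text \<open>If \<open>p\<close> and \<open>q\<close> are the amplitudes of the right-going and
  left-going waves at the right end of a cell, then \<open>cell_den\<close> and
  \<open>cell_num\<close> are those at its left end, multiplied by
  \<open>\<eta> * (1 - d\<^sup>2)\<close>. Leaving this factor out keeps both polynomial in
  \<open>\<eta>\<close>.\<close>

definition cell_den :: "complex \<Rightarrow> complex \<Rightarrow> complex \<Rightarrow> complex \<Rightarrow> complex" where
  "cell_den d \<eta> p q = (1 - d\<^sup>2 * \<eta>) * p - d * \<eta> * (1 - \<eta>) * q"

text \<open>The nested form of \<open>disk_map\<close> is kept so that both maps agree even where a
  denominator vanishes: fixed points are later determined in the whole plane.\<close>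

definition cell_map :: "complex \<Rightarrow> complex \<Rightarrow> complex \<Rightarrow> complex" where
  "cell_map d \<eta> z =
     (let w = (- d + \<eta> * z) / (1 - d * \<eta> * z) in (d + \<eta> * w) / (1 + d * \<eta> * w))"

lemma cell_den_scale: "cell_den d \<eta> (c * p) (c * q) = c * cell_den d \<eta> p q"
  by (simp add: cell_den_def algebra_simps)

lemma cell_num_scale: "cell_num d \<eta> (c * p) (c * q) = c * cell_num d \<eta> p q"
  by (simp add: cell_num_def algebra_simps)

text \<open>Determinant of the period matrix. Dividing both components by
  \<open>\<eta> * (1 - d\<^sup>2)\<close> makes it 1, which keeps Wronskians constant from cell to
  cell.\<close>

lemma cell_wronskian:
  fixes p q p' q' :: complex
  shows "cell_den d \<eta> p q * cell_num d \<eta> p' q' - cell_num d \<eta> p q * cell_den d \<eta> p' q'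
     = (\<eta> * (1 - d\<^sup>2))\<^sup>2 * (p * q' - q * p')"
  by (simp add: cell_num_def cell_den_def algebra_simps power2_eq_square)

text \<open>For |d| < 1 the matrix with rows (1, d) and (d, 1) is a multiple of a hyperbolic
  rotation, so it preserves the indefinite form up to its determinant. This is the effect of one
  interface.\<close>

lemma cmod_mix_diff:
  fixes d :: real and a b :: complex
  shows "(cmod (a + d * b))\<^sup>2 - (cmod (d * a + b))\<^sup>2 = (1 - d\<^sup>2) * ((cmod a)\<^sup>2 - (cmod b)\<^sup>2)"
  unfolding cmod_power2 by (simp add: power2_eq_square algebra_simps)

lemma mix_nonzero:
  fixes d :: real and \<zeta> :: complex
  assumes "\<bar>d\<bar> < 1" "cmod \<zeta> \<le> 1"
  shows "1 + d * \<zeta> \<noteq> 0"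
proof
  assume "1 + d * \<zeta> = 0"
  then have "cmod (d * \<zeta>) = 1" by (metis add_eq_0_iff norm_minus_cancel norm_one)
  then have "\<bar>d\<bar> * cmod \<zeta> = 1" by (simp add: norm_mult)
  moreover have "\<bar>d\<bar> * cmod \<zeta> \<le> \<bar>d\<bar> * 1" using assms(2) by (intro mult_left_mono) auto
  ultimately show False using assms(1) by simp
qed

lemma cmod_blaschke_le:
  fixes d :: real and \<zeta> :: complex
  assumes "\<bar>d\<bar> < 1" "cmod \<zeta> \<le> 1"
  shows "cmod ((d + \<zeta>) / (1 + d * \<zeta>)) \<le> 1"
proof -
  have "0 \<le> (1 - d\<^sup>2) * ((cmod 1)\<^sup>2 - (cmod \<zeta>)\<^sup>2)"
    using assms by (intro mult_nonneg_nonneg) (auto simp: abs_square_le_1 power_le_one)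
  then have "(cmod (d + \<zeta>))\<^sup>2 \<le> (cmod (1 + d * \<zeta>))\<^sup>2"
    using cmod_mix_diff[of 1 d \<zeta>] unfolding mult_1_right by linarith
  then have "cmod (d + \<zeta>) \<le> cmod (1 + d * \<zeta>)" by (rule power2_le_imp_le) simp
  then show ?thesis using mix_nonzero[OF assms] by (simp add: norm_divide)
qed

lemma cmod_blaschke_less:
  fixes d :: real and \<zeta> :: complex
  assumes "\<bar>d\<bar> < 1" "cmod \<zeta> < 1"
  shows "cmod ((d + \<zeta>) / (1 + d * \<zeta>)) < 1"
proof -
  have "0 < (1 - d\<^sup>2) * ((cmod 1)\<^sup>2 - (cmod \<zeta>)\<^sup>2)"
    using assms by (intro mult_pos_pos) (auto simp: abs_square_less_1 power_less_one_iff)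
  then have "(cmod (d + \<zeta>))\<^sup>2 < (cmod (1 + d * \<zeta>))\<^sup>2"
    using cmod_mix_diff[of 1 d \<zeta>] unfolding mult_1_right by linarith
  then have "cmod (d + \<zeta>) < cmod (1 + d * \<zeta>)" by (rule power2_less_imp_less) simp
  then show ?thesis using mix_nonzero[of d \<zeta>] assms by (simp add: norm_divide)
qed

context
  fixes d :: real and \<eta> :: complex
  assumes d: "\<bar>d\<bar> < 1" and \<eta>: "cmod \<eta> \<le> 1"
begin

lemma cell_map_nonzero1: "cmod z \<le> 1 \<Longrightarrow> 1 - d * \<eta> * z \<noteq> 0"
  using mix_nonzero[of "- d" "\<eta> * z"] d \<eta> mult_mono[of "cmod \<eta>" 1 "cmod z" 1]
  by (simp add: norm_mult mult.assoc)

lemma cmod_cell_inner_le: "cmod z \<le> 1 \<Longrightarrow> cmod (\<eta> * ((- of_real d + \<eta> * z) / (1 - d * \<eta> * z))) \<le> 1"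
proof -
  assume z: "cmod z \<le> 1"
  have "cmod ((- of_real d + \<eta> * z) / (1 - d * \<eta> * z)) \<le> 1"
    using cmod_blaschke_le[of "- d" "\<eta> * z"] d z \<eta> mult_mono[of "cmod \<eta>" 1 "cmod z" 1]
    by (simp add: norm_mult mult.assoc)
  then show ?thesis unfolding norm_mult using \<eta> by (intro mult_le_one) auto
qed

lemma cell_map_nonzero2:
  "cmod z \<le> 1 \<Longrightarrow> 1 + d * \<eta> * ((- of_real d + \<eta> * z) / (1 - d * \<eta> * z)) \<noteq> 0"
  using mix_nonzero[OF d cmod_cell_inner_le] by (simp add: mult.assoc)

lemma cell_den_factor:
  "1 - d * \<eta> * z \<noteq> 0 \<Longrightarrow>
    cell_den d \<eta> 1 z = (1 - d * \<eta> * z) * (1 + d * \<eta> * ((- of_real d + \<eta> * z) / (1 - d * \<eta> * z)))"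
  by (simp add: cell_den_def field_simps power2_eq_square)

lemma cell_den_nonzero: "cmod z \<le> 1 \<Longrightarrow> cell_den d \<eta> 1 z \<noteq> 0"
  using cell_den_factor cell_map_nonzero1 cell_map_nonzero2 by auto

lemma cell_num_factor:
  "1 - d * \<eta> * z \<noteq> 0 \<Longrightarrow>
    cell_num d \<eta> 1 z = (1 - d * \<eta> * z) * (d + \<eta> * ((- of_real d + \<eta> * z) / (1 - d * \<eta> * z)))"
  by (simp add: cell_num_def field_simps power2_eq_square)

lemma cell_map_eq:
  assumes "1 - d * \<eta> * z \<noteq> 0"
  shows "cell_map d \<eta> z = cell_num d \<eta> 1 z / cell_den d \<eta> 1 z"
  unfolding cell_den_factor[OF assms] cell_num_factor[OF assms] cell_map_def Let_def
  using assms by simp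

lemma cell_map_eq_disk: "cmod z \<le> 1 \<Longrightarrow> cell_map d \<eta> z = cell_num d \<eta> 1 z / cell_den d \<eta> 1 z"
  by (rule cell_map_eq[OF cell_map_nonzero1])

lemma cell_map_le: "cmod z \<le> 1 \<Longrightarrow> cmod (cell_map d \<eta> z) \<le> 1"
  using cmod_blaschke_le[OF d cmod_cell_inner_le] by (simp add: cell_map_def Let_def mult.assoc)

lemma cell_map_less: "cmod z < 1 \<Longrightarrow> cmod (cell_map d \<eta> z) < 1"
proof -
  assume z: "cmod z < 1"
  have 1: "cmod (\<eta> * y) < 1" if "cmod y < 1" for y
  proof -
    have "cmod \<eta> * cmod y \<le> 1 * cmod y" using \<eta> by (intro mult_right_mono) auto
    then show ?thesis using that by (simp add: norm_mult)
  qed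
  have "cmod ((- of_real d + \<eta> * z) / (1 - d * \<eta> * z)) < 1"
    using cmod_blaschke_less[of "- d" "\<eta> * z"] d 1[OF z] by (simp add: mult.assoc)
  from cmod_blaschke_less[OF d 1[OF this]] show ?thesis
    by (simp add: cell_map_def Let_def mult.assoc)
qed

lemma cell_map_iter_less: "cmod ((cell_map d \<eta> ^^ k) 0) < 1"
  by (induction k) (auto intro: cell_map_less)

lemma cell_num_minus:
  "cell_num d \<eta> 1 z - z * cell_den d \<eta> 1 z = (1 - \<eta>) * (d - (1 + \<eta>) * z + d * \<eta> * z\<^sup>2)"
  by (simp add: cell_num_def cell_den_def algebra_simps power2_eq_square)

text \<open>The two junk cases \<open>x / 0 = 0\<close> of the map produce no spurious fixed point.\<close>

lemma cell_map_fixed_iff: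
  assumes "\<eta> \<noteq> 1"
  shows "cell_map d \<eta> z = z \<longleftrightarrow> d - (1 + \<eta>) * z + d * \<eta> * z\<^sup>2 = 0"
proof (cases "1 - d * \<eta> * z = 0")
  case True
  then have e: "d * \<eta> * z = 1" by simp
  \<comment> \<open>The inner quotient is \<open>0\<close> by the convention for division, so the
    map returns \<open>d\<close>. Both sides of the equivalence turn out to be false.\<close>
  have "cell_map d \<eta> z = d" using True by (simp add: cell_map_def)
  moreover have "d \<noteq> z"
  proof
    assume "d = z"
    then have "cmod (d * \<eta> * d) = 1" using e by simp
    moreover have "cmod z \<le> 1" using \<open>d = z\<close> d by auto
    ultimately show False using cell_map_nonzero1 e by simp
  qed
  moreover have "d - (1 + \<eta>) * z + d * \<eta> * z\<^sup>2 = d - \<eta> * z"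
    using e by (simp add: algebra_simps power2_eq_square)
  moreover have "d - \<eta> * z \<noteq> 0"
  proof
    assume "d - \<eta> * z = 0"
    then have "complex_of_real d * d = 1" using e by (simp add: mult.assoc)
    then have "d * d = 1" using of_real_eq_1_iff by (metis of_real_mult)
    then show False using d by (metis abs_square_less_1 less_irrefl power2_eq_square)
  qed
  ultimately show ?thesis by metis
next
  case False
  note eq = cell_map_eq[OF False]
  show ?thesis
  proof (cases "cell_den d \<eta> 1 z = 0")
    case True
    \<comment> \<open>Now the outer denominator vanishes and the value is \<open>0\<close> by
      convention. Again both sides are false: \<open>z\<close> is not \<open>0\<close>, and the
      nonzero numerator makes the polynomial nonzero.\<close>
    then have "cell_map d \<eta> z = 0" using eq by simp
    moreover have "z \<noteq> 0" using True cell_den_nonzero[of 0] by auto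
    moreover have "cell_num d \<eta> 1 z \<noteq> 0"
    proof
      assume n: "cell_num d \<eta> 1 z = 0"
      let ?w = "\<eta> * ((- of_real d + \<eta> * z) / (1 - d * \<eta> * z))"
      have "1 + d * ?w = 0" "d + ?w = 0"
        using True n False by (simp_all add: cell_den_factor cell_num_factor mult.assoc)
      then have "complex_of_real d * d = 1"
        by (metis add.commute add_eq_0_iff minus_mult_right neg_equal_iff_equal)
      then have "d * d = 1" using of_real_eq_1_iff by (metis of_real_mult)
      then show False using d by (metis abs_square_less_1 less_irrefl power2_eq_square)
    qed
    ultimately show ?thesis using cell_num_minus[of z] True by auto
  next
    case nz: False
    then have "cell_map d \<eta> z = z \<longleftrightarrow> cell_num d \<eta> 1 z - z * cell_den d \<eta> 1 z = 0"
      by (simp add: eq field_simps)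
    then show ?thesis using assms by (simp add: cell_num_minus)
  qed
qed

section \<open>Fixed points of the period map and their multipliers\<close>

lemma cell_den_prod_diff:
  "cell_num d \<eta> 1 w * cell_den d \<eta> 1 z - cell_num d \<eta> 1 z * cell_den d \<eta> 1 w
     = (\<eta> * (1 - d\<^sup>2))\<^sup>2 * (w - z)"
  by (simp add: cell_num_def cell_den_def algebra_simps power2_eq_square)

lemma cell_map_diff:
  assumes "cmod w \<le> 1" "cmod z \<le> 1" "cell_map d \<eta> z = z"
  shows "cell_map d \<eta> w - z = (\<eta> * (1 - d\<^sup>2))\<^sup>2 * (w - z) / (cell_den d \<eta> 1 w * cell_den d \<eta> 1 z)"
proof -
  have "cell_map d \<eta> w - z = cell_map d \<eta> w - cell_map d \<eta> z" using assms by simp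
  also have "\<dots> = (cell_num d \<eta> 1 w * cell_den d \<eta> 1 z - cell_num d \<eta> 1 z * cell_den d \<eta> 1 w)
     / (cell_den d \<eta> 1 w * cell_den d \<eta> 1 z)"
    using assms cell_den_nonzero by (simp add: cell_map_eq_disk field_simps)
  finally show ?thesis by (simp only: cell_den_prod_diff)
qed

text \<open>\<open>cmod_mix_diff\<close> is applied once for each of the two interfaces; the factor
  \<open>\<eta>\<close> between them is discarded, which only helps since
  \<open>cmod \<eta> \<le> 1\<close>.\<close>

lemma cell_den_cmod_diff:
  "(cmod (cell_den d \<eta> 1 z))\<^sup>2 - (cmod (cell_num d \<eta> 1 z))\<^sup>2 \<ge>
     (1 - d\<^sup>2)\<^sup>2 * (1 - (cmod (\<eta> * z))\<^sup>2)"
proof -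
  let ?X = "1 + of_real (- d) * (\<eta> * z)" and ?Y = "of_real (- d) * 1 + \<eta> * z"
  have D: "cell_den d \<eta> 1 z = ?X + d * (\<eta> * ?Y)" "cell_num d \<eta> 1 z = d * ?X + \<eta> * ?Y"
    by (simp_all add: cell_num_def cell_den_def algebra_simps power2_eq_square)
  have p: "0 \<le> 1 - d\<^sup>2" using d by (simp add: abs_square_le_1)
  have "cmod (\<eta> * ?Y) \<le> cmod ?Y"
    unfolding norm_mult using mult_right_mono[OF \<eta>, of "cmod ?Y"] by simp
  then have "(cmod (\<eta> * ?Y))\<^sup>2 \<le> (cmod ?Y)\<^sup>2" by (rule power_mono) simp
  then have "(cmod ?X)\<^sup>2 - (cmod (\<eta> * ?Y))\<^sup>2 \<ge> (cmod ?X)\<^sup>2 - (cmod ?Y)\<^sup>2" by simp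
  also have "(cmod ?X)\<^sup>2 - (cmod ?Y)\<^sup>2 = (1 - (- d)\<^sup>2) * ((cmod 1)\<^sup>2 - (cmod (\<eta> * z))\<^sup>2)"
    by (rule cmod_mix_diff)
  finally have "(1 - d\<^sup>2) * ((cmod ?X)\<^sup>2 - (cmod (\<eta> * ?Y))\<^sup>2)
     \<ge> (1 - d\<^sup>2) * ((1 - (- d)\<^sup>2) * ((cmod 1)\<^sup>2 - (cmod (\<eta> * z))\<^sup>2))"
    using p by (intro mult_left_mono)
  then show ?thesis unfolding D cmod_mix_diff
    by (simp add: power2_eq_square mult.assoc)
qed

text \<open>\<open>\<eta> * (1 - d\<^sup>2) / cell_den d \<eta> 1 z\<close> is the factor gained by
  amplitudes of ratio \<open>z\<close> across one cell from left to right. To see that its modulus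
  is below 1, insert the fixed point equation into \<open>cell_den_cmod_diff\<close> and note that 1
  - |\<eta> z|^2 exceeds |\<eta>|^2 (1 - |z|^2).\<close>

lemma cell_map_fixed_point:
  assumes \<eta>1: "cmod \<eta> < 1"
  obtains z where "cmod z < 1" "cell_map d \<eta> z = z"
    "cmod (\<eta> * (1 - d\<^sup>2)) < cmod (cell_den d \<eta> 1 z)"
proof -
  have lt: "cmod (cell_map d \<eta> z) < 1" if z: "cmod z \<le> 1" for z
  proof -
    have 1: "cmod (\<eta> * y) < 1" if "cmod y \<le> 1" for y
      using mult_mono[of "cmod \<eta>" "cmod \<eta>" "cmod y" 1] that \<eta>1 by (simp add: norm_mult)
    have "cmod ((- of_real d + \<eta> * z) / (1 - d * \<eta> * z)) \<le> 1"
      using cmod_blaschke_less[of "- d" "\<eta> * z"] d 1[OF z] by (simp add: mult.assoc)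
    from cmod_blaschke_less[OF d 1[OF this]] show ?thesis
      by (simp add: cell_map_def Let_def mult.assoc)
  qed
  have "\<exists>z\<in>cball 0 1. cell_map d \<eta> z = z"
  proof (rule brouwer)
    have "continuous_on (cball 0 1) (\<lambda>z. cell_num d \<eta> 1 z / cell_den d \<eta> 1 z)"
      using cell_den_nonzero unfolding cell_num_def cell_den_def
      by (intro continuous_intros) auto
    then show "continuous_on (cball 0 1) (cell_map d \<eta>)"
      by (subst continuous_on_cong[OF refl cell_map_eq_disk]) auto
    show "cell_map d \<eta> \<in> cball 0 1 \<rightarrow> cball 0 1" using cell_map_le by auto
  qed auto
  then obtain z where z1: "cmod z \<le> 1" and fp: "cell_map d \<eta> z = z" by auto
  have z: "cmod z < 1" using lt[OF z1] fp by simp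
  have N: "cell_num d \<eta> 1 z = z * cell_den d \<eta> 1 z"
    using fp cell_map_eq_disk[OF z1] cell_den_nonzero[OF z1] by (simp add: field_simps)
  have zz: "0 < 1 - (cmod z)\<^sup>2" using z by (simp add: abs_square_less_1)
  have "(cmod (cell_den d \<eta> 1 z))\<^sup>2 * (1 - (cmod z)\<^sup>2) \<ge> (1 - d\<^sup>2)\<^sup>2 * (1 - (cmod (\<eta> * z))\<^sup>2)"
    using cell_den_cmod_diff[of z] unfolding N by (simp add: norm_mult algebra_simps)
  moreover have "(1 - d\<^sup>2)\<^sup>2 * (1 - (cmod (\<eta> * z))\<^sup>2) > (1 - d\<^sup>2)\<^sup>2 * ((cmod \<eta>)\<^sup>2 * (1 - (cmod z)\<^sup>2))"
  proof (rule mult_strict_left_mono)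
    have "(cmod \<eta>)\<^sup>2 < 1" using \<eta>1 by (simp add: abs_square_less_1)
    then show "(cmod \<eta>)\<^sup>2 * (1 - (cmod z)\<^sup>2) < 1 - (cmod (\<eta> * z))\<^sup>2"
      by (simp add: norm_mult power_mult_distrib algebra_simps)
    have "d\<^sup>2 < 1" using d by (simp add: abs_square_less_1)
    then show "0 < (1 - d\<^sup>2)\<^sup>2" by simp
  qed
  ultimately have "((1 - d\<^sup>2)\<^sup>2 * (cmod \<eta>)\<^sup>2) * (1 - (cmod z)\<^sup>2) < (cmod (cell_den d \<eta> 1 z))\<^sup>2 * (1 - (cmod z)\<^sup>2)"
    by (simp add: mult.assoc)
  then have "(1 - d\<^sup>2)\<^sup>2 * (cmod \<eta>)\<^sup>2 < (cmod (cell_den d \<eta> 1 z))\<^sup>2"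
    using zz by (simp add: mult_less_cancel_right)
  moreover have "cmod (\<eta> * (1 - d\<^sup>2)) = cmod \<eta> * \<bar>1 - d\<^sup>2\<bar>"
    by (metis norm_mult norm_of_real of_real_1 of_real_diff of_real_power)
  ultimately have "(cmod (\<eta> * (1 - d\<^sup>2)))\<^sup>2 < (cmod (cell_den d \<eta> 1 z))\<^sup>2"
    by (simp add: power_mult_distrib mult.commute)
  then have "cmod (\<eta> * (1 - d\<^sup>2)) < cmod (cell_den d \<eta> 1 z)"
    by (rule power2_less_imp_less) simp
  then show thesis using that z fp by blast
qed

end

subsection \<open>Dynamics for real frequencies\<close>

text \<open>With \<eta> = e^2, e = \<open>cis \<theta>\<close>, and u = d e z, the fixed point
  equation becomes u^2 - 2 u cos \<theta> + d^2 = 0, so u = cos \<theta> + i s with s^2 = d^2 -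
  cos^2 \<theta>. A real \<open>s\<close> exists exactly if cos^2 \<theta> \<le> d^2; its sign
  distinguishes the two roots.\<close>

definition cell_fixpt :: "real \<Rightarrow> real \<Rightarrow> real \<Rightarrow> complex" where
  "cell_fixpt d \<theta> s = Complex (cos \<theta>) s / (d * cis \<theta>)"

context
  fixes d \<theta> s :: real and \<eta> :: complex
  assumes d: "\<bar>d\<bar> < 1" "d \<noteq> 0" and s: "s\<^sup>2 = d\<^sup>2 - (cos \<theta>)\<^sup>2" and \<eta>: "\<eta> = (cis \<theta>)\<^sup>2"
begin

lemma norm_cis_sq: "cmod \<eta> = 1"
  by (simp add: \<eta> norm_power)

lemma norm_cis_sq_le: "cmod \<eta> \<le> 1"
  by (simp add: norm_cis_sq)

lemma contrast_param_sq_less_1: "d\<^sup>2 < 1"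
  using d by (simp add: abs_square_less_1)

lemma sin_sq_minus_sq: "(sin \<theta>)\<^sup>2 - s\<^sup>2 = 1 - d\<^sup>2"
  using s sin_cos_squared_add[of \<theta>] by simp

lemma sin_nonzero_in_gap: "sin \<theta> \<noteq> 0"
proof
  assume "sin \<theta> = 0"
  then have "1 - d\<^sup>2 \<le> 0" unfolding sin_sq_minus_sq[symmetric] by simp
  then show False using contrast_param_sq_less_1 by simp
qed

lemma cis_sq_neq_1: "\<eta> \<noteq> 1"
proof
  assume "\<eta> = 1"
  then have "Re ((cis \<theta>)\<^sup>2) = 1" by (simp add: \<eta>)
  then have "(cos \<theta>)\<^sup>2 - (sin \<theta>)\<^sup>2 = 1" by (simp add: power2_eq_square)
  then have "(sin \<theta>)\<^sup>2 = 0" using sin_cos_squared_add[of \<theta>] by linarith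
  then show False using sin_nonzero_in_gap by simp
qed

lemma cmod_cell_fixpt: "cmod (cell_fixpt d \<theta> s) = 1" "cmod (cell_fixpt d \<theta> (- s)) = 1"
proof -
  have "cmod (Complex (cos \<theta>) s) = \<bar>d\<bar>" "cmod (Complex (cos \<theta>) (- s)) = \<bar>d\<bar>"
    using s by (simp_all add: cmod_def)
  then show "cmod (cell_fixpt d \<theta> s) = 1" "cmod (cell_fixpt d \<theta> (- s)) = 1"
    using d by (simp_all add: cell_fixpt_def norm_divide norm_mult)
qed

lemma cell_fixpt_scaled: "d * \<eta> * cell_fixpt d \<theta> t = cis \<theta> * (cos \<theta> + \<i> * t)"
  using d by (simp add: cell_fixpt_def \<eta> Complex_eq field_simps power2_eq_square)

lemma fixed_point_poly_factor:
  "d - (1 + \<eta>) * z + d * \<eta> * z\<^sup>2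
     = d * \<eta> * (z - cell_fixpt d \<theta> s) * (z - cell_fixpt d \<theta> (- s))"
proof -
  let ?e = "cis \<theta>" and ?C = "complex_of_real (cos \<theta>)" and ?S = "complex_of_real (sin \<theta>)"
  have e: "?e = ?C + \<i> * ?S" by (simp add: complex_eq_iff)
  have e1: "?e * (?C - \<i> * ?S) = 1"
    unfolding e using sin_cos_squared_add[of \<theta>]
    by (simp add: complex_eq_iff algebra_simps power2_eq_square)
  have s': "complex_of_real s ^ 2 = complex_of_real d ^ 2 - ?C ^ 2"
    using s by (metis of_real_diff of_real_power)
  have "d * \<eta> * (cell_fixpt d \<theta> s + cell_fixpt d \<theta> (- s)) = 2 * ?e * ?C"
    unfolding distrib_left cell_fixpt_scaled by (simp add: algebra_simps)
  also have "\<dots> = 1 + \<eta>" using e e1 unfolding \<eta> by algebra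
  finally have 1: "d * \<eta> * (cell_fixpt d \<theta> s + cell_fixpt d \<theta> (- s)) = 1 + \<eta>" .
  have "(d * \<eta>) * (d * \<eta> * (cell_fixpt d \<theta> s * cell_fixpt d \<theta> (- s)))
       = (d * \<eta> * cell_fixpt d \<theta> s) * (d * \<eta> * cell_fixpt d \<theta> (- s))" by simp
  also have "\<dots> = ?e\<^sup>2 * (?C\<^sup>2 + (complex_of_real s)\<^sup>2)"
    unfolding cell_fixpt_scaled by (simp add: algebra_simps power2_eq_square)
  also have "\<dots> = (d * \<eta>) * d" unfolding s' \<eta> by (simp add: power2_eq_square)
  finally have 2: "d * \<eta> * (cell_fixpt d \<theta> s * cell_fixpt d \<theta> (- s)) = d"
    using d norm_cis_sq by auto
  have "d * \<eta> * (z - cell_fixpt d \<theta> s) * (z - cell_fixpt d \<theta> (- s))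
     = d * \<eta> * z\<^sup>2 - d * \<eta> * (cell_fixpt d \<theta> s + cell_fixpt d \<theta> (- s)) * z
        + d * \<eta> * (cell_fixpt d \<theta> s * cell_fixpt d \<theta> (- s))"
    by (simp add: algebra_simps power2_eq_square)
  then show ?thesis unfolding 1 2 by simp
qed

lemma cell_map_fixed_points: "{z. cell_map d \<eta> z = z} = {cell_fixpt d \<theta> s, cell_fixpt d \<theta> (- s)}"
  using d norm_cis_sq
  by (auto simp: cell_map_fixed_iff[OF d(1) norm_cis_sq_le cis_sq_neq_1] fixed_point_poly_factor)

text \<open>After division by \<open>\<eta> * (1 - d\<^sup>2)\<close> this is an eigenvalue of the
  period matrix. It is real and negative, and the two of them add up to twice the Lyapunov function,
  in accordance with gaps where that function is below -1.\<close>

lemma cell_den_fixpt_aux: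
  assumes "t\<^sup>2 = d\<^sup>2 - (cos \<theta>)\<^sup>2"
  shows "cell_den d \<eta> 1 (cell_fixpt d \<theta> t) = - \<eta> * of_real ((sin \<theta> + t)\<^sup>2)"
proof -
  let ?e = "cis \<theta>" and ?C = "complex_of_real (cos \<theta>)" and ?S = "complex_of_real (sin \<theta>)"
  have e: "?e = ?C + \<i> * ?S" by (simp add: complex_eq_iff)
  have cs: "?C ^ 2 + ?S ^ 2 = 1"
    using sin_cos_squared_add2[of \<theta>] by (metis of_real_1 of_real_add of_real_power)
  have i2: "\<i> * \<i> = -1" by simp
  have t': "complex_of_real t ^ 2 = complex_of_real d ^ 2 - ?C ^ 2"
    using assms by (metis of_real_diff of_real_power)
  have "cell_den d \<eta> 1 (cell_fixpt d \<theta> t)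
     = 1 - d\<^sup>2 * \<eta> - (1 - \<eta>) * (d * \<eta> * cell_fixpt d \<theta> t)"
    by (simp add: cell_den_def)
  also have "\<dots> = 1 - d\<^sup>2 * ?e\<^sup>2 - (1 - ?e\<^sup>2) * (?e * (?C + \<i> * t))"
    by (simp only: cell_fixpt_scaled) (simp add: \<eta>)
  also have "\<dots> = - ?e\<^sup>2 * (?S + t)\<^sup>2"
    unfolding of_real_power using e cs i2 t' by algebra
  finally show ?thesis by (simp add: \<eta>)
qed

lemma cell_den_fixpt:
  "cell_den d \<eta> 1 (cell_fixpt d \<theta> s) = - \<eta> * of_real ((sin \<theta> + s)\<^sup>2)"
  "cell_den d \<eta> 1 (cell_fixpt d \<theta> (- s)) = - \<eta> * of_real ((sin \<theta> - s)\<^sup>2)"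
  using cell_den_fixpt_aux[OF s] cell_den_fixpt_aux[of "- s"] s by simp_all

text \<open>By \<open>sin_sq_minus_sq\<close> the two squares have geometric mean
  \<open>1 - d\<^sup>2\<close>, so it lies strictly between them as soon as they differ. The sign of
  \<open>s * sin \<theta>\<close> decides which one is larger.\<close>

lemma hyperbolic_sizes:
  assumes "s * sin \<theta> > 0"
  shows "(sin \<theta> - s)\<^sup>2 < 1 - d\<^sup>2" "1 - d\<^sup>2 < (sin \<theta> + s)\<^sup>2"
proof -
  let ?a = "(sin \<theta> - s)\<^sup>2" and ?b = "(sin \<theta> + s)\<^sup>2"
  have "?b - ?a = 4 * (s * sin \<theta>)" by (simp add: power2_eq_square algebra_simps)
  then have ab: "?a < ?b" using assms by linarith
  have "?a * ?b = ((sin \<theta>)\<^sup>2 - s\<^sup>2)\<^sup>2" by (simp add: power2_eq_square algebra_simps)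
  then have p: "?a * ?b = (1 - d\<^sup>2) * (1 - d\<^sup>2)"
    unfolding sin_sq_minus_sq by (simp only: power2_eq_square)
  have d1: "0 < 1 - d\<^sup>2" using contrast_param_sq_less_1 by simp
  show "?a < 1 - d\<^sup>2"
  proof (rule ccontr)
    assume "\<not> ?a < 1 - d\<^sup>2"
    then have "(1 - d\<^sup>2) * (1 - d\<^sup>2) < ?a * ?b" using ab d1 by (intro mult_le_less_imp_less) auto
    then show False using p by simp
  qed
  show "1 - d\<^sup>2 < ?b"
  proof (rule ccontr)
    assume "\<not> 1 - d\<^sup>2 < ?b"
    then have "?a * ?b < (1 - d\<^sup>2) * (1 - d\<^sup>2)"
      using ab d1 by (intro mult_less_le_imp_less) (auto intro: order_less_le_trans)
    then show False using p by simp
  qed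
qed

text \<open>In the coordinate (w - z) / (w - z'), built from the two fixed points, the map is
  multiplication by a constant \<open>K\<close> below 1.\<close>

lemma cell_map_iterates_tendsto_hyperbolic:
  assumes h: "s * sin \<theta> > 0"
  shows "(\<lambda>k. (cell_map d \<eta> ^^ k) 0) \<longlonglongrightarrow> cell_fixpt d \<theta> s"
proof -
  let ?z = "cell_fixpt d \<theta> s" and ?z' = "cell_fixpt d \<theta> (- s)"
  define w where "w = (\<lambda>k. (cell_map d \<eta> ^^ k) 0)"
  have w: "cmod (w k) < 1" for k
    unfolding w_def by (rule cell_map_iter_less[OF d(1) norm_cis_sq_le])
  have fp: "cell_map d \<eta> ?z = ?z" "cell_map d \<eta> ?z' = ?z'" using cell_map_fixed_points by auto
  note le = cmod_cell_fixpt[THEN eq_refl]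
  define K where "K = (sin \<theta> - s)\<^sup>2 / (sin \<theta> + s)\<^sup>2"
  have "0 < (sin \<theta> + s)\<^sup>2" using hyperbolic_sizes[OF h] contrast_param_sq_less_1 by linarith
  then have K: "0 \<le> K" "K < 1"
    using hyperbolic_sizes[OF h] unfolding K_def by (simp, subst divide_less_eq_1_pos) auto
  \<comment> \<open>The iterates stay inside the open disk and so never meet the repelling fixed
    point on the circle, where the coordinate is infinite.\<close>
  have neq: "w k \<noteq> ?z'" for k using w[of k] cmod_cell_fixpt by auto
  have step: "(w (Suc k) - ?z) / (w (Suc k) - ?z') = K * ((w k - ?z) / (w k - ?z'))" for k
  proof -
    have nz: "cell_den d \<eta> 1 (w k) \<noteq> 0" "cell_den d \<eta> 1 ?z \<noteq> 0" "cell_den d \<eta> 1 ?z' \<noteq> 0"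
      using cell_den_nonzero[OF d(1) norm_cis_sq_le] w[of k] le by (auto intro: less_imp_le)
    have dd: "(\<eta> * (1 - d\<^sup>2))\<^sup>2 \<noteq> 0"
      using norm_cis_sq contrast_param_sq_less_1 of_real_eq_1_iff[of "d\<^sup>2", where ?'a = complex] by (auto simp: norm_zero)
    have "(w (Suc k) - ?z) / (w (Suc k) - ?z')
       = cell_den d \<eta> 1 ?z' / cell_den d \<eta> 1 ?z * ((w k - ?z) / (w k - ?z'))"
      using cell_map_diff[OF d(1) norm_cis_sq_le less_imp_le[OF w[of k]] le(1) fp(1)]
        cell_map_diff[OF d(1) norm_cis_sq_le less_imp_le[OF w[of k]] le(2) fp(2)] nz dd neq[of k]
      by (simp add: w_def)
    also have "cell_den d \<eta> 1 ?z' / cell_den d \<eta> 1 ?z = K"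
      using norm_cis_sq unfolding cell_den_fixpt K_def by auto
    finally show ?thesis .
  qed
  have q: "(w k - ?z) / (w k - ?z') = K ^ k * (?z / ?z')" for k
    by (induction k) (simp_all only: step, simp_all add: w_def)
  have bound: "norm (w k - ?z) \<le> 2 * K ^ k" for k
  proof -
    have "w k - ?z = K ^ k * (?z / ?z') * (w k - ?z')"
      using q[of k] neq[of k] by (simp add: divide_eq_eq)
    then have "cmod (w k - ?z) = K ^ k * cmod (w k - ?z')"
      using K by (simp add: norm_mult norm_divide cmod_cell_fixpt norm_power)
    also have "\<dots> \<le> K ^ k * 2"
      using K norm_triangle_ineq4[of "w k" ?z'] w[of k] cmod_cell_fixpt by (intro mult_left_mono) auto
    finally show ?thesis by simp
  qed
  have "(\<lambda>k. 2 * K ^ k) \<longlonglongrightarrow> 0"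
    using K by (intro tendsto_mult_right_zero LIMSEQ_power_zero) auto
  then have "(\<lambda>k. w k - ?z) \<longlonglongrightarrow> 0"
    by (rule Lim_null_comparison[OF always_eventually[OF allI[OF bound]]])
  then show ?thesis unfolding w_def by (rule LIM_zero_cancel)
qed

text \<open>With a double fixed point the coordinate 1 / (w - z) replaces the previous one. In it
  the map is translation by a constant \<open>\<kappa>\<close>, so the iterates approach the fixed
  point like 1 / k.\<close>

lemma cell_map_iterates_tendsto_parabolic:
  assumes h: "s = 0"
  shows "(\<lambda>k. (cell_map d \<eta> ^^ k) 0) \<longlonglongrightarrow> cell_fixpt d \<theta> 0"
proof -
  let ?z = "cell_fixpt d \<theta> 0"
  define w where "w = (\<lambda>k. (cell_map d \<eta> ^^ k) 0)"
  have w: "cmod (w k) < 1" for k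
    unfolding w_def by (rule cell_map_iter_less[OF d(1) norm_cis_sq_le])
  have fp: "cell_map d \<eta> ?z = ?z" using cell_map_fixed_points h by auto
  have le: "cmod ?z \<le> 1" using cmod_cell_fixpt h by simp
  have neq: "w k \<noteq> ?z" for k using w[of k] cmod_cell_fixpt h by auto
  let ?D = "cell_den d \<eta> 1 ?z"
  have Dnz: "?D \<noteq> 0" using cell_den_nonzero[OF d(1) norm_cis_sq_le le] .
  have "(sin \<theta>)\<^sup>2 = 1 - d\<^sup>2" using sin_sq_minus_sq h by simp
  then have "?D = - \<eta> * (1 - d\<^sup>2)" using cell_den_fixpt h by simp
  \<comment> \<open>The multiplier at the fixed point is exactly 1; this makes the coefficient of 1
    / (w - z) in \<open>step\<close> equal to 1.\<close>
  then have det: "(\<eta> * (1 - d\<^sup>2))\<^sup>2 = ?D\<^sup>2" by simp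
  define \<kappa> where "\<kappa> = - d * \<eta> * (1 - \<eta>) / ?D"
  have \<kappa>: "\<kappa> \<noteq> 0" using Dnz d norm_cis_sq cis_sq_neq_1 by (auto simp: \<kappa>_def)
  have step: "1 / (w (Suc k) - ?z) = 1 / (w k - ?z) + \<kappa>" for k
  proof -
    have nz: "cell_den d \<eta> 1 (w k) \<noteq> 0"
      using cell_den_nonzero[OF d(1) norm_cis_sq_le] w[of k] by (auto intro: less_imp_le)
    have "w (Suc k) - ?z = ?D * (w k - ?z) / cell_den d \<eta> 1 (w k)"
      using cell_map_diff[OF d(1) norm_cis_sq_le less_imp_le[OF w[of k]] le fp] Dnz
      unfolding det by (simp add: w_def power2_eq_square)
    then have "1 / (w (Suc k) - ?z) = cell_den d \<eta> 1 (w k) / (?D * (w k - ?z))" by simp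
    also have "cell_den d \<eta> 1 (w k) = ?D - d * \<eta> * (1 - \<eta>) * (w k - ?z)"
      by (simp add: cell_den_def algebra_simps)
    finally show ?thesis using neq[of k] Dnz by (simp add: \<kappa>_def diff_divide_distrib)
  qed
  have q: "1 / (w k - ?z) = - (1 / ?z) + of_nat k * \<kappa>" for k
    by (induction k) (simp_all only: step, simp_all add: w_def algebra_simps)
  \<comment> \<open>Numerator and denominator of w k - z are divided by \<open>k\<close> so that
    both have finite limits.\<close>
  have "(\<lambda>k. inverse (of_nat k) / (inverse (of_nat k) * (- (1 / ?z)) + \<kappa>)) \<longlonglongrightarrow> 0 / (0 * (- (1 / ?z)) + \<kappa>)"
    using \<kappa> by (intro tendsto_intros lim_inverse_n) auto
  moreover have "eventually (\<lambda>k. inverse (of_nat k) / (inverse (of_nat k) * (- (1 / ?z)) + \<kappa>) = w k - ?z) sequentially"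
    using eventually_gt_at_top[of 0]
  proof eventually_elim
    case (elim k)
    have "w k - ?z = 1 / (- (1 / ?z) + of_nat k * \<kappa>)" unfolding q[symmetric] by simp
    also have "\<dots> = inverse (of_nat k) / (inverse (of_nat k) * (- (1 / ?z) + of_nat k * \<kappa>))"
      using elim by (simp add: mult_divide_mult_cancel_left_if[symmetric])
    also have "inverse (of_nat k) * (- (1 / ?z) + of_nat k * \<kappa>) = inverse (of_nat k) * (- (1 / ?z)) + \<kappa>"
      using elim by (simp only: distrib_left) (simp add: field_simps)
    finally show ?case by simp
  qed
  ultimately have "(\<lambda>k. w k - ?z) \<longlonglongrightarrow> 0" by (simp add: tendsto_cong)
  then show ?thesis unfolding w_def by (rule LIM_zero_cancel)
qed

text \<open>Comparing the equation for \<open>h x\<close> with the one for \<open>\<eta>\<close>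
  bounds the product of the distances of \<open>z x\<close> to the two limiting fixed points by a
  multiple of \<open>cmod (h x - \<eta>)\<close>. For \<open>s = 0\<close> the product is a square.
  Otherwise the multiplier bound keeps \<open>z x\<close> away from the repelling point, so the
  other distance tends to 0.\<close>

lemma cell_fixpt_tendsto:
  fixes h z :: "'b \<Rightarrow> complex"
  assumes s0: "s = 0 \<or> s * sin \<theta> > 0"
    and \<eta>t: "(h \<longlongrightarrow> \<eta>) F"
    and zev: "eventually (\<lambda>x. cmod (z x) < 1 \<and> d - (1 + h x) * z x + d * h x * (z x)\<^sup>2 = 0
                 \<and> cmod (h x * (1 - d\<^sup>2)) \<le> cmod (cell_den d (h x) 1 (z x))) F"
  shows "(z \<longlongrightarrow> cell_fixpt d \<theta> s) F"
proof -
  let ?z = "cell_fixpt d \<theta> s" and ?z' = "cell_fixpt d \<theta> (- s)"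
  have dt: "((\<lambda>x. cmod (h x - \<eta>)) \<longlongrightarrow> 0) F"
    using \<eta>t tendsto_dist_iff[of h \<eta> F] by (simp add: dist_norm)
  have prod: "eventually (\<lambda>x. cmod (z x - ?z) * cmod (z x - ?z') \<le> 2 * cmod (h x - \<eta>) / \<bar>d\<bar>) F"
    using zev
  proof eventually_elim
    case (elim x)
    have "d * \<eta> * (z x - ?z) * (z x - ?z') =
        (d - (1 + \<eta>) * z x + d * \<eta> * (z x)\<^sup>2) - (d - (1 + h x) * z x + d * h x * (z x)\<^sup>2)"
      using elim fixed_point_poly_factor by simp
    also have "\<dots> = (h x - \<eta>) * (z x - d * (z x)\<^sup>2)" by (simp add: algebra_simps)
    finally have "\<bar>d\<bar> * (cmod (z x - ?z) * cmod (z x - ?z')) = cmod (h x - \<eta>) * cmod (z x - d * (z x)\<^sup>2)"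
      by (metis (no_types, lifting) norm_cis_sq mult.assoc mult.right_neutral norm_mult norm_of_real)
    also have "\<dots> \<le> cmod (h x - \<eta>) * 2"
    proof (rule mult_left_mono)
      have "cmod (d * (z x)\<^sup>2) \<le> 1"
        using elim d(1) by (simp add: norm_mult norm_power mult_le_one power_le_one)
      then show "cmod (z x - d * (z x)\<^sup>2) \<le> 2"
        using norm_triangle_ineq4[of "z x" "d * (z x)\<^sup>2"] elim by linarith
    qed simp
    finally show ?case using d by (simp add: field_simps)
  qed
  have pz: "((\<lambda>x. 2 * cmod (h x - \<eta>) / \<bar>d\<bar>) \<longlongrightarrow> 0) F"
    using tendsto_divide[OF tendsto_mult[OF tendsto_const[of 2] dt] tendsto_const[of "\<bar>d\<bar>"]] d by simp
  from s0 show ?thesis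
  proof
    assume s: "s = 0"
    then have "((\<lambda>x. (cmod (z x - ?z))\<^sup>2) \<longlongrightarrow> 0) F"
      using prod by (intro Lim_null_comparison[OF _ pz]) (simp add: power2_eq_square)
    then have "((\<lambda>x. sqrt ((cmod (z x - ?z))\<^sup>2)) \<longlongrightarrow> sqrt 0) F" by (rule tendsto_real_sqrt)
    then have "((\<lambda>x. cmod (z x - ?z)) \<longlongrightarrow> 0) F" by simp
    then show ?thesis using tendsto_dist_iff[of z ?z F] by (simp add: dist_norm)
  next
    assume hyp: "s * sin \<theta> > 0"
    \<comment> \<open>A lower bound for \<open>cmod (cell_den d \<eta> 1 (z x))\<close>: the assumed
      bound, less the cost of replacing \<open>h x\<close> by \<open>\<eta>\<close>, estimated
      uniformly in the unit disk.\<close>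
    define g where "g = (\<lambda>x. cmod (h x * (1 - d\<^sup>2))
        - (\<bar>d\<bar>\<^sup>2 * cmod (h x - \<eta>) + \<bar>d\<bar> * cmod (h x * (1 - h x) - \<eta> * (1 - \<eta>))))"
    have "(g \<longlongrightarrow> cmod (\<eta> * (1 - d\<^sup>2)) - (\<bar>d\<bar>\<^sup>2 * cmod (\<eta> - \<eta>) + \<bar>d\<bar> * cmod (\<eta> * (1 - \<eta>) - \<eta> * (1 - \<eta>)))) F"
      unfolding g_def by (intro tendsto_intros \<eta>t)
    moreover have "cmod (\<eta> * (1 - d\<^sup>2)) = 1 - d\<^sup>2"
    proof -
      have "\<eta> * (1 - d\<^sup>2) = \<eta> * of_real (1 - d\<^sup>2)" by simp
      then show ?thesis using norm_cis_sq contrast_param_sq_less_1 by (simp only: norm_mult norm_of_real) simp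
    qed
    ultimately have g: "(g \<longlongrightarrow> 1 - d\<^sup>2) F" by simp
    \<comment> \<open>Midpoint between the modulus of \<open>cell_den\<close> at \<open>?z'\<close>
      and the limit of \<open>g\<close>. In \<open>\<delta>\<close> it is combined with
      \<open>2 * \<bar>d\<bar>\<close>, a Lipschitz constant of \<open>cell_den\<close> in its last
      argument.\<close>
    define a where "a = (1 - d\<^sup>2 + (sin \<theta> - s)\<^sup>2) / 2"
    have a: "a < 1 - d\<^sup>2" "(sin \<theta> - s)\<^sup>2 < a" using hyperbolic_sizes[OF hyp] by (auto simp: a_def)
    define \<delta> where "\<delta> = (a - (sin \<theta> - s)\<^sup>2) / (2 * \<bar>d\<bar>)"
    have \<delta>: "\<delta> > 0" using a d by (simp add: \<delta>_def)
    have "eventually (\<lambda>x. cmod (z x - ?z') \<ge> \<delta>) F"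
      using zev order_tendstoD(1)[OF g a(1)]
    proof eventually_elim
      case (elim x)
      let ?c = "d\<^sup>2 * (h x - \<eta>) + d * (h x * (1 - h x) - \<eta> * (1 - \<eta>)) * z x"
      have "cell_den d \<eta> 1 (z x) = cell_den d (h x) 1 (z x) + ?c"
        by (simp add: cell_den_def algebra_simps)
      then have "cmod (cell_den d (h x) 1 (z x)) \<le> cmod (cell_den d \<eta> 1 (z x)) + cmod ?c"
        using norm_triangle_ineq4[of "cell_den d \<eta> 1 (z x)" ?c] by simp
      moreover have "cmod ?c \<le> \<bar>d\<bar>\<^sup>2 * cmod (h x - \<eta>) + \<bar>d\<bar> * cmod (h x * (1 - h x) - \<eta> * (1 - \<eta>))"
      proof (rule norm_triangle_le, rule add_mono)
        show "cmod (d * (h x * (1 - h x) - \<eta> * (1 - \<eta>)) * z x)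
          \<le> \<bar>d\<bar> * cmod (h x * (1 - h x) - \<eta> * (1 - \<eta>))"
          using elim by (simp add: norm_mult mult_left_le)
      qed (simp add: norm_mult norm_power)
      ultimately have "a < cmod (cell_den d \<eta> 1 (z x))" using elim unfolding g_def by linarith
      moreover have "cell_den d \<eta> 1 (z x) = cell_den d \<eta> 1 ?z' - d * (\<eta> * (1 - \<eta>) * (z x - ?z'))"
        by (simp add: cell_den_def algebra_simps)
      then have "cmod (cell_den d \<eta> 1 (z x)) \<le> cmod (cell_den d \<eta> 1 ?z') + cmod (d * (\<eta> * (1 - \<eta>) * (z x - ?z')))"
        using norm_triangle_ineq4 by metis
      moreover have "cmod (cell_den d \<eta> 1 ?z') = (sin \<theta> - s)\<^sup>2"
        unfolding cell_den_fixpt using norm_cis_sq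
        by (simp only: norm_mult norm_minus_cancel norm_of_real) simp
      moreover have "cmod (d * (\<eta> * (1 - \<eta>) * (z x - ?z'))) \<le> \<bar>d\<bar> * (2 * cmod (z x - ?z'))"
      proof -
        have "cmod (1 - \<eta>) \<le> 2" using norm_triangle_ineq4[of 1 \<eta>] norm_cis_sq by simp
        then show ?thesis unfolding norm_mult norm_of_real norm_cis_sq
          by (intro mult_left_mono) (auto intro: mult_right_mono)
      qed
      ultimately have "a - (sin \<theta> - s)\<^sup>2 \<le> cmod (z x - ?z') * (2 * \<bar>d\<bar>)"
        by (simp add: algebra_simps)
      then show ?case using d by (simp add: \<delta>_def pos_divide_le_eq)
    qed
    with prod have "eventually (\<lambda>x. cmod (z x - ?z) \<le> (2 * cmod (h x - \<eta>) / \<bar>d\<bar>) / \<delta>) F"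
    proof eventually_elim
      case (elim x)
      have "cmod (z x - ?z) * \<delta> \<le> cmod (z x - ?z) * cmod (z x - ?z')"
        using elim by (intro mult_left_mono) auto
      then show ?case using elim unfolding pos_le_divide_eq[OF \<delta>] by linarith
    qed
    moreover have "((\<lambda>x. (2 * cmod (h x - \<eta>) / \<bar>d\<bar>) / \<delta>) \<longlongrightarrow> 0) F"
      using tendsto_divide[OF pz tendsto_const[of \<delta>]] \<delta> by simp
    ultimately have "((\<lambda>x. z x - ?z) \<longlongrightarrow> 0) F" by (rule Lim_null_comparison)
    then show ?thesis by (rule LIM_zero_cancel)
  qed
qed

text \<open>Gives the word double its meaning: f z - z vanishes to second order. The argument is
  confined to the open set where neither denominator vanishes and the map is a quotient of affine
  functions.\<close>

lemma zorder_cell_map_parabolic: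
  assumes "s = 0"
  shows "zorder (\<lambda>z. cell_map d \<eta> z - z) (cell_fixpt d \<theta> 0) = 2"
proof -
  let ?z = "cell_fixpt d \<theta> 0"
  let ?S = "{z. 1 - d * \<eta> * z \<noteq> 0} \<inter> {z. cell_den d \<eta> 1 z \<noteq> 0}"
  let ?g = "\<lambda>z. (1 - \<eta>) * d * \<eta> / cell_den d \<eta> 1 z"
  have le: "cmod ?z \<le> 1" using cmod_cell_fixpt assms by simp
  show ?thesis
  proof (rule zorder_eqI)
    show "open ?S" unfolding cell_den_def
      by (intro open_Int open_Collect_neq continuous_intros)
    show "?z \<in> ?S"
      using cell_den_nonzero[OF d(1) norm_cis_sq_le le] cell_map_nonzero1[OF d(1) norm_cis_sq_le le] by simp
    show "?g holomorphic_on ?S" unfolding cell_den_def by (intro holomorphic_intros) (auto simp: cell_den_def)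
    show "?g ?z \<noteq> 0"
      using cell_den_nonzero[OF d(1) norm_cis_sq_le le] cis_sq_neq_1 d norm_cis_sq by auto
    fix w assume w: "w \<in> ?S" "w \<noteq> ?z"
    then have "cell_map d \<eta> w - w = (cell_num d \<eta> 1 w - w * cell_den d \<eta> 1 w) / cell_den d \<eta> 1 w"
      using cell_map_eq[OF d(1) norm_cis_sq_le, of w] by (simp add: field_simps)
    also have "\<dots> = ?g w * (w - ?z) powi 2"
      unfolding cell_num_minus[OF d(1) norm_cis_sq_le] fixed_point_poly_factor using assms
      by (simp add: power2_eq_square)
    finally show "cell_map d \<eta> w - w = ?g w * (w - ?z) powi 2" .
  qed
qed

end

subsection \<open>Solutions in piecewise constant media\<close>

text \<open>Exposes the flux that \<open>is_solution\<close> hides under a quantifier; the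
  amplitudes at an interface are formed from it.\<close>

definition solution_with_flux ::
  "(real \<Rightarrow> real) \<Rightarrow> complex \<Rightarrow> real set \<Rightarrow> (real \<Rightarrow> complex) \<Rightarrow> (real \<Rightarrow> complex) \<Rightarrow> bool" where
  "solution_with_flux a \<mu> I \<psi> \<phi> \<longleftrightarrow> continuous_on I \<psi> \<and> continuous_on I \<phi> \<and>
     (\<forall>x\<in>I. isCont a x \<longrightarrow>
        (\<psi> has_vector_derivative (\<phi> x / a x)) (at x within I) \<and> a x \<noteq> 0 \<and>
        (\<phi> has_vector_derivative (- (\<mu>\<^sup>2 * \<psi> x))) (at x within I))"

lemma is_solution_iff_flux:
  assumes "\<And>x. a x \<noteq> 0"
  shows "is_solution a \<mu> I \<psi> \<longleftrightarrow> (\<exists>\<phi>. solution_with_flux a \<mu> I \<psi> \<phi>)"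
proof -
  have "(\<exists>\<psi>'. (\<psi> has_vector_derivative \<psi>') F \<and> \<phi> x = of_real (a x) * \<psi>')
     \<longleftrightarrow> (\<psi> has_vector_derivative (\<phi> x / a x)) F" for \<phi> :: "real \<Rightarrow> complex" and x F
    using assms[of x] by (auto intro!: exI[of _ "\<phi> x / a x"])
  then show ?thesis using assms unfolding is_solution_def solution_with_flux_def by blast
qed

text \<open>With \<open>b\<close> of either sign this is the amplitude of the wave \<open>exp (\<i> \<mu> b x)\<close> in a layer
  where the coefficient is \<open>1 / b\<^sup>2\<close>, up to the factor \<open>2 \<i> \<mu>\<close>.\<close>

definition amp :: "real \<Rightarrow> complex \<Rightarrow> complex \<Rightarrow> complex \<Rightarrow> complex" where
  "amp b \<mu> u v = \<i> * \<mu> * u + b * v"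

lemma has_vector_derivative_exp_mult:
  "((\<lambda>x. exp (c * complex_of_real x)) has_vector_derivative c * exp (c * of_real x)) (at x within S)"
  by (rule has_vector_derivative_real_field) (auto intro!: derivative_eq_intros)

lemma isCont_if_locally_const:
  assumes "\<And>y. y \<in> {s<..<e} \<Longrightarrow> a y = (c::real)" "x \<in> {s<..<e::real}"
  shows "isCont a x"
proof -
  have "continuous_on {s<..<e} a" by (rule continuous_on_eq[OF continuous_on_const]) (simp add: assms)
  then show ?thesis using assms(2) by (simp add: continuous_on_eq_continuous_at)
qed

text \<open>Used in the contrapositive, to show that the coefficient is discontinuous at the
  interfaces.\<close>

lemma isCont_eq_left_const:
  assumes "isCont a (x::real)" "s < x" "\<And>y. y \<in> {s<..<x} \<Longrightarrow> a y = (c::real)"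
  shows "a x = c"
proof (rule tendsto_unique[of "at_left x"])
  show "(a \<longlongrightarrow> a x) (at_left x)"
    using assms(1) by (simp add: isCont_def filterlim_at_split)
  have "eventually (\<lambda>y. c = a y) (at_left x)"
    unfolding eventually_at_left[OF assms(2)] using assms by auto
  then show "(a \<longlongrightarrow> c) (at_left x)" by (rule Lim_transform_eventually[OF tendsto_const])
qed simp

text \<open>The equations \<psi>' = b^2 \<phi> and \<phi>' = - \<mu>^2 \<psi> give amp' = i \<mu> b
  amp, so multiplying by the inverse exponential leaves a constant.\<close>

lemma amp_transport:
  assumes sol: "solution_with_flux a \<mu> I \<psi> \<phi>" and sub: "{s..e} \<subseteq> I" and se: "s \<le> e" and b: "b \<noteq> 0"
    and a: "\<And>x. x \<in> {s<..<e} \<Longrightarrow> a x = 1 / b\<^sup>2"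
  shows "amp b \<mu> (\<psi> e) (\<phi> e) = exp (\<i> * \<mu> * b * (e - s)) * amp b \<mu> (\<psi> s) (\<phi> s)"
proof -
  define c where "c = \<i> * \<mu> * b"
  define g where "g = (\<lambda>x. exp (- c * complex_of_real x) * amp b \<mu> (\<psi> x) (\<phi> x))"
  have "continuous_on {s..e} \<psi>" "continuous_on {s..e} \<phi>"
    using sol sub by (auto simp: solution_with_flux_def intro: continuous_on_subset)
  then have cont: "continuous_on {s..e} g" unfolding g_def amp_def by (intro continuous_intros)
  have der: "(g has_derivative (\<lambda>h. 0)) (at x within {s..e})" if x: "x \<in> {s..e} - {s, e}" for x
  proof -
    have x': "x \<in> {s<..<e}" using x by auto
    have ic: "isCont a x" using isCont_if_locally_const[OF a x'] .
    have "x \<in> I" using x sub by auto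
    with ic sol have "(\<psi> has_vector_derivative (\<phi> x / a x)) (at x within I)"
        "(\<phi> has_vector_derivative (- (\<mu>\<^sup>2 * \<psi> x))) (at x within I)"
      by (auto simp: solution_with_flux_def)
    then have d: "(\<psi> has_vector_derivative (b\<^sup>2 * \<phi> x)) (at x within {s..e})"
        "(\<phi> has_vector_derivative (- (\<mu>\<^sup>2 * \<psi> x))) (at x within {s..e})"
      using has_vector_derivative_within_subset[OF _ sub] a[OF x'] b by (auto simp: mult.commute)
    have "(g has_vector_derivative (exp (- c * of_real x) * (\<i> * \<mu> * (b\<^sup>2 * \<phi> x) + b * (- (\<mu>\<^sup>2 * \<psi> x)))
         + (- c * exp (- c * of_real x)) * amp b \<mu> (\<psi> x) (\<phi> x))) (at x within {s..e})"
      unfolding g_def amp_def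
      by (intro has_vector_derivative_mult has_vector_derivative_add has_vector_derivative_exp_mult
           has_vector_derivative_mult_right d)
    moreover have "exp (- c * of_real x) * (\<i> * \<mu> * (b\<^sup>2 * \<phi> x) + b * (- (\<mu>\<^sup>2 * \<psi> x)))
         + (- c * exp (- c * of_real x)) * amp b \<mu> (\<psi> x) (\<phi> x) = 0"
      by (simp add: c_def amp_def algebra_simps power2_eq_square)
    ultimately show ?thesis by (simp add: has_vector_derivative_def)
  qed
  \<comment> \<open>At \<open>s\<close> and \<open>e\<close> the coefficient may jump and no
    derivative is known; continuity of \<open>g\<close> allows these two exceptional points.\<close>
  have "g e = g s"
    by (rule has_derivative_zero_unique_strong_interval[where k = "{s, e}", OF _ cont refl der]) (use se in auto)
  then have "exp (c * e) * g e = exp (c * e) * g s" by simp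
  then show ?thesis
    unfolding g_def mult.assoc[symmetric] exp_add[symmetric] by (simp add: c_def algebra_simps)
qed

text \<open>Assembles a solution from its layers, infinitely many if necessary.\<close>

lemma glue_continuous:
  fixes g :: "nat \<Rightarrow> real \<Rightarrow> 'a::topological_space" and t :: "nat \<Rightarrow> real"
  assumes t: "\<And>j. t j < t (Suc j)" and unb: "\<And>x. \<exists>j. x \<le> t j"
    and g: "\<And>j. continuous_on UNIV (g j)" and match: "\<And>j. g j (t j) = g (Suc j) (t j)"
  obtains G where "continuous_on UNIV G" "\<And>x. x \<le> t 0 \<Longrightarrow> G x = g 0 x"
    "\<And>j x. t j \<le> x \<Longrightarrow> x \<le> t (Suc j) \<Longrightarrow> G x = g (Suc j) x"
proof -
  \<comment> \<open>At a breakpoint \<open>LEAST\<close> selects the piece on the left; by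
    \<open>match\<close> the one on the right has the same value.\<close>
  define G where "G = (\<lambda>x. g (LEAST j. x \<le> t j) x)"
  have Z: "G x = g 0 x" if "x \<le> t 0" for x
    unfolding G_def using that by (subst Least_eq_0) auto
  have mono: "strict_mono t" using t by (simp add: strict_mono_Suc_iff)
  have S: "G x = g (Suc j) x" if "t j \<le> x" "x \<le> t (Suc j)" for j x
  proof (cases "x = t j")
    case True
    have "(LEAST i. x \<le> t i) = j"
      unfolding True using mono by (intro Least_equality) (auto simp: strict_mono_less_eq)
    then show ?thesis unfolding G_def using True match by simp
  next
    case False
    have "Suc j \<le> i" if i: "x \<le> t i" for i
    proof -
      have "t j < t i" using i False \<open>t j \<le> x\<close> by linarith
      then show ?thesis using mono by (simp add: strict_mono_less Suc_le_eq)
    qed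
    then have "(LEAST i. x \<le> t i) = Suc j" using that by (intro Least_equality) auto
    then show ?thesis unfolding G_def by simp
  qed
  have c: "continuous_on {..t n} G" for n
  proof (induction n)
    case 0
    show ?case using continuous_on_subset[OF g[of 0]]
      by (rule continuous_on_eq) (auto simp: Z)
  next
    case (Suc n)
    have "continuous_on {t n..t (Suc n)} G"
      using continuous_on_subset[OF g[of "Suc n"]] by (rule continuous_on_eq) (auto simp: S)
    then have "continuous_on ({..t n} \<union> {t n..t (Suc n)}) G"
      using Suc by (intro continuous_on_closed_Un) auto
    moreover have "{..t n} \<union> {t n..t (Suc n)} = {..t (Suc n)}" using t[of n] by auto
    ultimately show ?case by simp
  qed
  have "isCont G x" for x
  proof -
    obtain j where "x \<le> t j" using unb by blast
    then have x: "x \<in> {..<t (Suc j)}" using t[of j] by auto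
    have "continuous_on {..<t (Suc j)} G" by (rule continuous_on_subset[OF c[of "Suc j"]]) auto
    then show ?thesis using x by (simp add: continuous_on_eq_continuous_at)
  qed
  then have "continuous_on UNIV G" by (simp add: continuous_at_imp_continuous_on)
  then show thesis using that Z S by blast
qed

text \<open>The second component is the flux.\<close>

definition wave :: "real \<Rightarrow> complex \<Rightarrow> complex \<Rightarrow> complex \<Rightarrow> real \<Rightarrow> complex \<times> complex" where
  "wave b \<mu> p q y =
     ((p * exp (\<i> * \<mu> * b * y) + q * exp (- (\<i> * \<mu> * b * y))) / (2 * \<i> * \<mu>),
      (p * exp (\<i> * \<mu> * b * y) - q * exp (- (\<i> * \<mu> * b * y))) / (2 * b))"

lemma continuous_on_wave: "continuous_on UNIV (\<lambda>x. wave b \<mu> p q (x - x0))"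
  unfolding wave_def divide_inverse by (intro continuous_intros)

lemma amp_wave:
  assumes "b \<noteq> 0" "\<mu> \<noteq> 0"
  shows "amp b \<mu> (fst (wave b \<mu> p q y)) (snd (wave b \<mu> p q y)) = p * exp (\<i> * \<mu> * b * y)"
    "amp (- b) \<mu> (fst (wave b \<mu> p q y)) (snd (wave b \<mu> p q y)) = q * exp (- (\<i> * \<mu> * b * y))"
  using assms by (simp_all add: amp_def wave_def field_simps)

lemma amp_inject:
  assumes "b \<noteq> 0" "\<mu> \<noteq> 0" "amp b \<mu> u v = amp b \<mu> u' v'" "amp (- b) \<mu> u v = amp (- b) \<mu> u' v'"
  shows "u = u'" "v = v'"
proof -
  have "amp b \<mu> u v + amp (- b) \<mu> u v = amp b \<mu> u' v' + amp (- b) \<mu> u' v'"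
    "amp b \<mu> u v - amp (- b) \<mu> u v = amp b \<mu> u' v' - amp (- b) \<mu> u' v'"
    using assms(3,4) by simp_all
  then have "2 * (\<i> * \<mu> * u) = 2 * (\<i> * \<mu> * u')" "2 * (b * v) = 2 * (b * v')"
    unfolding amp_def by (simp_all add: algebra_simps)
  then show "u = u'" "v = v'" using assms(1,2) by simp_all
qed

lemma wave_amp:
  assumes "b \<noteq> 0" "\<mu> \<noteq> 0"
  shows "wave b \<mu> (amp b \<mu> u v) (amp (- b) \<mu> u v) 0 = (u, v)"
  using assms by (simp add: amp_def wave_def field_simps)

lemma wave_scale: "wave b \<mu> (c * p) (c * q) y = (c * fst (wave b \<mu> p q y), c * snd (wave b \<mu> p q y))"
  by (simp add: wave_def algebra_simps)

lemma amp_scale: "amp b \<mu> (c * u) (c * v) = c * amp b \<mu> u v"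
  by (simp add: amp_def algebra_simps)

text \<open>The differential equations are imposed only at continuity points of the coefficient, so
  at the jumps a glued wave needs nothing but continuity.\<close>

lemma solution_if_locally_wave:
  assumes cont: "continuous_on UNIV G" and \<mu>: "\<mu> \<noteq> 0"
    and loc: "\<And>x. x \<in> I \<Longrightarrow> isCont a x \<Longrightarrow>
      \<exists>s e b p q x0. x \<in> {s<..<e} \<and> b \<noteq> 0 \<and> a x = 1 / b\<^sup>2 \<and> (\<forall>y\<in>{s<..<e}. G y = wave b \<mu> p q (y - x0))"
  shows "solution_with_flux a \<mu> I (\<lambda>x. fst (G x)) (\<lambda>x. snd (G x))"
  unfolding solution_with_flux_def
proof (intro conjI ballI impI)
  show "continuous_on I (\<lambda>x. fst (G x))" "continuous_on I (\<lambda>x. snd (G x))"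
    using continuous_on_subset[OF cont, of I] by (auto intro: continuous_intros)
  fix x assume "x \<in> I" "isCont a x"
  from loc[OF this] obtain s e b p q x0 where x: "x \<in> {s<..<e}" and b: "b \<noteq> 0" and ax: "a x = 1 / b\<^sup>2"
    and G: "\<And>y. y \<in> {s<..<e} \<Longrightarrow> G y = wave b \<mu> p q (y - x0)" by blast
  show "a x \<noteq> 0" using ax b by simp
  define c where "c = \<i> * \<mu> * b"
  have e: "((\<lambda>y. exp (c * (complex_of_real y - of_real x0))) has_vector_derivative c * exp (c * (of_real x - of_real x0))) (at x)"
    for c by (rule has_vector_derivative_real_field[where f = "\<lambda>y. exp (c * (y - of_real x0))"])
      (auto intro!: derivative_eq_intros)
  have w: "wave b \<mu> p q (y - x0) =
     ((p * exp (c * (of_real y - of_real x0)) + q * exp ((- c) * (of_real y - of_real x0))) / (2 * \<i> * \<mu>),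
      (p * exp (c * (of_real y - of_real x0)) - q * exp ((- c) * (of_real y - of_real x0))) / (2 * b))" for y
    by (simp add: wave_def c_def)
  have "((\<lambda>y. fst (wave b \<mu> p q (y - x0))) has_vector_derivative
      (p * (c * exp (c * (of_real x - of_real x0))) + q * ((- c) * exp ((- c) * (of_real x - of_real x0)))) / (2 * \<i> * \<mu>)) (at x)"
    unfolding w fst_conv
    by (intro has_vector_derivative_divide has_vector_derivative_add has_vector_derivative_mult_right e)
  moreover have "(p * (c * exp (c * (of_real x - of_real x0))) + q * ((- c) * exp ((- c) * (of_real x - of_real x0)))) / (2 * \<i> * \<mu>)
     = snd (G x) / a x"
    using b \<mu> by (simp add: G[OF x] w ax c_def field_simps power2_eq_square)
  ultimately have d1: "((\<lambda>y. fst (wave b \<mu> p q (y - x0))) has_vector_derivative snd (G x) / a x) (at x)" by simp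
  have "((\<lambda>y. snd (wave b \<mu> p q (y - x0))) has_vector_derivative
      (p * (c * exp (c * (of_real x - of_real x0))) - q * ((- c) * exp ((- c) * (of_real x - of_real x0)))) / (2 * b)) (at x)"
    unfolding w snd_conv
    by (intro has_vector_derivative_divide has_vector_derivative_diff has_vector_derivative_mult_right e)
  moreover have "(p * (c * exp (c * (of_real x - of_real x0))) - q * ((- c) * exp ((- c) * (of_real x - of_real x0)))) / (2 * b)
     = - (\<mu>\<^sup>2 * fst (G x))"
    using b \<mu> by (simp add: G[OF x] w ax c_def field_simps power2_eq_square)
  ultimately have d2: "((\<lambda>y. snd (wave b \<mu> p q (y - x0))) has_vector_derivative - (\<mu>\<^sup>2 * fst (G x))) (at x)" by simp
  have "((\<lambda>y. fst (G y)) has_vector_derivative snd (G x) / a x) (at x)"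
    by (rule has_vector_derivative_transform_within_open[OF d1 open_greaterThanLessThan x]) (simp add: G)
  then show "((\<lambda>y. fst (G y)) has_vector_derivative snd (G x) / a x) (at x within I)"
    by (rule has_vector_derivative_at_within)
  have "((\<lambda>y. snd (G y)) has_vector_derivative - (\<mu>\<^sup>2 * fst (G x))) (at x)"
    by (rule has_vector_derivative_transform_within_open[OF d2 open_greaterThanLessThan x]) (simp add: G)
  then show "((\<lambda>y. snd (G y)) has_vector_derivative - (\<mu>\<^sup>2 * fst (G x))) (at x within I)"
    by (rule has_vector_derivative_at_within)
qed

text \<open>\<open>(u1, v1)\<close> is the state at the interface inside the cell,
  \<open>(u0, v0)\<close> that at the left end, and \<open>P\<close>, \<open>Q\<close> are the
  amplitudes at the right end. Value and flux are continuous, so crossing an interface merely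
  rewrites the same state in the amplitudes of the other layer, which is
  \<open>conv\<close>.\<close>

lemma cell_algebra:
  fixes b1 b2 :: real
  assumes b: "b1 > 0" "b2 > 0" and E: "E \<noteq> 0"
    and 1: "amp b1 \<mu> u1 v1 = P / E" "amp (- b1) \<mu> u1 v1 = Q * E"
    and 0: "amp b2 \<mu> u0 v0 = amp b2 \<mu> u1 v1 / E" "amp (- b2) \<mu> u0 v0 = amp (- b2) \<mu> u1 v1 * E"
    and d: "d = (b2 - b1) / (b2 + b1)"
  shows "amp b1 \<mu> u0 v0 = cell_den d (E\<^sup>2) P Q / (E\<^sup>2 * (1 - d\<^sup>2))"
    and "amp (- b1) \<mu> u0 v0 = cell_num d (E\<^sup>2) P Q / (E\<^sup>2 * (1 - d\<^sup>2))"
proof -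
  let ?b1 = "complex_of_real b1" and ?b2 = "complex_of_real b2" and ?d = "complex_of_real d"
  have nz: "?b1 \<noteq> 0" "?b2 \<noteq> 0" "?b2 + ?b1 \<noteq> 0"
    using b by (auto simp flip: of_real_add)
  have conv: "amp c \<mu> u v = ((b + c) * amp b \<mu> u v + (b - c) * amp (- b) \<mu> u v) / (2 * b)"
    if "b \<noteq> 0" for b c u v using that by (simp add: amp_def field_simps)
  have "d * (b2 + b1) = b2 - b1" using b by (simp add: d)
  then have d': "?d * (?b2 + ?b1) = ?b2 - ?b1" by (metis of_real_add of_real_diff of_real_mult)
  have d2: "(1 - ?d\<^sup>2) * (?b2 + ?b1)\<^sup>2 = 4 * ?b1 * ?b2"
    using d' by algebra
  have dnz: "1 - ?d\<^sup>2 \<noteq> 0"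
  proof
    assume "1 - ?d\<^sup>2 = 0"
    with d2 nz show False by simp
  qed
  have A: "amp b2 \<mu> u1 v1 = ((?b1 + ?b2) * (P / E) + (?b1 - ?b2) * (Q * E)) / (2 * ?b1)"
    "amp (- b2) \<mu> u1 v1 = ((?b1 - ?b2) * (P / E) + (?b1 + ?b2) * (Q * E)) / (2 * ?b1)"
    using conv[of b1 b2 u1 v1] conv[of b1 "- b2" u1 v1] b by (simp_all add: 1)
  have B: "amp b1 \<mu> u0 v0 = ((?b2 + ?b1) * (amp b2 \<mu> u1 v1 / E) + (?b2 - ?b1) * (amp (- b2) \<mu> u1 v1 * E)) / (2 * ?b2)"
    "amp (- b1) \<mu> u0 v0 = ((?b2 - ?b1) * (amp b2 \<mu> u1 v1 / E) + (?b2 + ?b1) * (amp (- b2) \<mu> u1 v1 * E)) / (2 * ?b2)"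
    using conv[of b2 b1 u0 v0] conv[of b2 "- b1" u0 v0] b by (simp_all add: 0)
  let ?s = "?b2 + ?b1"
  have dd: "?b1 - ?b2 = - (?d * ?s)" "?b1 + ?b2 = ?s" using d' by simp_all
  have A': "amp b2 \<mu> u1 v1 = ?s * (P / E - ?d * (Q * E)) / (2 * ?b1)"
    "amp (- b2) \<mu> u1 v1 = ?s * (Q * E - ?d * (P / E)) / (2 * ?b1)"
    unfolding A dd by (simp_all add: algebra_simps add_divide_distrib)
  \<comment> \<open>Collects the constants of the two changes of basis into the normalizing factor
    of the period matrix.\<close>
  have s2: "?s * ?s / (4 * ?b1 * ?b2) = 1 / (1 - ?d\<^sup>2)"
    using d2 dnz nz by (simp add: field_simps power2_eq_square)
  have "amp b1 \<mu> u0 v0 = ?s * (amp b2 \<mu> u1 v1 / E + ?d * (amp (- b2) \<mu> u1 v1 * E)) / (2 * ?b2)"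
    unfolding B d'[symmetric] by (simp add: algebra_simps add_divide_distrib)
  also have "\<dots> = (?s * ?s / (4 * ?b1 * ?b2)) * ((P / E - ?d * (Q * E)) / E + ?d * ((Q * E - ?d * (P / E)) * E))"
    unfolding A' using nz E by (simp add: field_simps)
  also have "\<dots> = cell_den d (E\<^sup>2) P Q / (E\<^sup>2 * (1 - d\<^sup>2))"
    unfolding s2 cell_den_def using E dnz by (simp add: field_simps power2_eq_square)
  finally show "amp b1 \<mu> u0 v0 = cell_den d (E\<^sup>2) P Q / (E\<^sup>2 * (1 - d\<^sup>2))" .
  have "amp (- b1) \<mu> u0 v0 = ?s * (?d * (amp b2 \<mu> u1 v1 / E) + amp (- b2) \<mu> u1 v1 * E) / (2 * ?b2)"
    unfolding B d'[symmetric] by (simp add: algebra_simps add_divide_distrib)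
  also have "\<dots> = (?s * ?s / (4 * ?b1 * ?b2)) * (?d * ((P / E - ?d * (Q * E)) / E) + (Q * E - ?d * (P / E)) * E)"
    unfolding A' using nz E by (simp add: field_simps)
  also have "\<dots> = cell_num d (E\<^sup>2) P Q / (E\<^sup>2 * (1 - d\<^sup>2))"
    unfolding s2 cell_num_def using E dnz by (simp add: field_simps power2_eq_square)
  finally show "amp (- b1) \<mu> u0 v0 = cell_num d (E\<^sup>2) P Q / (E\<^sup>2 * (1 - d\<^sup>2))" .
qed

lemma solution_with_flux_scale:
  assumes "solution_with_flux a \<mu> I \<psi> \<phi>"
  shows "solution_with_flux a \<mu> I (\<lambda>x. c * \<psi> x) (\<lambda>x. c * \<phi> x)"
  unfolding solution_with_flux_def
proof (intro conjI ballI impI)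
  show "continuous_on I (\<lambda>x. c * \<psi> x)" "continuous_on I (\<lambda>x. c * \<phi> x)"
    using assms by (auto simp: solution_with_flux_def intro: continuous_intros)
  fix x assume "x \<in> I" "isCont a x"
  with assms have *: "(\<psi> has_vector_derivative (\<phi> x / a x)) (at x within I)" "a x \<noteq> 0"
      "(\<phi> has_vector_derivative (- (\<mu>\<^sup>2 * \<psi> x))) (at x within I)"
    by (auto simp: solution_with_flux_def)
  show "a x \<noteq> 0" by fact
  show "((\<lambda>x. c * \<psi> x) has_vector_derivative c * \<phi> x / a x) (at x within I)"
    using has_vector_derivative_mult_right[OF *(1), of c] by simp
  show "((\<lambda>x. c * \<phi> x) has_vector_derivative - (\<mu>\<^sup>2 * (c * \<psi> x))) (at x within I)"
    using has_vector_derivative_mult_right[OF *(3), of c] by (simp add: algebra_simps)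
qed

section \<open>Amplitudes of prescribed plane waves\<close>

lemma amp_plane_waves:
  assumes sol: "solution_with_flux a \<mu> I \<psi> \<phi>" and sub: "{s<..<e} \<subseteq> I" and b: "b \<noteq> 0"
    and a: "\<And>x. x \<in> {s<..<e} \<Longrightarrow> a x = 1 / b\<^sup>2"
    and \<psi>: "\<And>x. x \<in> {s<..<e} \<Longrightarrow> \<psi> x = \<alpha> * plane_wave b \<mu> x + \<beta> * plane_wave b (- \<mu>) x"
    and x: "x \<in> {s<..<e}"
  shows "amp b \<mu> (\<psi> x) (\<phi> x) = 2 * \<i> * \<mu> * \<alpha> * plane_wave b \<mu> x"
    "amp (- b) \<mu> (\<psi> x) (\<phi> x) = 2 * \<i> * \<mu> * \<beta> * plane_wave b (- \<mu>) x"
proof -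
  have "isCont a x" using isCont_if_locally_const[OF a x] .
  then have "(\<psi> has_vector_derivative (\<phi> x / a x)) (at x within I)"
    using sol sub x by (auto simp: solution_with_flux_def)
  then have d1: "(\<psi> has_vector_derivative (\<phi> x / a x)) (at x)"
    using has_vector_derivative_within_subset[OF _ sub] x at_within_open[OF x open_greaterThanLessThan] by metis
  have e: "(plane_wave b \<nu> has_vector_derivative \<i> * \<nu> * b * plane_wave b \<nu> x) (at x)" for \<nu>
    unfolding plane_wave_def by (rule has_vector_derivative_exp_mult)
  have "((\<lambda>x. \<alpha> * plane_wave b \<mu> x + \<beta> * plane_wave b (- \<mu>) x) has_vector_derivative
      \<alpha> * (\<i> * \<mu> * b * plane_wave b \<mu> x) + \<beta> * (\<i> * (- \<mu>) * b * plane_wave b (- \<mu>) x)) (at x)"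
    by (intro has_vector_derivative_add has_vector_derivative_mult_right e)
  then have "(\<psi> has_vector_derivative
      \<alpha> * (\<i> * \<mu> * b * plane_wave b \<mu> x) + \<beta> * (\<i> * (- \<mu>) * b * plane_wave b (- \<mu>) x)) (at x)"
    by (rule has_vector_derivative_transform_within_open[OF _ open_greaterThanLessThan x]) (simp add: \<psi>)
  \<comment> \<open>Scattering conditions prescribe only the values of the solution; uniqueness of
    the derivative yields the flux.\<close>
  with d1 have "\<phi> x / a x = \<alpha> * (\<i> * \<mu> * b * plane_wave b \<mu> x) + \<beta> * (\<i> * (- \<mu>) * b * plane_wave b (- \<mu>) x)"
    by (rule vector_derivative_unique_at)
  then have "b * (b * \<phi> x) = b * (\<i> * \<mu> * (\<alpha> * plane_wave b \<mu> x - \<beta> * plane_wave b (- \<mu>) x))"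
    using a[OF x] by (simp add: algebra_simps power2_eq_square)
  then have "b * \<phi> x = \<i> * \<mu> * (\<alpha> * plane_wave b \<mu> x - \<beta> * plane_wave b (- \<mu>) x)"
    using b by simp
  then show "amp b \<mu> (\<psi> x) (\<phi> x) = 2 * \<i> * \<mu> * \<alpha> * plane_wave b \<mu> x"
    "amp (- b) \<mu> (\<psi> x) (\<phi> x) = 2 * \<i> * \<mu> * \<beta> * plane_wave b (- \<mu>) x"
    unfolding amp_def by (simp_all add: \<psi>[OF x] algebra_simps)
qed

lemma amp_plane_waves_left:
  assumes sol: "solution_with_flux a \<mu> UNIV \<psi> \<phi>" and b: "b \<noteq> 0"
    and a: "\<And>x. x < 0 \<Longrightarrow> a x = 1 / b\<^sup>2"
    and \<psi>: "\<And>x. x < 0 \<Longrightarrow> \<psi> x = plane_wave b \<mu> x + r * plane_wave b (- \<mu>) x"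
  shows "amp b \<mu> (\<psi> 0) (\<phi> 0) = 2 * \<i> * \<mu>" "amp (- b) \<mu> (\<psi> 0) (\<phi> 0) = 2 * \<i> * \<mu> * r"
proof -
  \<comment> \<open>The plane waves are prescribed only for x < 0. The amplitudes are read off at -1
    and then transported to 0.\<close>
  have m: "amp b \<mu> (\<psi> (- 1)) (\<phi> (- 1)) = 2 * \<i> * \<mu> * 1 * plane_wave b \<mu> (- 1)"
    "amp (- b) \<mu> (\<psi> (- 1)) (\<phi> (- 1)) = 2 * \<i> * \<mu> * r * plane_wave b (- \<mu>) (- 1)"
    by (rule amp_plane_waves[OF sol, of "- 2" 0 b 1 r]; use a b \<psi> in simp)+
  have "amp b \<mu> (\<psi> 0) (\<phi> 0) = exp (\<i> * \<mu> * b * (0 - (- 1))) * amp b \<mu> (\<psi> (- 1)) (\<phi> (- 1))"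
    using amp_transport[OF sol, of "- 1" 0 b] a b by simp
  then show "amp b \<mu> (\<psi> 0) (\<phi> 0) = 2 * \<i> * \<mu>"
    unfolding m by (simp add: plane_wave_def exp_minus field_simps)
  have "amp (- b) \<mu> (\<psi> 0) (\<phi> 0) = exp (\<i> * \<mu> * of_real (- b) * (0 - (- 1))) * amp (- b) \<mu> (\<psi> (- 1)) (\<phi> (- 1))"
    using amp_transport[OF sol, of "- 1" 0 "- b"] a b by simp
  then show "amp (- b) \<mu> (\<psi> 0) (\<phi> 0) = 2 * \<i> * \<mu> * r"
    unfolding m by (simp add: plane_wave_def exp_minus field_simps)
qed

lemma amp_plane_waves_right:
  assumes sol: "solution_with_flux a \<mu> UNIV \<psi> \<phi>" and b: "b \<noteq> 0"
    and a: "\<And>x. x > k \<Longrightarrow> a x = 1 / b\<^sup>2"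
    and \<psi>: "\<And>x. x > k \<Longrightarrow> \<psi> x = t * plane_wave b \<mu> x"
  shows "amp (- b) \<mu> (\<psi> k) (\<phi> k) = 0"
proof -
  have "amp (- b) \<mu> (\<psi> (k + 1)) (\<phi> (k + 1)) = 2 * \<i> * \<mu> * 0 * plane_wave b (- \<mu>) (k + 1)"
    by (rule amp_plane_waves[OF sol, of k "k + 2" b t 0]; use a b \<psi> in simp)
  then show ?thesis
    using amp_transport[OF sol, of k "k + 1" "- b"] a b by simp
qed

section \<open>Square integrability on the half-line\<close>

lemma window_integral_tendsto_0:
  fixes f :: "real \<Rightarrow> real"
  assumes f: "set_integrable lborel {0..} f" and w: "0 \<le> w"
  shows "(\<lambda>n. integral {real n..real n + w} f) \<longlonglongrightarrow> 0"
proof -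
  let ?g = "\<lambda>n x. indicator {real n..real n + w} x *\<^sub>R f x"
  have sub: "{real n..real n + w} \<subseteq> {0..}" for n by auto
  have int: "set_integrable lborel {real n..real n + w} f" for n
    by (rule set_integrable_subset[OF f _ sub]) simp
  have "(\<lambda>n. integral\<^sup>L lborel (?g n)) \<longlonglongrightarrow> integral\<^sup>L lborel (\<lambda>x::real. 0::real)"
  proof (rule integral_dominated_convergence[where w = "\<lambda>x. norm (indicator {0..} x *\<^sub>R f x)"])
    show "integrable lborel (\<lambda>x. norm (indicator {0..} x *\<^sub>R f x))"
      using f unfolding set_integrable_def by (rule integrable_norm)
    show "AE x in lborel. (\<lambda>n. ?g n x) \<longlonglongrightarrow> 0"
    proof (rule AE_I2)
      fix x :: real
      obtain N :: nat where N: "x < real N" using reals_Archimedean2 by blast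
      have "eventually (\<lambda>n. ?g n x = 0) sequentially"
        using eventually_ge_at_top[of N] by eventually_elim (use N in auto)
      then show "(\<lambda>n. ?g n x) \<longlonglongrightarrow> 0" by (rule tendsto_eventually)
    qed
    show "AE x in lborel. norm (?g n x) \<le> norm (indicator {0..} x *\<^sub>R f x)" for n
      by (auto simp: indicator_def)
    show "?g n \<in> borel_measurable lborel" for n
      using int[of n] unfolding set_integrable_def by (rule borel_measurable_integrable)
  qed simp
  moreover have "integral\<^sup>L lborel (?g n) = integral {real n..real n + w} f" for n
    using set_borel_integral_eq_integral(2)[OF int[of n]] by (simp add: set_lebesgue_integral_def)
  ultimately show ?thesis by simp
qed

lemma set_integrable_geometric_bound:
  fixes f :: "real \<Rightarrow> complex"
  assumes cont: "continuous_on {0..} f" and \<rho>: "0 < \<rho>" "\<rho> < 1" and K: "0 \<le> K"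
    and bound: "\<And>n x. real n \<le> x \<Longrightarrow> x \<le> real n + 1 \<Longrightarrow> cmod (f x) \<le> K * \<rho> ^ n"
  shows "set_integrable lborel {0..} (\<lambda>x. (cmod (f x))\<^sup>2)"
proof -
  \<comment> \<open>Chosen so that the square of \<open>\<rho> ^ n\<close> is
    \<open>exp (- c * n)\<close>. The factor \<open>exp c\<close> in the majorant pays for replacing
    \<open>n\<close> by x \<le> n + 1.\<close>
  define c where "c = - 2 * ln \<rho>"
  have c: "c > 0" using \<rho> by (simp add: c_def)
  have "set_integrable lebesgue {0..} (\<lambda>x. K\<^sup>2 * exp c * exp (- c * x))"
    by (intro set_integrable_mult_right nonnegative_absolutely_integrable_1 integrable_on_exp_minus_to_infinity c) auto
  moreover have "(\<lambda>x. indicator {0..} x *\<^sub>R (K\<^sup>2 * exp c * exp (- c * x))) \<in> borel_measurable borel"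
    by (auto intro!: borel_measurable_continuous_on_indicator continuous_intros)
  ultimately have "set_integrable lborel {0..} (\<lambda>x. K\<^sup>2 * exp c * exp (- c * x))"
    unfolding set_integrable_def by (simp add: integrable_completion)
  then show ?thesis
  proof (rule set_integrable_bound)
    have "(\<lambda>x. indicator {0..} x *\<^sub>R (cmod (f x))\<^sup>2) \<in> borel_measurable borel"
      by (intro borel_measurable_continuous_on_indicator continuous_intros cont) simp
    then show "set_borel_measurable lborel {0..} (\<lambda>x. (cmod (f x))\<^sup>2)"
      by (simp add: set_borel_measurable_def)
    show "AE x in lborel. x \<in> {0..} \<longrightarrow> norm ((cmod (f x))\<^sup>2) \<le> norm (K\<^sup>2 * exp c * exp (- c * x))"
    proof (intro AE_I2 impI)
      fix x :: real assume x: "x \<in> {0..}"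
      define n where "n = nat \<lfloor>x\<rfloor>"
      have n: "real n \<le> x" "x \<le> real n + 1" using x unfolding n_def by (auto; linarith)+
      have "(cmod (f x))\<^sup>2 \<le> (K * \<rho> ^ n)\<^sup>2" using bound[OF n] by (intro power_mono) auto
      also have "\<dots> = K\<^sup>2 * exp (- c * real n)"
      proof -
        have "\<rho> ^ n = exp (real n * ln \<rho>)" using \<rho> by (simp add: exp_of_nat_mult)
        then have "(\<rho> ^ n)\<^sup>2 = exp (- c * real n)"
          by (simp add: c_def power2_eq_square exp_add[symmetric])
        then show ?thesis by (simp add: power_mult_distrib)
      qed
      also have "\<dots> \<le> K\<^sup>2 * exp (c + - c * x)"
        using n c mult_left_mono[of x "real n + 1" c] by (intro mult_left_mono) (auto simp: algebra_simps)
      finally show "norm ((cmod (f x))\<^sup>2) \<le> norm (K\<^sup>2 * exp c * exp (- c * x))"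
        by (simp add: mult.assoc flip: exp_add)
    qed
  qed
qed

subsection \<open>The layered medium\<close>

locale layered_medium =
  fixes b1 b2 x2 :: real
  assumes b1: "0 < b1" and b2: "0 < b2" and x2: "0 < x2" "x2 < 1"
    and balanced: "b2 * x2 = b1 * (1 - x2)"
begin

definition contrast :: real where "contrast = (b2 - b1) / (b2 + b1)"

text \<open>Phase across one layer. By \<open>balanced\<close> it is the same for both kinds of
  layer, see \<open>half_phase_inner\<close> and \<open>half_phase_outer\<close>; hence a single
  \<open>E\<close> suffices in \<open>cell_algebra\<close>.\<close>

definition half_phase :: "complex \<Rightarrow> complex" where "half_phase \<mu> = exp (\<i> * \<mu> * (b2 * x2))"

definition phase :: "complex \<Rightarrow> complex" where "phase \<mu> = (half_phase \<mu>)\<^sup>2"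

lemma half_phase_nonzero: "half_phase \<mu> \<noteq> 0"
  by (simp add: half_phase_def)

lemma half_phase_inner:
  "exp (\<i> * \<mu> * b2 * x2) = half_phase \<mu>" "exp (- (\<i> * \<mu> * b2 * x2)) = 1 / half_phase \<mu>"
  by (simp_all add: half_phase_def exp_minus field_simps)

lemma half_phase_outer:
  "exp (\<i> * \<mu> * b1 * (1 - x2)) = half_phase \<mu>" "exp (- (\<i> * \<mu> * b1 * (1 - x2))) = 1 / half_phase \<mu>"
proof -
  have "complex_of_real b1 * complex_of_real (1 - x2) = complex_of_real (b2 * x2)"
    unfolding balanced by simp
  then have "\<i> * \<mu> * b1 * complex_of_real (1 - x2) = \<i> * \<mu> * complex_of_real (b2 * x2)"
    by (simp only: mult.assoc)
  then show "exp (\<i> * \<mu> * b1 * (1 - x2)) = half_phase \<mu>"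
    "exp (- (\<i> * \<mu> * b1 * (1 - x2))) = 1 / half_phase \<mu>"
    by (simp_all only: half_phase_def exp_minus divide_inverse mult_1_left)
qed

lemma phase_nonzero: "phase \<mu> \<noteq> 0"
  by (simp add: phase_def half_phase_nonzero)

lemma cmod_phase_less:
  assumes Im: "Im \<mu> > 0"
  shows "cmod (phase \<mu>) < 1"
proof -
  have "cmod (half_phase \<mu>) < 1" using Im b2 x2 by (simp add: half_phase_def norm_exp_eq_Re)
  then show ?thesis by (simp add: phase_def norm_power power_less_one_iff)
qed

lemma abs_contrast: "\<bar>contrast\<bar> < 1"
  using b1 b2 by (auto simp: contrast_def abs_less_iff field_simps)

lemma contrast_sq: "contrast\<^sup>2 < 1"
  using abs_contrast by (simp add: abs_square_less_1)

lemma det_nonzero: "phase \<mu> * (1 - contrast\<^sup>2) \<noteq> 0"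
proof -
  have "complex_of_real (1 - contrast\<^sup>2) \<noteq> 0" using contrast_sq by (subst of_real_eq_0_iff) simp
  then show ?thesis using phase_nonzero by simp
qed

lemma coeff_per_layer2: "real n \<le> x \<Longrightarrow> x < real n + x2 \<Longrightarrow> coeff_per b1 b2 x2 x = 1 / b2\<^sup>2"
proof -
  assume "real n \<le> x" "x < real n + x2"
  then have "\<lfloor>x\<rfloor> = int n" using x2 by (intro floor_unique) auto
  then show ?thesis using \<open>x < real n + x2\<close> by (simp add: coeff_per_def frac_def)
qed

lemma coeff_per_layer1: "real n + x2 \<le> x \<Longrightarrow> x < real n + 1 \<Longrightarrow> coeff_per b1 b2 x2 x = 1 / b1\<^sup>2"
proof -
  assume "real n + x2 \<le> x" "x < real n + 1"
  then have "\<lfloor>x\<rfloor> = int n" using x2 by (intro floor_unique) auto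
  then show ?thesis using \<open>real n + x2 \<le> x\<close> by (simp add: coeff_per_def frac_def)
qed

lemma coeff_per_neg: "- 1 < x \<Longrightarrow> x < 0 \<Longrightarrow> x2 - 1 \<le> x \<Longrightarrow> coeff_per b1 b2 x2 x = 1 / b1\<^sup>2"
proof -
  assume "- 1 < x" "x < 0" "x2 - 1 \<le> x"
  then have "\<lfloor>x\<rfloor> = - 1" by (intro floor_unique) auto
  then show ?thesis using \<open>x2 - 1 \<le> x\<close> by (simp add: coeff_per_def frac_def)
qed

lemma coeff_nonzero:
  "coeff_per b1 b2 x2 x \<noteq> 0" "coeff_fin b1 b2 x2 k x \<noteq> 0" "coeff_half b1 b2 x2 x \<noteq> 0"
  using b1 b2 by (simp_all add: coeff_per_def coeff_fin_def coeff_half_def)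

text \<open>The direction is from right to left because the condition that selects the solution is
  imposed on the right. As \<open>a\<close> is compared with the periodic coefficient only inside
  the cell, the lemma serves the finite stack as well as the periodic half-line.\<close>

lemma cell_transfer:
  assumes sol: "solution_with_flux a \<mu> I \<psi> \<phi>" and sub: "{real n..real n + 1} \<subseteq> I"
    and a: "\<And>x. x \<in> {real n<..<real n + 1} \<Longrightarrow> a x = coeff_per b1 b2 x2 x"
  defines "P \<equiv> (\<lambda>x. amp b1 \<mu> (\<psi> x) (\<phi> x))" and "Q \<equiv> (\<lambda>x. amp (- b1) \<mu> (\<psi> x) (\<phi> x))"
  shows "P (real n) = cell_den contrast (phase \<mu>) (P (real n + 1)) (Q (real n + 1)) / (phase \<mu> * (1 - contrast\<^sup>2))"
    "Q (real n) = cell_num contrast (phase \<mu>) (P (real n + 1)) (Q (real n + 1)) / (phase \<mu> * (1 - contrast\<^sup>2))"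
proof -
  let ?m = "real n + x2" and ?E = "half_phase \<mu>"
  have sub1: "{real n..?m} \<subseteq> I" and sub2: "{?m..real n + 1} \<subseteq> I" using sub x2 by auto
  have a1: "a x = 1 / b2\<^sup>2" if "x \<in> {real n<..<?m}" for x
    using a[of x] coeff_per_layer2[of n x] that x2 by auto
  have a2: "a x = 1 / b1\<^sup>2" if "x \<in> {?m<..<real n + 1}" for x
    using a[of x] coeff_per_layer1[of n x] that x2 by auto
  have E2: "exp (\<i> * \<mu> * b2 * (?m - real n)) = ?E"
      "exp (\<i> * \<mu> * of_real (- b2) * (?m - real n)) = 1 / ?E"
      "exp (\<i> * \<mu> * b1 * (real n + 1 - ?m)) = ?E"
      "exp (\<i> * \<mu> * of_real (- b1) * (real n + 1 - ?m)) = 1 / ?E"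
    using half_phase_outer[of \<mu>] half_phase_inner[of \<mu>] by simp_all
  have t: "amp b2 \<mu> (\<psi> ?m) (\<phi> ?m) = ?E * amp b2 \<mu> (\<psi> n) (\<phi> n)"
    "amp (- b2) \<mu> (\<psi> ?m) (\<phi> ?m) = 1 / ?E * amp (- b2) \<mu> (\<psi> n) (\<phi> n)"
    "P (real n + 1) = ?E * P ?m" "Q (real n + 1) = 1 / ?E * Q ?m"
    using amp_transport[OF sol sub1, of b2] amp_transport[OF sol sub1, of "- b2"]
      amp_transport[OF sol sub2, of b1] amp_transport[OF sol sub2, of "- b1"] a1 a2 x2 b1 b2
    unfolding P_def Q_def E2 by simp_all
  note c = cell_algebra[OF b1 b2 half_phase_nonzero[of \<mu>], of _ "\<psi> ?m" "\<phi> ?m" "P (real n + 1)" "Q (real n + 1)"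
    "\<psi> n" "\<phi> n" contrast]
  show "P (real n) = cell_den contrast (phase \<mu>) (P (real n + 1)) (Q (real n + 1)) / (phase \<mu> * (1 - contrast\<^sup>2))"
    "Q (real n) = cell_num contrast (phase \<mu>) (P (real n + 1)) (Q (real n + 1)) / (phase \<mu> * (1 - contrast\<^sup>2))"
    unfolding P_def Q_def phase_def of_real_power[symmetric]
    by (rule c[unfolded P_def Q_def]; use t half_phase_nonzero[of \<mu>] in \<open>simp add: P_def Q_def contrast_def\<close>)+
qed

text \<open>Anchored at \<open>n\<close> and used on the \<open>b1\<close> layer that ends there;
  index 0 covers the left half-line, and the last index of a finite stack also everything beyond
  it.\<close>

definition outer_wave :: "complex \<Rightarrow> (nat \<Rightarrow> complex) \<Rightarrow> (nat \<Rightarrow> complex) \<Rightarrow> nat \<Rightarrow> real \<Rightarrow> complex \<times> complex" where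
  "outer_wave \<mu> p q n x = wave b1 \<mu> (p n) (q n) (x - n)"

text \<open>Started at the interface \<open>n + x2\<close> with the value and flux of the outer wave
  next to it, so matching there is built in. Matching at the left end of the cell is what the
  recursion for \<open>p\<close> and \<open>q\<close> provides.\<close>

definition inner_wave :: "complex \<Rightarrow> (nat \<Rightarrow> complex) \<Rightarrow> (nat \<Rightarrow> complex) \<Rightarrow> nat \<Rightarrow> real \<Rightarrow> complex \<times> complex" where
  "inner_wave \<mu> p q n x =
     (case outer_wave \<mu> p q (Suc n) (n + x2) of (u, v) \<Rightarrow>
        wave b2 \<mu> (amp b2 \<mu> u v) (amp (- b2) \<mu> u v) (x - (n + x2)))"

lemma inner_wave_right:
  assumes "\<mu> \<noteq> 0"
  shows "inner_wave \<mu> p q n (n + x2) = outer_wave \<mu> p q (Suc n) (n + x2)"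
  using assms b2 by (simp add: inner_wave_def wave_amp split: prod.split)

lemma inner_wave_left:
  assumes \<mu>: "\<mu> \<noteq> 0"
    and p: "p n = cell_den contrast (phase \<mu>) (p (Suc n)) (q (Suc n)) / (phase \<mu> * (1 - contrast\<^sup>2))"
    and q: "q n = cell_num contrast (phase \<mu>) (p (Suc n)) (q (Suc n)) / (phase \<mu> * (1 - contrast\<^sup>2))"
  shows "inner_wave \<mu> p q n n = outer_wave \<mu> p q n n"
proof -
  obtain u1 v1 where uv1: "outer_wave \<mu> p q (Suc n) (n + x2) = (u1, v1)" by fastforce
  obtain u0 v0 where uv0: "inner_wave \<mu> p q n n = (u0, v0)" by fastforce
  obtain u v where uv: "outer_wave \<mu> p q n n = (u, v)" by fastforce
  have b: "b1 \<noteq> 0" "b2 \<noteq> 0" using b1 b2 by auto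
  have e1: "exp (\<i> * \<mu> * b1 * (x2 - 1)) = 1 / half_phase \<mu>"
    "exp (- (\<i> * \<mu> * b1 * (x2 - 1))) = half_phase \<mu>"
    "exp (\<i> * \<mu> * b2 * (- x2)) = 1 / half_phase \<mu>"
    "exp (- (\<i> * \<mu> * b2 * (- x2))) = half_phase \<mu>"
    using half_phase_outer[of \<mu>] half_phase_inner[of \<mu>] by (simp_all add: right_diff_distrib)
  have w1: "(u1, v1) = wave b1 \<mu> (p (Suc n)) (q (Suc n)) (x2 - 1)"
    using uv1 by (simp add: outer_wave_def)
  have A1: "amp b1 \<mu> u1 v1 = p (Suc n) / half_phase \<mu>" "amp (- b1) \<mu> u1 v1 = q (Suc n) * half_phase \<mu>"
    using amp_wave[OF b(1) \<mu>, of "p (Suc n)" "q (Suc n)" "x2 - 1"] by (simp_all only: w1[symmetric] fst_conv snd_conv e1) simp_all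
  have w0: "(u0, v0) = wave b2 \<mu> (amp b2 \<mu> u1 v1) (amp (- b2) \<mu> u1 v1) (- x2)"
    using uv0 by (simp add: inner_wave_def uv1)
  have A0: "amp b2 \<mu> u0 v0 = amp b2 \<mu> u1 v1 / half_phase \<mu>" "amp (- b2) \<mu> u0 v0 = amp (- b2) \<mu> u1 v1 * half_phase \<mu>"
    using amp_wave[OF b(2) \<mu>, of "amp b2 \<mu> u1 v1" "amp (- b2) \<mu> u1 v1" "- x2"]
    by (simp_all only: w0[symmetric] fst_conv snd_conv e1) simp_all
  have "(u, v) = wave b1 \<mu> (p n) (q n) 0" using uv by (simp add: outer_wave_def)
  then have A: "amp b1 \<mu> u v = p n" "amp (- b1) \<mu> u v = q n"
    using amp_wave[OF b(1) \<mu>, of "p n" "q n" 0] by (simp_all flip: of_real_minus add: prod_eq_iff)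
  have "amp b1 \<mu> u0 v0 = amp b1 \<mu> u v" "amp (- b1) \<mu> u0 v0 = amp (- b1) \<mu> u v"
    unfolding A p q phase_def of_real_power[symmetric]
    using cell_algebra[OF b1 b2 half_phase_nonzero A1 A0 contrast_def] by simp_all
  from amp_inject[OF b(1) \<mu> this] show ?thesis using uv0 uv by simp
qed

text \<open>The medium consists of the cells \<open>n < k\<close>, or of all cells if \<open>unb\<close> holds.\<close>

lemma layered_wave_exists:
  assumes \<mu>: "\<mu> \<noteq> 0"
    and p: "\<And>n. unb \<or> n < k \<Longrightarrow>
      p n = cell_den contrast (phase \<mu>) (p (Suc n)) (q (Suc n)) / (phase \<mu> * (1 - contrast\<^sup>2))"
    and q: "\<And>n. unb \<or> n < k \<Longrightarrow>
      q n = cell_num contrast (phase \<mu>) (p (Suc n)) (q (Suc n)) / (phase \<mu> * (1 - contrast\<^sup>2))"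
  obtains G where "continuous_on UNIV G" "\<And>x. x \<le> 0 \<Longrightarrow> G x = outer_wave \<mu> p q 0 x"
    "\<And>n x. unb \<or> n < k \<Longrightarrow> real n \<le> x \<Longrightarrow> x \<le> n + x2 \<Longrightarrow> G x = inner_wave \<mu> p q n x"
    "\<And>n x. unb \<or> n < k \<Longrightarrow> real n + x2 \<le> x \<Longrightarrow> x \<le> n + 1 \<Longrightarrow> G x = outer_wave \<mu> p q (Suc n) x"
    "\<And>x. \<not> unb \<Longrightarrow> real k \<le> x \<Longrightarrow> G x = outer_wave \<mu> p q k x"
proof -
  \<comment> \<open>The points 0, x2, 1, 1 + x2, 2, ...: cell boundaries at even indices, inner
    interfaces at odd ones.\<close>
  define t where "t = (\<lambda>j. real (j div 2) + (if even j then 0 else x2))"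
  \<comment> \<open>Piece \<open>Suc i\<close> lies to the right of \<open>t i\<close>. Beyond a
    finite stack all pieces are the same wave, so one countable gluing treats finite and infinite
    media alike.\<close>
  define g where "g = (\<lambda>j. case j of 0 \<Rightarrow> outer_wave \<mu> p q 0 | Suc i \<Rightarrow>
     (if \<not> (unb \<or> i div 2 < k) then outer_wave \<mu> p q k
      else if even i then inner_wave \<mu> p q (i div 2) else outer_wave \<mu> p q (Suc (i div 2))))"
  have cont: "continuous_on UNIV (outer_wave \<mu> p q n)" "continuous_on UNIV (inner_wave \<mu> p q n)" for n
    unfolding outer_wave_def inner_wave_def by (auto simp: case_prod_beta continuous_on_wave)
  obtain G where G: "continuous_on UNIV G" "\<And>x. x \<le> t 0 \<Longrightarrow> G x = g 0 x"
    "\<And>j x. t j \<le> x \<Longrightarrow> x \<le> t (Suc j) \<Longrightarrow> G x = g (Suc j) x"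
  proof (rule glue_continuous[of t g])
    show "t j < t (Suc j)" for j
      using x2 by (cases "even j") (auto simp: t_def elim!: evenE oddE)
    show "\<exists>j. x \<le> t j" for x
    proof -
      obtain n :: nat where "x \<le> real n" using real_arch_simple by blast
      then show ?thesis by (intro exI[of _ "2 * n"]) (simp add: t_def)
    qed
    show "continuous_on UNIV (g j)" for j
      by (auto simp: g_def cont split: nat.split)
    show "g j (t j) = g (Suc j) (t j)" for j
    proof (cases "even j")
      case False
      then obtain n where j: "j = Suc (2 * n)" by (auto elim!: oddE)
      show ?thesis
        using inner_wave_right[OF \<mu>, of p q n] by (simp add: j g_def t_def)
    next
      case True
      then obtain n where j: "j = 2 * n" by (auto elim!: evenE)
      show ?thesis
      proof (cases "unb \<or> n < k")
        case True
        have "g j = outer_wave \<mu> p q n"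
          using True by (cases n) (auto simp: j g_def)
        moreover have "g (Suc j) = inner_wave \<mu> p q n" using True by (simp add: j g_def)
        moreover have "t j = n" by (simp add: j t_def)
        ultimately show ?thesis using inner_wave_left[OF \<mu> p[OF True] q[OF True]] by simp
      next
        case False
        have "g j = outer_wave \<mu> p q k"
        proof (cases n)
          case (Suc i)
          then show ?thesis using False by (cases "i < k") (auto simp: j g_def intro: arg_cong)
        qed (use False in \<open>simp add: j g_def\<close>)
        moreover have "g (Suc j) = outer_wave \<mu> p q k" using False by (simp add: j g_def)
        ultimately show ?thesis by simp
      qed
    qed
  qed blast
  have inner: "G x = inner_wave \<mu> p q n x" if "unb \<or> n < k" "real n \<le> x" "x \<le> n + x2" for n x
    using G(3)[of "2 * n" x] that by (simp add: t_def g_def)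
  have outer: "G x = outer_wave \<mu> p q (Suc n) x" if "unb \<or> n < k" "real n + x2 \<le> x" "x \<le> n + 1" for n x
    using G(3)[of "Suc (2 * n)" x] that by (simp add: t_def g_def add.commute)
  have beyond: "G x = outer_wave \<mu> p q k x" if "\<not> unb" "real k \<le> x" for x
  proof -
    define n where "n = nat \<lfloor>x\<rfloor>"
    have n: "real n \<le> x" "x \<le> real n + 1" "k \<le> n"
      using that unfolding n_def by linarith+
    show ?thesis
    proof (cases "x \<le> n + x2")
      case True
      then show ?thesis using G(3)[of "2 * n" x] n that by (simp add: t_def g_def)
    next
      case False
      then show ?thesis using G(3)[of "Suc (2 * n)" x] n that by (simp add: t_def g_def add.commute)
    qed
  qed
  show thesis
    by (rule that[OF G(1) _ inner outer beyond]) (use G(2) in \<open>simp add: t_def g_def\<close>)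
qed

subsection \<open>Finitely many periods\<close>

text \<open>Every alternative is the interior of a layer together with its coefficient. For distinct
  \<open>b1\<close> and \<open>b2\<close> all continuity points are of this kind; for
  \<open>b1 = b2\<close> the interfaces are continuity points too and escape the list, so that case
  is treated separately.\<close>

definition continuity_layer :: "(real \<Rightarrow> real) \<Rightarrow> bool \<Rightarrow> nat \<Rightarrow> real \<Rightarrow> bool" where
  "continuity_layer a unb k x \<longleftrightarrow>
     (x < 0 \<and> a x = 1 / b1\<^sup>2) \<or> (\<not> unb \<and> real k < x \<and> a x = 1 / b1\<^sup>2) \<or>
     (\<exists>n. (unb \<or> n < k) \<and> x \<in> {real n<..<n + x2} \<and> a x = 1 / b2\<^sup>2) \<or>
     (\<exists>n. (unb \<or> n < k) \<and> x \<in> {real n + x2<..<real n + 1} \<and> a x = 1 / b1\<^sup>2)"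

lemma layered_solution_exists:
  assumes \<mu>: "\<mu> \<noteq> 0"
    and p: "\<And>n. unb \<or> n < k \<Longrightarrow>
      p n = cell_den contrast (phase \<mu>) (p (Suc n)) (q (Suc n)) / (phase \<mu> * (1 - contrast\<^sup>2))"
    and q: "\<And>n. unb \<or> n < k \<Longrightarrow>
      q n = cell_num contrast (phase \<mu>) (p (Suc n)) (q (Suc n)) / (phase \<mu> * (1 - contrast\<^sup>2))"
  obtains G where "continuous_on UNIV G" "\<And>x. x \<le> 0 \<Longrightarrow> G x = outer_wave \<mu> p q 0 x"
    "\<And>n x. unb \<or> n < k \<Longrightarrow> real n \<le> x \<Longrightarrow> x \<le> n + x2 \<Longrightarrow> G x = inner_wave \<mu> p q n x"
    "\<And>n x. unb \<or> n < k \<Longrightarrow> real n + x2 \<le> x \<Longrightarrow> x \<le> n + 1 \<Longrightarrow> G x = outer_wave \<mu> p q (Suc n) x"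
    "\<And>x. \<not> unb \<Longrightarrow> real k \<le> x \<Longrightarrow> G x = outer_wave \<mu> p q k x"
    "\<And>a I. (\<And>x. x \<in> I \<Longrightarrow> isCont a x \<Longrightarrow> continuity_layer a unb k x) \<Longrightarrow>
       solution_with_flux a \<mu> I (\<lambda>x. fst (G x)) (\<lambda>x. snd (G x))"
proof -
  from layered_wave_exists[of \<mu> unb k p q, OF assms] obtain G where
    G: "continuous_on UNIV G" "\<And>x. x \<le> 0 \<Longrightarrow> G x = outer_wave \<mu> p q 0 x"
    "\<And>n x. unb \<or> n < k \<Longrightarrow> real n \<le> x \<Longrightarrow> x \<le> n + x2 \<Longrightarrow> G x = inner_wave \<mu> p q n x"
    "\<And>n x. unb \<or> n < k \<Longrightarrow> real n + x2 \<le> x \<Longrightarrow> x \<le> n + 1 \<Longrightarrow> G x = outer_wave \<mu> p q (Suc n) x"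
    "\<And>x. \<not> unb \<Longrightarrow> real k \<le> x \<Longrightarrow> G x = outer_wave \<mu> p q k x" by blast
  have b: "b1 \<noteq> 0" "b2 \<noteq> 0" using b1 b2 by auto
  have sol: "solution_with_flux a \<mu> I (\<lambda>x. fst (G x)) (\<lambda>x. snd (G x))"
    if layer: "\<And>x. x \<in> I \<Longrightarrow> isCont a x \<Longrightarrow> continuity_layer a unb k x" for a I
  proof (rule solution_if_locally_wave[OF G(1) \<mu>])
    fix x assume "x \<in> I" "isCont a x"
    from layer[OF this] consider
      "x < 0" "a x = 1 / b1\<^sup>2" | "\<not> unb" "real k < x" "a x = 1 / b1\<^sup>2"
      | n where "unb \<or> n < k" "x \<in> {real n<..<n + x2}" "a x = 1 / b2\<^sup>2"
      | n where "unb \<or> n < k" "x \<in> {real n + x2<..<real n + 1}" "a x = 1 / b1\<^sup>2"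
      unfolding continuity_layer_def by blast
    moreover have "\<exists>s e b p q x0. x \<in> {s<..<e} \<and> b \<noteq> 0 \<and> a x = 1 / b\<^sup>2 \<and>
        (\<forall>y\<in>{s<..<e}. G y = wave b \<mu> p q (y - x0))"
      if "x \<in> {s<..<e}" "b \<noteq> 0" "a x = 1 / b\<^sup>2" "\<And>y. y \<in> {s<..<e} \<Longrightarrow> G y = wave b \<mu> p q (y - x0)"
      for s e b p q x0
      using that by blast
    note I = this
    ultimately show "\<exists>s e b p q x0. x \<in> {s<..<e} \<and> b \<noteq> 0 \<and> a x = 1 / b\<^sup>2 \<and>
        (\<forall>y\<in>{s<..<e}. G y = wave b \<mu> p q (y - x0))"
    proof cases
      case 1
      then show ?thesis using b G(2)
        by (intro I[of "x - 1" 0 b1 "p 0" "q 0" 0]) (auto simp: outer_wave_def)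
    next
      case 2
      then show ?thesis using b G(5)
        by (intro I[of k "x + 1" b1 "p k" "q k" k]) (auto simp: outer_wave_def)
    next
      case 3
      obtain u v where "outer_wave \<mu> p q (Suc n) (n + x2) = (u, v)" by fastforce
      then show ?thesis using b 3 G(3)[OF 3(1)]
        by (intro I[of n "n + x2" b2 "amp b2 \<mu> u v" "amp (- b2) \<mu> u v" "n + x2"]) (auto simp: inner_wave_def)
    next
      case 4
      then show ?thesis using b G(4)[OF 4(1)]
        by (intro I[of "n + x2" "real n + 1" b1 "p (Suc n)" "q (Suc n)" "Suc n"]) (auto simp: outer_wave_def)
    qed
  qed
  show thesis by (rule that[OF G sol])
qed

section \<open>Continuity points of the coefficients\<close>

lemma cell_position:
  assumes "0 \<le> x"
  obtains n where "x = real n" | n where "x \<in> {real n<..<n + x2}" | n where "x = real n + x2"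
    | n where "x \<in> {real n + x2<..<real n + 1}"
proof -
  define n where "n = nat \<lfloor>x\<rfloor>"
  have "real n \<le> x" "x < real n + 1" using assms unfolding n_def by linarith+
  then consider "x = real n" | "x \<in> {real n<..<n + x2}" | "x = real n + x2" | "x \<in> {real n + x2<..<real n + 1}"
    by fastforce
  then show thesis using that by cases blast+
qed

lemma coeff_per_left_of_nat:
  assumes "x \<in> {real n - (1 - x2)<..<n}"
  shows "coeff_per b1 b2 x2 x = 1 / b1\<^sup>2"
proof (cases n)
  case 0
  then show ?thesis using assms x2 by (intro coeff_per_neg) auto
next
  case (Suc m)
  then show ?thesis using assms by (intro coeff_per_layer1[of m]) auto
qed

lemma not_isCont_at_nat:
  assumes "b1 \<noteq> b2" "a (real n) = 1 / b2\<^sup>2" "\<And>x. x \<in> {real n - (1 - x2)<..<n} \<Longrightarrow> a x = 1 / b1\<^sup>2"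
  shows "\<not> isCont a (real n)"
proof
  assume "isCont a (real n)"
  then have "a (real n) = 1 / b1\<^sup>2"
    by (rule isCont_eq_left_const[OF _ _ assms(3)]) (use x2 in auto)
  then have "b2\<^sup>2 = b1\<^sup>2" using b1 b2 assms(2) by simp
  then show False using assms(1) b1 b2 by (simp add: power2_eq_iff)
qed

lemma not_isCont_inside:
  assumes "b1 \<noteq> b2" "a (real n + x2) = 1 / b1\<^sup>2" "\<And>x. x \<in> {real n<..<n + x2} \<Longrightarrow> a x = 1 / b2\<^sup>2"
  shows "\<not> isCont a (real n + x2)"
proof
  assume "isCont a (real n + x2)"
  then have "a (real n + x2) = 1 / b2\<^sup>2"
    by (rule isCont_eq_left_const[OF _ _ assms(3)]) (use x2 in auto)
  then have "b2\<^sup>2 = b1\<^sup>2" using b1 b2 assms(2) by simp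
  then show False using assms(1) b1 b2 by (simp add: power2_eq_iff)
qed

lemma continuity_layer_infinite:
  assumes "b1 \<noteq> b2" "isCont a x" "\<And>x. 0 \<le> x \<Longrightarrow> a x = coeff_per b1 b2 x2 x"
    and "\<And>x. x2 - 1 < x \<Longrightarrow> x < 0 \<Longrightarrow> a x = 1 / b1\<^sup>2" "x < 0 \<Longrightarrow> a x = 1 / b1\<^sup>2"
  shows "continuity_layer a True k x"
proof (cases "x < 0")
  case False
  then have "0 \<le> x" by simp
  then show ?thesis
  proof (cases rule: cell_position)
    case (1 n)
    have "\<not> isCont a (real n)"
    proof (rule not_isCont_at_nat[OF assms(1)])
      show "a (real n) = 1 / b2\<^sup>2" using assms(3) coeff_per_layer2[of n n] x2 by simp
      show "a x = 1 / b1\<^sup>2" if "x \<in> {real n - (1 - x2)<..<n}" for x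
        using assms(3)[of x] assms(4)[of x] coeff_per_left_of_nat[OF that] that
        by (cases "x < 0") auto
    qed
    then show ?thesis using 1 assms(2) by simp
  next
    case (2 n)
    then show ?thesis using assms(3)[OF \<open>0 \<le> x\<close>] coeff_per_layer2[of n x]
      by (auto simp: continuity_layer_def)
  next
    case (3 n)
    have "\<not> isCont a (real n + x2)"
    proof (rule not_isCont_inside[OF assms(1)])
      show "a (real n + x2) = 1 / b1\<^sup>2" using assms(3) coeff_per_layer1[of n "n + x2"] x2 by simp
      show "a x = 1 / b2\<^sup>2" if "x \<in> {real n<..<n + x2}" for x
        using assms(3)[of x] coeff_per_layer2[of n x] that by auto
    qed
    then show ?thesis using 3 assms(2) by simp
  next
    case (4 n)
    then show ?thesis using assms(3)[OF \<open>0 \<le> x\<close>] coeff_per_layer1[of n x]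
      by (auto simp: continuity_layer_def)
  qed
qed (use assms(5) in \<open>simp add: continuity_layer_def\<close>)

lemma continuity_layer_finite:
  assumes "b1 \<noteq> b2" "isCont (coeff_fin b1 b2 x2 k) x"
  shows "continuity_layer (coeff_fin b1 b2 x2 k) False k x"
proof -
  let ?a = "coeff_fin b1 b2 x2 k"
  consider "x < 0" | "real k < x" | "0 \<le> x" "x \<le> k" by linarith
  then show ?thesis
  proof cases
    case 3
    then have ax: "?a x = coeff_per b1 b2 x2 x" by (simp add: coeff_fin_def)
    from \<open>0 \<le> x\<close> show ?thesis
    proof (cases rule: cell_position)
      case (1 n)
      then have nk: "n \<le> k" using 3 by simp
      have "\<not> isCont ?a (real n)"
      proof (rule not_isCont_at_nat[OF assms(1)])
        \<comment> \<open>This includes n = k: the closed interval in \<open>coeff_fin\<close>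
          assigns the \<open>b2\<close> value to the single point \<open>k\<close>, although the
          coefficient is \<open>1 / b1\<^sup>2\<close> on both sides of it.\<close>
        show "?a (real n) = 1 / b2\<^sup>2" using nk coeff_per_layer2[of n n] x2 by (simp add: coeff_fin_def)
        show "?a x = 1 / b1\<^sup>2" if "x \<in> {real n - (1 - x2)<..<n}" for x
          using coeff_per_left_of_nat[OF that] by (simp add: coeff_fin_def)
      qed
      then show ?thesis using 1 assms(2) by simp
    next
      case (2 n)
      then have "real n < real k" using 3 by auto
      then show ?thesis using 2 ax coeff_per_layer2[of n x]
        by (auto simp: continuity_layer_def)
    next
      case (3 n)
      then have "real n < real k" using \<open>x \<le> k\<close> x2 by linarith
      then have nk: "real n + 1 \<le> real k" by simp
      have "\<not> isCont ?a (real n + x2)"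
      proof (rule not_isCont_inside[OF assms(1)])
        show "?a (real n + x2) = 1 / b1\<^sup>2"
          using nk coeff_per_layer1[of n "n + x2"] x2 by (simp add: coeff_fin_def)
        show "?a x = 1 / b2\<^sup>2" if "x \<in> {real n<..<n + x2}" for x
          using coeff_per_layer2[of n x] that nk x2 by (simp add: coeff_fin_def)
      qed
      then show ?thesis using 3 assms(2) by simp
    next
      case (4 n)
      then have "real n < real k" using 3 x2 by auto
      then show ?thesis using 4 ax coeff_per_layer1[of n x]
        by (auto simp: continuity_layer_def)
    qed
  qed (simp_all add: continuity_layer_def coeff_fin_def)
qed

section \<open>Reflection by a finite stack\<close>

lemma outer_wave_left:
  assumes "p 0 = 2 * \<i> * \<mu>" "q 0 = 2 * \<i> * \<mu> * r" "\<mu> \<noteq> 0"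
  shows "fst (outer_wave \<mu> p q 0 x) = plane_wave b1 \<mu> x + r * plane_wave b1 (- \<mu>) x"
  using assms by (simp add: outer_wave_def wave_def plane_wave_def field_simps)

definition refl_iter :: "complex \<Rightarrow> nat \<Rightarrow> complex" where
  "refl_iter \<mu> j = (cell_map contrast (phase \<mu>) ^^ j) 0"

text \<open>Forward amplitude \<open>j\<close> cells to the left of the end of the stack, if a wave
  of forward amplitude 1 leaves there and nothing enters from the right.\<close>

definition amp_iter :: "complex \<Rightarrow> nat \<Rightarrow> complex" where
  "amp_iter \<mu> j = (\<Prod>i<j. cell_den contrast (phase \<mu>) 1 (refl_iter \<mu> i) / (phase \<mu> * (1 - contrast\<^sup>2)))"

context
  fixes \<mu> :: complex
  assumes \<mu>: "\<mu> \<noteq> 0" and phase_le: "cmod (phase \<mu>) \<le> 1"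
begin

lemma cell_den_refl_iter_nonzero: "cell_den contrast (phase \<mu>) 1 (refl_iter \<mu> j) \<noteq> 0"
  using cell_den_nonzero[OF abs_contrast phase_le] cell_map_iter_less[OF abs_contrast phase_le, of j]
  by (simp add: refl_iter_def less_imp_le)

lemma amp_iter_nonzero: "amp_iter \<mu> j \<noteq> 0"
  using cell_den_refl_iter_nonzero det_nonzero by (simp add: amp_iter_def)

lemma amp_iter_step:
  "cell_den contrast (phase \<mu>) (c * amp_iter \<mu> j) (c * amp_iter \<mu> j * refl_iter \<mu> j) / (phase \<mu> * (1 - contrast\<^sup>2))
     = c * amp_iter \<mu> (Suc j)" (is ?d)
  "cell_num contrast (phase \<mu>) (c * amp_iter \<mu> j) (c * amp_iter \<mu> j * refl_iter \<mu> j) / (phase \<mu> * (1 - contrast\<^sup>2))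
     = c * amp_iter \<mu> (Suc j) * refl_iter \<mu> (Suc j)" (is ?n)
proof -
  have "cell_map contrast (phase \<mu>) (refl_iter \<mu> j) =
      cell_num contrast (phase \<mu>) 1 (refl_iter \<mu> j) / cell_den contrast (phase \<mu>) 1 (refl_iter \<mu> j)"
    using cell_map_eq_disk[OF abs_contrast phase_le] cell_map_iter_less[OF abs_contrast phase_le, of j]
    by (simp add: refl_iter_def less_imp_le)
  then have r: "refl_iter \<mu> (Suc j) * cell_den contrast (phase \<mu>) 1 (refl_iter \<mu> j)
      = cell_num contrast (phase \<mu>) 1 (refl_iter \<mu> j)"
    using cell_den_refl_iter_nonzero[of j] by (simp add: refl_iter_def)
  have A: "amp_iter \<mu> (Suc j) = amp_iter \<mu> j * (cell_den contrast (phase \<mu>) 1 (refl_iter \<mu> j) / (phase \<mu> * (1 - contrast\<^sup>2)))"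
    by (simp add: amp_iter_def)
  show ?d using cell_den_scale[of contrast "phase \<mu>" "c * amp_iter \<mu> j" 1 "refl_iter \<mu> j"] A by simp
  show ?n using cell_num_scale[of contrast "phase \<mu>" "c * amp_iter \<mu> j" 1 "refl_iter \<mu> j"] A r
    by (simp add: mult.assoc) (simp add: mult.commute)
qed

lemma finite_amplitudes:
  assumes sol: "solution_with_flux (coeff_fin b1 b2 x2 k) \<mu> UNIV \<psi> \<phi>"
    and out: "amp (- b1) \<mu> (\<psi> k) (\<phi> k) = 0"
  shows "amp b1 \<mu> (\<psi> 0) (\<phi> 0) = amp b1 \<mu> (\<psi> k) (\<phi> k) * amp_iter \<mu> k"
    "amp (- b1) \<mu> (\<psi> 0) (\<phi> 0) = amp b1 \<mu> (\<psi> k) (\<phi> k) * amp_iter \<mu> k * refl_iter \<mu> k"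
proof -
  let ?c = "amp b1 \<mu> (\<psi> k) (\<phi> k)"
  \<comment> \<open>\<open>j\<close> counts cells from the right end, where the backward amplitude
    vanishes.\<close>
  have "amp b1 \<mu> (\<psi> (real (k - j))) (\<phi> (real (k - j))) = ?c * amp_iter \<mu> j \<and>
     amp (- b1) \<mu> (\<psi> (real (k - j))) (\<phi> (real (k - j))) = ?c * amp_iter \<mu> j * refl_iter \<mu> j" if "j \<le> k" for j
    using that
  proof (induction j)
    case 0
    show ?case using out by (simp add: amp_iter_def refl_iter_def)
  next
    case (Suc j)
    have k: "real (k - j) = real (k - Suc j) + 1" using Suc.prems by linarith
    have "coeff_fin b1 b2 x2 k x = coeff_per b1 b2 x2 x"
      if "x \<in> {real (k - Suc j)<..<real (k - Suc j) + 1}" for x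
    proof -
      have "0 \<le> x" "x \<le> real k" using that Suc.prems by auto
      then show ?thesis by (simp add: coeff_fin_def)
    qed
    note c = cell_transfer[where n = "k - Suc j", OF sol subset_UNIV this]
    have I: "amp b1 \<mu> (\<psi> (real (k - j))) (\<phi> (real (k - j))) = ?c * amp_iter \<mu> j"
      "amp (- b1) \<mu> (\<psi> (real (k - j))) (\<phi> (real (k - j))) = ?c * amp_iter \<mu> j * refl_iter \<mu> j"
      using Suc by simp_all
    show ?case using c[folded k] unfolding I amp_iter_step by simp
  qed
  from this[of k] show "amp b1 \<mu> (\<psi> 0) (\<phi> 0) = ?c * amp_iter \<mu> k"
    "amp (- b1) \<mu> (\<psi> 0) (\<phi> 0) = ?c * amp_iter \<mu> k * refl_iter \<mu> k" by simp_all
qed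

lemma finite_solution_exists:
  obtains \<psi> t where "is_solution (coeff_fin b1 b2 x2 k) \<mu> UNIV \<psi>"
    "\<And>x. x < 0 \<Longrightarrow> \<psi> x = plane_wave b1 \<mu> x + refl_iter \<mu> k * plane_wave b1 (- \<mu>) x"
    "\<And>x. x > real k \<Longrightarrow> \<psi> x = t * plane_wave b1 \<mu> x"
proof (cases "b1 = b2")
  case True
  have a: "coeff_fin b1 b2 x2 k = (\<lambda>x. 1 / b1\<^sup>2)"
    by (auto simp: coeff_fin_def coeff_per_def True)
  have "contrast = 0" unfolding contrast_def using True by simp
  then have "refl_iter \<mu> k = 0"
    by (induction k) (simp_all add: refl_iter_def cell_map_def)
  moreover have "solution_with_flux (coeff_fin b1 b2 x2 k) \<mu> UNIV
      (\<lambda>x. fst (wave b1 \<mu> (2 * \<i> * \<mu>) 0 (x - 0))) (\<lambda>x. snd (wave b1 \<mu> (2 * \<i> * \<mu>) 0 (x - 0)))"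
  proof (rule solution_if_locally_wave[OF continuous_on_wave \<mu>])
    fix x :: real
    show "\<exists>s e b p q x0. x \<in> {s<..<e} \<and> b \<noteq> 0 \<and> coeff_fin b1 b2 x2 k x = 1 / b\<^sup>2 \<and>
         (\<forall>y\<in>{s<..<e}. wave b1 \<mu> (2 * \<i> * \<mu>) 0 (y - 0) = wave b \<mu> p q (y - x0))"
      using b1 a by (intro exI[of _ "x - 1"] exI[of _ "x + 1"] exI[of _ b1] exI[of _ "2 * \<i> * \<mu>"] exI[of _ 0] conjI) auto
  qed
  moreover have "fst (wave b1 \<mu> (2 * \<i> * \<mu>) 0 (x - 0)) = plane_wave b1 \<mu> x" for x
    using \<mu> by (simp add: wave_def plane_wave_def)
  ultimately show thesis
    using that[of "plane_wave b1 \<mu>" 1] is_solution_iff_flux[OF coeff_nonzero(2)] by auto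
next
  case False
  \<comment> \<open>Makes the incident amplitude at 0 equal to 2 i \<mu>, which belongs to a plane
    wave with coefficient 1.\<close>
  define c where "c = 2 * \<i> * \<mu> / amp_iter \<mu> k"
  define p where "p = (\<lambda>n. c * amp_iter \<mu> (k - n))"
  define q where "q = (\<lambda>n. c * amp_iter \<mu> (k - n) * refl_iter \<mu> (k - n))"
  have rec: "p n = cell_den contrast (phase \<mu>) (p (Suc n)) (q (Suc n)) / (phase \<mu> * (1 - contrast\<^sup>2))"
    "q n = cell_num contrast (phase \<mu>) (p (Suc n)) (q (Suc n)) / (phase \<mu> * (1 - contrast\<^sup>2))"
    if "False \<or> n < k" for n
  proof -
    have k: "k - n = Suc (k - Suc n)" using that by simp
    show "p n = cell_den contrast (phase \<mu>) (p (Suc n)) (q (Suc n)) / (phase \<mu> * (1 - contrast\<^sup>2))"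
      "q n = cell_num contrast (phase \<mu>) (p (Suc n)) (q (Suc n)) / (phase \<mu> * (1 - contrast\<^sup>2))"
      unfolding p_def q_def amp_iter_step k by simp_all
  qed
  from layered_solution_exists[of \<mu> False k p q, OF \<mu> rec] obtain G where
    G: "\<And>x. x \<le> 0 \<Longrightarrow> G x = outer_wave \<mu> p q 0 x" "\<And>x. real k \<le> x \<Longrightarrow> G x = outer_wave \<mu> p q k x"
    and sol: "\<And>a I. (\<And>x. x \<in> I \<Longrightarrow> isCont a x \<Longrightarrow> continuity_layer a False k x) \<Longrightarrow>
       solution_with_flux a \<mu> I (\<lambda>x. fst (G x)) (\<lambda>x. snd (G x))" by metis
  have "is_solution (coeff_fin b1 b2 x2 k) \<mu> UNIV (\<lambda>x. fst (G x))"
    unfolding is_solution_iff_flux[OF coeff_nonzero(2)]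
    using sol[OF continuity_layer_finite[OF False]] by blast
  moreover have "fst (G x) = plane_wave b1 \<mu> x + refl_iter \<mu> k * plane_wave b1 (- \<mu>) x" if "x < 0" for x
  proof -
    have "p 0 = 2 * \<i> * \<mu>" "q 0 = 2 * \<i> * \<mu> * refl_iter \<mu> k"
      using amp_iter_nonzero[of k] by (simp_all add: p_def q_def c_def)
    then show ?thesis using that G(1)[of x] \<mu> by (simp add: outer_wave_left)
  qed
  moreover have "fst (G x) = (c / (2 * \<i> * \<mu>) * exp (- (\<i> * \<mu> * b1 * k))) * plane_wave b1 \<mu> x" if "x > real k" for x
    using that G(2)[of x] \<mu>
    by (simp add: outer_wave_def wave_def p_def q_def amp_iter_def refl_iter_def plane_wave_def
      exp_add[symmetric] algebra_simps)
  ultimately show thesis using that by blast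
qed

end

lemma cmod_phase_real: "cmod (phase (of_real \<mu>)) = 1"
  by (simp add: phase_def half_phase_def norm_power norm_exp_eq_Re)

lemma ex_scattering_fin_iff:
  assumes "\<mu> \<noteq> 0"
  shows "(\<exists>t. is_scattering_fin b1 b2 x2 k \<mu> r t) \<longleftrightarrow> r = (cell_map contrast (phase (of_real \<mu>)) ^^ k) 0"
proof -
  let ?\<mu> = "complex_of_real \<mu>"
  have \<mu>: "?\<mu> \<noteq> 0" and le: "cmod (phase ?\<mu>) \<le> 1" using assms cmod_phase_real by auto
  note fin = finite_amplitudes[OF \<mu> le] finite_solution_exists[OF \<mu> le, of k]
  show ?thesis
  proof
    assume "\<exists>t. is_scattering_fin b1 b2 x2 k \<mu> r t"
    then obtain \<psi> \<phi> t where sol: "solution_with_flux (coeff_fin b1 b2 x2 k) ?\<mu> UNIV \<psi> \<phi>"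
      and \<psi>: "\<And>x. x < 0 \<Longrightarrow> \<psi> x = plane_wave b1 ?\<mu> x + r * plane_wave b1 (- ?\<mu>) x"
        "\<And>x. x > real k \<Longrightarrow> \<psi> x = t * plane_wave b1 ?\<mu> x"
      unfolding is_scattering_fin_def is_solution_iff_flux[OF coeff_nonzero(2)] by blast
    have b: "b1 \<noteq> 0" using b1 by simp
    have out: "amp (- b1) ?\<mu> (\<psi> k) (\<phi> k) = 0"
      by (rule amp_plane_waves_right[OF sol b _ \<psi>(2)]) (simp_all add: coeff_fin_def)
    have left: "amp b1 ?\<mu> (\<psi> 0) (\<phi> 0) = 2 * \<i> * ?\<mu>" "amp (- b1) ?\<mu> (\<psi> 0) (\<phi> 0) = 2 * \<i> * ?\<mu> * r"
      by (rule amp_plane_waves_left[OF sol b _ \<psi>(1)]; simp add: coeff_fin_def)+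
    have "2 * \<i> * ?\<mu> * r = 2 * \<i> * ?\<mu> * refl_iter ?\<mu> k"
      using finite_amplitudes[OF \<mu> le sol out] left by simp
    then show "r = (cell_map contrast (phase ?\<mu>) ^^ k) 0"
      using \<mu> by (simp add: refl_iter_def)
  next
    assume r: "r = (cell_map contrast (phase ?\<mu>) ^^ k) 0"
    show "\<exists>t. is_scattering_fin b1 b2 x2 k \<mu> r t"
      using finite_solution_exists[OF \<mu> le, of k]
      unfolding is_scattering_fin_def r refl_iter_def by metis
  qed
qed

lemma tendsto_phase: "(f \<longlongrightarrow> \<mu>) F \<Longrightarrow> ((\<lambda>x. phase (f x)) \<longlongrightarrow> phase \<mu>) F"
  unfolding phase_def half_phase_def by (intro tendsto_intros)

lemma refl_fin_eq: "refl_fin b1 b2 x2 k \<mu> = (cell_map contrast (phase (of_real \<mu>)) ^^ k) 0"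
proof -
  define R where "R = (\<lambda>\<nu>::real. (cell_map contrast (phase (of_real \<nu>)) ^^ k) 0)"
  have R: "(THE r. \<exists>t. is_scattering_fin b1 b2 x2 k \<nu> r t) = R \<nu>" if "\<nu> \<noteq> 0" for \<nu>
    unfolding ex_scattering_fin_iff[OF that] R_def by simp
  \<comment> \<open>Settles the frequency 0, where \<open>refl_fin\<close> is a limit. The iterates
    depend continuously on the frequency, as they stay in the disk where no denominator
    vanishes.\<close>
  have "(R \<longlongrightarrow> R 0) (at 0)"
    unfolding R_def
  proof (induction k)
    case (Suc k)
    let ?w = "(cell_map contrast (phase (of_real 0)) ^^ k) 0"
    have le: "cmod (phase (of_real 0)) \<le> 1" by (rule eq_refl[OF cmod_phase_real])
    have w: "cmod ?w \<le> 1" using cell_map_iter_less[OF abs_contrast le, of k] by simp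
    note ph = tendsto_phase[OF tendsto_of_real[OF tendsto_ident_at]]
    show ?case unfolding funpow.simps o_apply cell_map_def[of _ _ "(_ ^^ k) 0"] Let_def
      by (intro tendsto_intros ph Suc cell_map_nonzero1[OF abs_contrast le w] cell_map_nonzero2[OF abs_contrast le w])
  qed simp
  moreover have "eventually (\<lambda>\<nu>. R \<nu> = (THE r. \<exists>t. is_scattering_fin b1 b2 x2 k \<nu> r t)) (at 0)"
    using R by (auto simp: eventually_at_filter)
  ultimately have "((\<lambda>\<nu>. THE r. \<exists>t. is_scattering_fin b1 b2 x2 k \<nu> r t) \<longlongrightarrow> R 0) (at 0)"
    by (rule Lim_transform_eventually)
  then have "Lim (at 0) (\<lambda>\<nu>. THE r. \<exists>t. is_scattering_fin b1 b2 x2 k \<nu> r t) = R 0"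
    by (intro tendsto_Lim) auto
  then show ?thesis using R by (auto simp: refl_fin_def Let_def R_def)
qed

subsection \<open>The half-infinite medium\<close>

text \<open>Inside a layer both amplitudes can be recovered from the values of the solution at two points
  at a fixed distance, so square integrability of the solution alone controls them.\<close>

lemma decaying_amplitudes:
  assumes sol: "solution_with_flux (coeff_per b1 b2 x2) \<mu> {0..} \<psi> \<phi>"
    and int: "set_integrable lborel {0..} (\<lambda>x. (cmod (\<psi> x))\<^sup>2)" and Im: "Im \<mu> > 0"
  shows "(\<lambda>n. amp b1 \<mu> (\<psi> (real n)) (\<phi> (real n))) \<longlonglongrightarrow> 0"
    "(\<lambda>n. amp (- b1) \<mu> (\<psi> (real n)) (\<phi> (real n))) \<longlonglongrightarrow> 0"
proof -
  \<comment> \<open>Half the width of the \<open>b2\<close> layer: for x in [n, n + h] both x and x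
    + h lie in the layer, and the two windows tile it.\<close>
  define h where "h = x2 / 2"
  have h: "0 < h" "2 * h = x2" using x2 by (auto simp: h_def)
  define U where "U = (\<lambda>x. amp b2 \<mu> (\<psi> x) (\<phi> x))"
  define V where "V = (\<lambda>x. amp (- b2) \<mu> (\<psi> x) (\<phi> x))"
  define e where "e = (\<lambda>y::real. exp (\<i> * \<mu> * b2 * y))"
  have ce: "cmod (e y) = exp (- (Im \<mu> * b2 * y))" for y by (simp add: e_def norm_exp_eq_Re)
  have e_nz: "e y \<noteq> 0" for y by (simp add: e_def)
  let ?E = "e h"
  have E: "0 < cmod ?E" "cmod ?E < 1" using Im b2 h by (simp_all add: ce)
  \<comment> \<open>Up to sign this is the determinant of the linear system for \<open>U x\<close>
    and \<open>V x\<close> in terms of the solution at x and x + h.\<close>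
  have E2: "?E - 1 / ?E \<noteq> 0"
  proof
    assume "?E - 1 / ?E = 0"
    then have "?E * ?E = 1" using e_nz[of h] by (simp add: field_simps)
    then have "cmod ?E * cmod ?E = 1" by (metis norm_mult norm_one)
    moreover have "cmod ?E * cmod ?E < 1 * 1" using E by (intro mult_strict_mono) auto
    ultimately show False by simp
  qed
  have sum: "2 * \<i> * \<mu> * \<psi> x = U x + V x" for x by (simp add: U_def V_def amp_def)
  have tr: "U y = e (y - x) * U x" "V y = V x / e (y - x)"
    if "real n \<le> x" "x \<le> y" "y \<le> real n + x2" for n x y
  proof -
    have sub: "{x..y} \<subseteq> {0..}" using that by auto
    have a: "coeff_per b1 b2 x2 t = 1 / b2\<^sup>2" if "t \<in> {x<..<y}" for t
      using coeff_per_layer2[of n t] that \<open>real n \<le> x\<close> \<open>y \<le> real n + x2\<close> by auto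
    show "U y = e (y - x) * U x"
      using amp_transport[OF sol sub \<open>x \<le> y\<close>, of b2] a b2 by (simp add: U_def e_def)
    have "exp (\<i> * \<mu> * of_real (- b2) * of_real (y - x)) = 1 / e (y - x)"
      by (simp only: e_def of_real_minus mult_minus_right mult_minus_left exp_minus inverse_eq_divide)
    then show "V y = V x / e (y - x)"
      using amp_transport[OF sol sub \<open>x \<le> y\<close>, of "- b2"] a b2 by (simp add: V_def)
  qed
  define K where "K = 2 * cmod \<mu> / (cmod ?E * cmod (?E - 1 / ?E))"
  have K: "0 \<le> K" by (simp add: K_def)
  have K_eq: "K * cmod (?E - 1 / ?E) = 2 * cmod \<mu> / cmod ?E"
    using E2 by (simp add: K_def)
  define f where "f = (\<lambda>x. (cmod (\<psi> x))\<^sup>2)"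
  \<comment> \<open>The extra division by \<open>cmod ?E\<close> carries the bound from x back to n;
    the 2 comes from (y + z)^2 \<le> 2 (y^2 + z^2).\<close>
  define C where "C = 2 * (K / cmod ?E)\<^sup>2"
  have C: "0 \<le> C" by (simp add: C_def)
  have point: "(cmod (U n))\<^sup>2 \<le> C * (f x + f (x + h))" "(cmod (V n))\<^sup>2 \<le> C * (f x + f (x + h))"
    if x: "real n \<le> x" "x \<le> real n + h" for n x
  proof -
    let ?s = "cmod (\<psi> (x + h)) + cmod (\<psi> x)"
    have le: "x \<le> x + h" "x + h \<le> real n + x2" "x \<le> real n + x2" using x h by auto
    have t1: "U (x + h) = ?E * U x" "V (x + h) = V x / ?E" using tr[OF x(1) le(1,2)] by simp_all
    have t0: "U x = e (x - n) * U n" "V x = V n / e (x - n)" using tr[OF order_refl x(1) le(3)] by simp_all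
    have "(?E - 1 / ?E) * U x = 2 * \<i> * \<mu> * \<psi> (x + h) - (2 * \<i> * \<mu> * \<psi> x) / ?E"
      unfolding sum t1 using e_nz[of h] by (simp add: field_simps)
    then have u1: "(?E - 1 / ?E) * U x = 2 * \<i> * \<mu> * (\<psi> (x + h) - \<psi> x / ?E)"
      by (simp add: algebra_simps)
    have "(?E - 1 / ?E) * V x = (2 * \<i> * \<mu> * \<psi> x) * ?E - 2 * \<i> * \<mu> * \<psi> (x + h)"
      unfolding sum t1 using e_nz[of h] by (simp add: field_simps)
    then have v1: "(?E - 1 / ?E) * V x = 2 * \<i> * \<mu> * (\<psi> x * ?E - \<psi> (x + h))"
      by (simp add: algebra_simps)
    have E1: "1 \<le> 1 / cmod ?E" using E by simp
    have m1: "cmod (\<psi> (x + h)) \<le> cmod (\<psi> (x + h)) / cmod ?E"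
      using mult_left_mono[OF E1, of "cmod (\<psi> (x + h))"] by simp
    have "cmod (\<psi> (x + h) - \<psi> x / ?E) \<le> cmod (\<psi> (x + h)) + cmod (\<psi> x) / cmod ?E"
      using norm_triangle_ineq4[of "\<psi> (x + h)" "\<psi> x / ?E"] by (simp add: norm_divide)
    then have u2: "cmod (\<psi> (x + h) - \<psi> x / ?E) \<le> ?s / cmod ?E"
      using m1 by (simp add: add_divide_distrib)
    have "cmod (\<psi> x * ?E - \<psi> (x + h)) \<le> cmod (\<psi> x) * cmod ?E + cmod (\<psi> (x + h))"
      using norm_triangle_ineq4[of "\<psi> x * ?E" "\<psi> (x + h)"] by (simp add: norm_mult)
    moreover have "cmod (\<psi> x) * cmod ?E \<le> cmod (\<psi> x) * (1 / cmod ?E)"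
      using E E1 by (intro mult_left_mono[OF order_trans[of _ 1]]) auto
    ultimately have v2: "cmod (\<psi> x * ?E - \<psi> (x + h)) \<le> ?s / cmod ?E"
      using m1 by (simp add: add_divide_distrib)
    have bound: "cmod W \<le> K * ?s" if "(?E - 1 / ?E) * W = 2 * \<i> * \<mu> * D" "cmod D \<le> ?s / cmod ?E" for W D
    proof -
      have "cmod (?E - 1 / ?E) * cmod W = 2 * cmod \<mu> * cmod D"
        using arg_cong[OF that(1), of cmod] by (simp add: norm_mult)
      also have "\<dots> \<le> 2 * cmod \<mu> * (?s / cmod ?E)" using that(2) by (intro mult_left_mono) auto
      also have "\<dots> = (K * cmod (?E - 1 / ?E)) * ?s" unfolding K_eq by simp
      also have "\<dots> = cmod (?E - 1 / ?E) * (K * ?s)" by (simp only: mult_ac)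
      finally show ?thesis using E2 by simp
    qed
    have xs: "cmod (e (x - n)) \<le> 1" "cmod ?E \<le> cmod (e (x - n))"
      using x Im b2 by (simp_all add: ce mult_left_mono)
    have "cmod (U n) = cmod (U x) / cmod (e (x - n))"
      using e_nz[of "x - n"] by (simp add: t0 norm_mult)
    also have "\<dots> \<le> (K * ?s) / cmod ?E"
      using bound[OF u1 u2] xs E by (intro frac_le) (auto simp: K)
    finally have un: "cmod (U n) \<le> (K * ?s) / cmod ?E" .
    have "cmod (V n) = cmod (V x) * cmod (e (x - n))"
      using e_nz[of "x - n"] by (simp add: t0 norm_divide)
    also have "\<dots> \<le> (K * ?s) * (1 / cmod ?E)"
      using bound[OF v1 v2] xs E1 K by (intro mult_mono) auto
    finally have vn: "cmod (V n) \<le> (K * ?s) / cmod ?E" by simp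
    have sq: "y\<^sup>2 \<le> C * (f x + f (x + h))" if "y \<le> (K * ?s) / cmod ?E" "0 \<le> y" for y
    proof -
      have "y\<^sup>2 \<le> ((K * ?s) / cmod ?E)\<^sup>2" using that by (intro power_mono) auto
      also have "\<dots> = (K / cmod ?E)\<^sup>2 * ?s\<^sup>2" by (simp add: power_mult_distrib power_divide)
      also have "\<dots> \<le> (K / cmod ?E)\<^sup>2 * (2 * (f x + f (x + h)))"
      proof (rule mult_left_mono)
        have "0 \<le> (cmod (\<psi> (x + h)) - cmod (\<psi> x))\<^sup>2" by simp
        then show "?s\<^sup>2 \<le> 2 * (f x + f (x + h))"
          unfolding f_def by (simp add: power2_eq_square algebra_simps)
      qed simp
      finally show ?thesis by (simp only: C_def mult_ac)
    qed
    show "(cmod (U n))\<^sup>2 \<le> C * (f x + f (x + h))" "(cmod (V n))\<^sup>2 \<le> C * (f x + f (x + h))"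
      using sq[OF un] sq[OF vn] by simp_all
  qed
  have cont: "continuous_on {0..} f"
    using sol unfolding f_def solution_with_flux_def by (auto intro!: continuous_intros)
  \<comment> \<open>Integrating the pointwise bound over [n, n + h] leaves the integral over the
    whole \<open>b2\<close> layer, because the shifted term contributes its second half.\<close>
  have window: "S\<^sup>2 \<le> C / h * integral {real n..real n + x2} f"
    if S: "\<And>x. real n \<le> x \<Longrightarrow> x \<le> real n + h \<Longrightarrow> S\<^sup>2 \<le> C * (f x + f (x + h))" for S n
  proof -
    have i: "f integrable_on {a..b}" if "0 \<le> a" for a b
      by (rule integrable_continuous_real, rule continuous_on_subset[OF cont]) (use that in auto)
    have "f integrable_on {real n + h..real n + h + h}" by (rule i) (use h in simp)
    from integrable_shift_real_ivl[OF this, of h] have ish: "(\<lambda>x. f (x + h)) integrable_on {real n..real n + h}"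
      by (simp add: add.commute)
    have "(\<lambda>x. f x + f (x + h)) integrable_on {real n..real n + h}"
      by (intro integrable_add i ish) simp
    from integrable_cmul[OF this, of C]
    have iC: "(\<lambda>x. C * (f x + f (x + h))) integrable_on {real n..real n + h}" by simp
    have "h * S\<^sup>2 = integral {real n..real n + h} (\<lambda>x. S\<^sup>2)" using h by simp
    also have "\<dots> \<le> integral {real n..real n + h} (\<lambda>x. C * (f x + f (x + h)))"
      using S iC by (intro integral_le) auto
    also have "\<dots> = C * (integral {real n..real n + h} f + integral {real n..real n + h} (\<lambda>x. f (x + h)))"
      using i[of n] ish by (simp add: integral_add)
    also have "integral {real n..real n + h} (\<lambda>x. f (x + h)) = integral {real n + h..real n + h + h} f"
      using integral_shift_real_ivl[of "real n + h" h "real n + h + h" f] by (simp add: add.commute)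
    also have "integral {real n..real n + h} f + integral {real n + h..real n + h + h} f
        = integral {real n..real n + h + h} f"
      using h i[of n] by (intro Henstock_Kurzweil_Integration.integral_combine) auto
    also have "real n + h + h = real n + x2" using h by simp
    finally show ?thesis using h by (simp add: field_simps)
  qed
  have lim: "(\<lambda>n. C / h * integral {real n..real n + x2} f) \<longlonglongrightarrow> 0"
    using window_integral_tendsto_0[of f x2] int x2 unfolding f_def
    by (intro tendsto_mult_right_zero) auto
  have lim0: "W \<longlonglongrightarrow> 0"
    if "\<And>n x. real n \<le> x \<Longrightarrow> x \<le> real n + h \<Longrightarrow> (cmod (W n))\<^sup>2 \<le> C * (f x + f (x + h))" for W
  proof -
    have "(\<lambda>n. (cmod (W n))\<^sup>2) \<longlonglongrightarrow> 0"
      using window[OF that] by (intro Lim_null_comparison[OF _ lim]) auto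
    then have "(\<lambda>n. sqrt ((cmod (W n))\<^sup>2)) \<longlonglongrightarrow> sqrt 0" by (rule tendsto_real_sqrt)
    then show ?thesis by (simp add: tendsto_norm_zero_iff)
  qed
  have UV: "(\<lambda>n. U (real n)) \<longlonglongrightarrow> 0" "(\<lambda>n. V (real n)) \<longlonglongrightarrow> 0"
    using point by (auto intro!: lim0)
  have conv: "amp c \<mu> (\<psi> x) (\<phi> x) = ((b2 + c) * U x + (b2 - c) * V x) / (2 * b2)" for c x
    using b2 by (simp add: U_def V_def amp_def field_simps)
  have "(\<lambda>n. amp c \<mu> (\<psi> (real n)) (\<phi> (real n))) \<longlonglongrightarrow>
      (of_real (b2 + c) * 0 + of_real (b2 - c) * 0) / of_real (2 * b2)" for c
    unfolding conv using b2 by (intro tendsto_intros UV) auto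
  then show "(\<lambda>n. amp b1 \<mu> (\<psi> (real n)) (\<phi> (real n))) \<longlonglongrightarrow> 0"
    "(\<lambda>n. amp (- b1) \<mu> (\<psi> (real n)) (\<phi> (real n))) \<longlonglongrightarrow> 0" by simp_all
qed

lemma decaying_solutions_proportional:
  assumes 1: "solution_with_flux (coeff_per b1 b2 x2) \<mu> {0..} \<psi> \<phi>"
      "set_integrable lborel {0..} (\<lambda>x. (cmod (\<psi> x))\<^sup>2)"
    and 2: "solution_with_flux (coeff_per b1 b2 x2) \<mu> {0..} \<psi>' \<phi>'"
      "set_integrable lborel {0..} (\<lambda>x. (cmod (\<psi>' x))\<^sup>2)"
    and Im: "Im \<mu> > 0"
  shows "amp b1 \<mu> (\<psi> 0) (\<phi> 0) * amp (- b1) \<mu> (\<psi>' 0) (\<phi>' 0)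
     = amp (- b1) \<mu> (\<psi> 0) (\<phi> 0) * amp b1 \<mu> (\<psi>' 0) (\<phi>' 0)"
proof -
  define W where "W = (\<lambda>x. amp b1 \<mu> (\<psi> x) (\<phi> x) * amp (- b1) \<mu> (\<psi>' x) (\<phi>' x)
     - amp (- b1) \<mu> (\<psi> x) (\<phi> x) * amp b1 \<mu> (\<psi>' x) (\<phi>' x))"
  have step: "W (real n) = W (real n + 1)" for n
  proof -
    let ?D = "phase \<mu> * (1 - contrast\<^sup>2)"
    have sub: "{real n..real n + 1} \<subseteq> {0..}" by auto
    have D: "(phase \<mu> * (1 - contrast\<^sup>2))\<^sup>2 \<noteq> 0" using det_nonzero by simp
    have "a / ?D * (b / ?D) - c / ?D * (d / ?D) = (a * b - c * d) / ?D\<^sup>2" for a b c d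
      by (simp add: power2_eq_square diff_divide_distrib)
    then show ?thesis unfolding W_def
      using cell_transfer[OF 1(1) sub refl] cell_transfer[OF 2(1) sub refl] D
      by (simp add: cell_wronskian)
  qed
  have const: "W (real n) = W 0" for n
  proof (induction n)
    case (Suc n)
    then show ?case using step[of n] by (simp add: add.commute)
  qed simp
  have "(\<lambda>n. W (real n)) \<longlonglongrightarrow> 0 * 0 - 0 * 0"
    unfolding W_def by (intro tendsto_intros decaying_amplitudes[OF 1 Im] decaying_amplitudes[OF 2 Im])
  then have "W 0 = 0" unfolding const by (simp add: LIMSEQ_const_iff)
  then show ?thesis by (simp add: W_def)
qed

section \<open>The decaying solution and its reflection coefficient\<close>

lemma continuity_layer_half:
  assumes "b1 \<noteq> b2" "isCont (coeff_half b1 b2 x2) x"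
  shows "continuity_layer (coeff_half b1 b2 x2) True k x"
  by (rule continuity_layer_infinite[OF assms]) (auto simp: coeff_half_def)

text \<open>For distinct \<open>b1\<close> and \<open>b2\<close> the periodic coefficient jumps at
  0, so no one-sided equation is demanded at the end point; near every x > 0 the two coefficients
  coincide.\<close>

lemma solution_half_restrict:
  assumes ne: "b1 \<noteq> b2" and sol: "solution_with_flux (coeff_half b1 b2 x2) \<mu> UNIV \<psi> \<phi>"
  shows "solution_with_flux (coeff_per b1 b2 x2) \<mu> {0..} \<psi> \<phi>"
  unfolding solution_with_flux_def
proof (intro conjI ballI impI)
  show "continuous_on {0..} \<psi>" "continuous_on {0..} \<phi>"
    using sol by (auto simp: solution_with_flux_def intro: continuous_on_subset)
  fix x :: real assume x: "x \<in> {0..}" and c: "isCont (coeff_per b1 b2 x2) x"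
  show "coeff_per b1 b2 x2 x \<noteq> 0" by (rule coeff_nonzero)
  have "\<not> isCont (coeff_per b1 b2 x2) (real 0)"
    using coeff_per_layer2[of 0 0] coeff_per_left_of_nat[of _ 0] x2 by (intro not_isCont_at_nat[OF ne]) auto
  then have x0: "0 < x" using x c by (cases "x = 0") auto
  have "eventually (\<lambda>y. y \<in> {0<..}) (nhds x)"
    using x0 by (intro eventually_nhds_in_open) auto
  then have "eventually (\<lambda>y. coeff_per b1 b2 x2 y = coeff_half b1 b2 x2 y) (nhds x)"
    by eventually_elim (simp add: coeff_half_def)
  then have "isCont (coeff_half b1 b2 x2) x" using c isCont_cong by blast
  with sol have "(\<psi> has_vector_derivative (\<phi> x / coeff_half b1 b2 x2 x)) (at x)"
      "(\<phi> has_vector_derivative (- (\<mu>\<^sup>2 * \<psi> x))) (at x)"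
    by (auto simp: solution_with_flux_def)
  then show "(\<psi> has_vector_derivative (\<phi> x / coeff_per b1 b2 x2 x)) (at x within {0..})"
    "(\<phi> has_vector_derivative (- (\<mu>\<^sup>2 * \<psi> x))) (at x within {0..})"
    using x0 by (auto simp: coeff_half_def intro: has_vector_derivative_at_within)
qed

context
  fixes \<mu> z :: complex
  assumes ne: "b1 \<noteq> b2" and Im: "Im \<mu> > 0" and z: "cmod z < 1" and fp: "cell_map contrast (phase \<mu>) z = z"
    and mult: "cmod (phase \<mu> * (1 - contrast\<^sup>2)) < cmod (cell_den contrast (phase \<mu>) 1 z)"
begin

lemma half_solution_exists:
  obtains \<psi> \<phi> where "solution_with_flux (coeff_half b1 b2 x2) \<mu> UNIV \<psi> \<phi>"
    "\<And>x. x < 0 \<Longrightarrow> \<psi> x = plane_wave b1 \<mu> x + z * plane_wave b1 (- \<mu>) x"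
    "set_integrable lborel {0..} (\<lambda>x. (cmod (\<psi> x))\<^sup>2)" "\<psi> 0 = 1 + z"
proof -
  have \<mu>: "\<mu> \<noteq> 0" using Im by auto
  let ?den = "cell_den contrast (phase \<mu>) 1 z"
  \<comment> \<open>The Floquet multiplier. At a fixed point the ratio of the amplitudes repeats in
    every cell and both are multiplied by \<open>m\<close>; the hypothesis \<open>mult\<close> says
    that \<open>cmod m < 1\<close>.\<close>
  define m where "m = phase \<mu> * (1 - contrast\<^sup>2) / ?den"
  have den: "?den \<noteq> 0" using mult by auto
  have m: "0 < cmod m" "cmod m < 1"
    using mult det_nonzero[of \<mu>] den by (auto simp: m_def norm_divide)
  define p where "p = (\<lambda>n::nat. m ^ n * (2 * \<i> * \<mu>))"
  define q where "q = (\<lambda>n::nat. m ^ n * (2 * \<i> * \<mu> * z))"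
  have num: "cell_num contrast (phase \<mu>) 1 z = z * ?den"
    using fp cell_map_eq_disk[OF abs_contrast _ less_imp_le[OF z]] cmod_phase_less[OF Im] den
    by (simp add: field_simps)
  have p: "p n = cell_den contrast (phase \<mu>) (p (Suc n)) (q (Suc n)) / (phase \<mu> * (1 - contrast\<^sup>2))" for n
    using cell_den_scale[of contrast "phase \<mu>" "m ^ Suc n * (2 * \<i> * \<mu>)" 1 z] det_nonzero[of \<mu>] den
    by (simp add: p_def q_def mult.assoc) (simp add: m_def field_simps)
  have q: "q n = cell_num contrast (phase \<mu>) (p (Suc n)) (q (Suc n)) / (phase \<mu> * (1 - contrast\<^sup>2))" for n
    using cell_num_scale[of contrast "phase \<mu>" "m ^ Suc n * (2 * \<i> * \<mu>)" 1 z] det_nonzero[of \<mu>] den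
    unfolding num by (simp add: p_def q_def mult.assoc) (simp add: m_def field_simps)
  show thesis
  proof (rule layered_solution_exists[of \<mu> True 0 p q, OF \<mu> p q])
    fix G assume
      G': "continuous_on UNIV G" "\<And>x. x \<le> 0 \<Longrightarrow> G x = outer_wave \<mu> p q 0 x"
        "\<And>n x. True \<or> n < 0 \<Longrightarrow> real n \<le> x \<Longrightarrow> x \<le> n + x2 \<Longrightarrow> G x = inner_wave \<mu> p q n x"
        "\<And>n x. True \<or> n < 0 \<Longrightarrow> real n + x2 \<le> x \<Longrightarrow> x \<le> n + 1 \<Longrightarrow> G x = outer_wave \<mu> p q (Suc n) x"
      and sol: "\<And>a I. (\<And>x. x \<in> I \<Longrightarrow> isCont a x \<Longrightarrow> continuity_layer a True 0 x) \<Longrightarrow>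
         solution_with_flux a \<mu> I (\<lambda>x. fst (G x)) (\<lambda>x. snd (G x))"
    note G = G'(1,2) G'(3,4)[OF disjI1[OF TrueI]]
    have pq0: "p 0 = 2 * \<i> * \<mu>" "q 0 = 2 * \<i> * \<mu> * z" by (simp_all add: p_def q_def)
    have left: "fst (G x) = plane_wave b1 \<mu> x + z * plane_wave b1 (- \<mu>) x" if "x \<le> 0" for x
      using G(2)[OF that] outer_wave_left[of p \<mu> q z, OF pq0 \<mu>] by simp
    have outer: "outer_wave \<mu> p q (n + j) (x + n) = (m ^ n * fst (outer_wave \<mu> p q j x), m ^ n * snd (outer_wave \<mu> p q j x))"
      for n j and x :: real
      using wave_scale[of b1 \<mu> "m ^ n" "p j" "q j" "x - j"]
      by (simp add: outer_wave_def p_def q_def power_add mult.assoc)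
    have inner: "fst (inner_wave \<mu> p q n (x + n)) = m ^ n * fst (inner_wave \<mu> p q 0 x)" for n and x :: real
      using outer[of n 1 x2]
      by (simp add: inner_wave_def case_prod_beta amp_scale wave_scale add.commute)
    \<comment> \<open>Quasi-periodicity: a bound on the first cell becomes a geometric bound on the
      half-line.\<close>
    have shift: "fst (G (x + n)) = m ^ n * fst (G x)" if "0 \<le> x" "x \<le> 1" for n and x :: real
    proof (cases "x \<le> x2")
      case True
      then show ?thesis using G(3)[of n "x + n"] G(3)[of 0 x] that inner by simp
    next
      case False
      then show ?thesis using G(4)[of n "x + n"] G(4)[of 0 x] that outer[of n 1 x] by simp
    qed
    have cont: "continuous_on S (\<lambda>x. fst (G x))" for S
      using continuous_on_subset[OF G(1), of S] by (auto intro: continuous_intros)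
    have "bounded ((\<lambda>x. fst (G x)) ` {0..1})"
      by (intro compact_imp_bounded compact_continuous_image cont) simp
    then obtain K where "\<forall>x\<in>{0..1}. cmod (fst (G x)) \<le> K"
      unfolding bounded_iff by auto
    then have K: "cmod (fst (G x)) \<le> K" if "0 \<le> x" "x \<le> 1" for x using that by simp
    have "0 \<le> K" using order_trans[OF norm_ge_zero K[of 0]] by simp
    have "set_integrable lborel {0..} (\<lambda>x. (cmod (fst (G x)))\<^sup>2)"
    proof (rule set_integrable_geometric_bound[OF cont m \<open>0 \<le> K\<close>])
      fix n x assume x: "real n \<le> x" "x \<le> real n + 1"
      then have "cmod (fst (G x)) = cmod m ^ n * cmod (fst (G (x - n)))"
        using shift[of "x - n" n] by (simp add: norm_mult norm_power)
      also have "\<dots> \<le> cmod m ^ n * K" using x K[of "x - n"] by (intro mult_left_mono) auto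
      finally show "cmod (fst (G x)) \<le> K * cmod m ^ n" by (simp add: mult.commute)
    qed
    moreover have "fst (G 0) = 1 + z" using left[of 0] by (simp add: plane_wave_def)
    moreover have "solution_with_flux (coeff_half b1 b2 x2) \<mu> UNIV (\<lambda>x. fst (G x)) (\<lambda>x. snd (G x))"
      by (rule sol[OF continuity_layer_half[OF ne]])
    ultimately show thesis using that[of "\<lambda>x. fst (G x)" "\<lambda>x. snd (G x)"] left by simp
  qed
qed

lemma scattering_half_iff: "is_scattering_half b1 b2 x2 \<mu> r \<longleftrightarrow> r = z"
proof -
  have \<mu>: "\<mu> \<noteq> 0" using Im by auto
  have b: "b1 \<noteq> 0" using b1 by simp
  obtain \<psi>0 \<phi>0 where sol0: "solution_with_flux (coeff_half b1 b2 x2) \<mu> UNIV \<psi>0 \<phi>0"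
    and left0: "\<And>x. x < 0 \<Longrightarrow> \<psi>0 x = plane_wave b1 \<mu> x + z * plane_wave b1 (- \<mu>) x"
    and int0: "set_integrable lborel {0..} (\<lambda>x. (cmod (\<psi>0 x))\<^sup>2)" and val0: "\<psi>0 0 = 1 + z"
    using half_solution_exists by blast
  show ?thesis
  proof
    assume "r = z"
    \<comment> \<open>The decaying solution is normalized to 1 at 0, whereas \<open>\<psi>0\<close>
      takes the value \<open>1 + z\<close> there.\<close>
    have z1: "1 + z \<noteq> 0"
      using z by (metis add_eq_0_iff norm_minus_cancel norm_one order_less_irrefl)
    let ?p = "\<lambda>x. 1 / (1 + z) * \<psi>0 x"
    have "solution_with_flux (coeff_per b1 b2 x2) \<mu> {0..} ?p (\<lambda>x. 1 / (1 + z) * \<phi>0 x)"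
      by (rule solution_with_flux_scale[OF solution_half_restrict[OF ne sol0]])
    moreover have "set_integrable lborel {0..} (\<lambda>x. (cmod (1 / (1 + z)))\<^sup>2 * (cmod (\<psi>0 x))\<^sup>2)"
      using int0 by (rule set_integrable_mult_right)
    then have "set_integrable lborel {0..} (\<lambda>x. (cmod (?p x))\<^sup>2)"
      by (simp only: norm_mult power_mult_distrib)
    ultimately have "is_decaying_solution b1 b2 x2 \<mu> ?p"
      unfolding is_decaying_solution_def is_solution_iff_flux[OF coeff_nonzero(1)]
      using z1 val0 by auto
    moreover have "is_solution (coeff_half b1 b2 x2) \<mu> UNIV \<psi>0"
      unfolding is_solution_iff_flux[OF coeff_nonzero(3)] using sol0 by blast
    moreover have "\<psi>0 x = (1 + z) * ?p x" for x using z1 by simp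
    ultimately show "is_scattering_half b1 b2 x2 \<mu> r"
      unfolding is_scattering_half_def \<open>r = z\<close> using left0 by blast
  next
    assume "is_scattering_half b1 b2 x2 \<mu> r"
    then obtain \<psi> \<psi>p c where "is_solution (coeff_half b1 b2 x2) \<mu> UNIV \<psi>"
      and dec: "is_decaying_solution b1 b2 x2 \<mu> \<psi>p"
      and left: "\<And>x. x < 0 \<Longrightarrow> \<psi> x = plane_wave b1 \<mu> x + r * plane_wave b1 (- \<mu>) x"
      and right: "\<And>x. x > 0 \<Longrightarrow> \<psi> x = c * \<psi>p x"
      unfolding is_scattering_half_def by blast
    then obtain \<phi> where sol: "solution_with_flux (coeff_half b1 b2 x2) \<mu> UNIV \<psi> \<phi>"
      unfolding is_solution_iff_flux[OF coeff_nonzero(3)] by blast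
    have "set_integrable lborel {0..} (\<lambda>x. (cmod c)\<^sup>2 * (cmod (\<psi>p x))\<^sup>2)"
      using dec unfolding is_decaying_solution_def by (intro set_integrable_mult_right) auto
    then have i1: "set_integrable lborel {0..} (\<lambda>x. (cmod (c * \<psi>p x))\<^sup>2)"
      by (simp only: norm_mult power_mult_distrib)
    \<comment> \<open>The definition relates the two functions only for x > 0; continuity from the
      right supplies x = 0.\<close>
    have "\<psi> x = c * \<psi>p x" if "x \<in> {0..}" for x
    proof (cases "x = 0")
      case True
      have "continuous_on {0..} \<psi>" "continuous_on {0..} (\<lambda>x. c * \<psi>p x)"
        using sol dec by (auto simp: solution_with_flux_def is_decaying_solution_def is_solution_def
            intro: continuous_on_subset continuous_intros)
      then have "(\<psi> \<longlongrightarrow> \<psi> 0) (at_right 0)" "((\<lambda>x. c * \<psi>p x) \<longlongrightarrow> c * \<psi>p 0) (at_right 0)"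
        by (auto simp: continuous_on_def intro: tendsto_within_subset)
      moreover have "eventually (\<lambda>x. c * \<psi>p x = \<psi> x) (at_right 0)"
        using right by (auto simp: eventually_at_filter)
      ultimately have "\<psi> 0 = c * \<psi>p 0"
        using tendsto_unique[OF _ _ Lim_transform_eventually] trivial_limit_at_right_real by blast
      then show ?thesis using True by simp
    qed (use right that in auto)
    then have i2: "set_integrable lborel {0..} (\<lambda>x. (cmod (\<psi> x))\<^sup>2)"
      using i1 by (subst set_integrable_cong[OF refl refl]) auto
    \<comment> \<open>Two square integrable solutions have the same amplitude ratio at 0, and these
      ratios are \<open>r\<close> and \<open>z\<close>.\<close>
    have "2 * \<i> * \<mu> * (2 * \<i> * \<mu> * z) = 2 * \<i> * \<mu> * r * (2 * \<i> * \<mu>)"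
      using decaying_solutions_proportional[OF solution_half_restrict[OF ne sol] i2
          solution_half_restrict[OF ne sol0] int0 Im]
        amp_plane_waves_left[OF sol b _ left] amp_plane_waves_left[OF sol0 b _ left0]
      by (simp add: coeff_half_def)
    then show "r = z" using \<mu> by simp
  qed
qed

lemma refl_half_upper_eq: "refl_half_upper b1 b2 x2 \<mu> = z"
  by (simp add: refl_half_upper_def scattering_half_iff)

end

subsection \<open>Gaps and band edges\<close>

lemma half_phase_real: "half_phase (of_real \<mu>) = cis (\<mu> * b2 * x2)"
  by (simp add: half_phase_def cis_conv_exp mult.assoc)

lemma phase_real: "phase (of_real \<mu>) = (cis (\<mu> * b2 * x2))\<^sup>2"
  by (simp add: phase_def half_phase_real)

lemma disk_map_eq: "disk_map b1 b2 x2 \<mu> = cell_map contrast (phase (of_real \<mu>))"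
proof -
  have "exp (2 * \<i> * of_real (\<mu> * b2 * x2)) = phase (of_real \<mu>)"
    by (simp add: phase_def half_phase_def exp_double[symmetric] algebra_simps)
  then show ?thesis
    by (simp add: fun_eq_iff disk_map_def cell_map_def contrast_def Let_def)
qed

text \<open>Rests on \<open>(1 - contrast\<^sup>2) * (\<rho> + 1) = 2\<close>. It turns conditions
  on the Lyapunov function into a comparison of cos^2 with \<open>contrast\<^sup>2\<close>, that is,
  into the sign of the discriminant of the fixed point equation.\<close>

lemma lyapunov_eq:
  "lyapunov b1 b2 x2 \<mu> = (2 * (cos (\<mu> * b2 * x2))\<^sup>2 - 1 - contrast\<^sup>2) / (1 - contrast\<^sup>2)"
proof -
  define \<rho> where "\<rho> = (b1\<^sup>2 + b2\<^sup>2) / (2 * b1 * b2)"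
  have a: "x2 * b2 + (1 - x2) * b1 = 2 * (b2 * x2)" "x2 * b2 - (1 - x2) * b1 = 0"
    using balanced by (simp_all add: algebra_simps)
  have c: "cos (\<mu> * (2 * (b2 * x2))) = 2 * (cos (\<mu> * b2 * x2))\<^sup>2 - 1"
    using cos_double_cos[of "\<mu> * b2 * x2"] by (simp add: mult_ac)
  have d: "contrast * (b2 + b1) = b2 - b1" using b1 b2 by (simp add: contrast_def)
  have "(1 - contrast\<^sup>2) * (b2 + b1)\<^sup>2 = 4 * b1 * b2" using d by algebra
  moreover have "(\<rho> + 1) * (2 * b1 * b2) = (b2 + b1)\<^sup>2"
    using b1 b2 by (simp add: \<rho>_def field_simps power2_eq_square)
  ultimately have "((1 - contrast\<^sup>2) * (\<rho> + 1)) * (2 * b1 * b2) = 2 * (2 * b1 * b2)"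
    by (simp add: mult.assoc)
  moreover have "2 * b1 * b2 \<noteq> 0" using b1 b2 by simp
  ultimately have r: "(1 - contrast\<^sup>2) * (\<rho> + 1) = 2" using mult_right_cancel by blast
  have L: "lyapunov b1 b2 x2 \<mu> = (\<rho> + 1) * (cos (\<mu> * b2 * x2))\<^sup>2 - \<rho>"
    unfolding lyapunov_def Let_def a c \<rho>_def[symmetric] by (simp add: field_simps)
  have "(1 - contrast\<^sup>2) * ((\<rho> + 1) * (cos (\<mu> * b2 * x2))\<^sup>2 - \<rho>)
      = ((1 - contrast\<^sup>2) * (\<rho> + 1)) * (cos (\<mu> * b2 * x2))\<^sup>2 - (1 - contrast\<^sup>2) * (\<rho> + 1) + (1 - contrast\<^sup>2)"
    by (simp add: algebra_simps)
  then have "(1 - contrast\<^sup>2) * ((\<rho> + 1) * (cos (\<mu> * b2 * x2))\<^sup>2 - \<rho>)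
      = 2 * (cos (\<mu> * b2 * x2))\<^sup>2 - 1 - contrast\<^sup>2"
    unfolding r by simp
  then show ?thesis unfolding L using contrast_sq by (simp add: eq_divide_eq mult.commute)
qed

lemma deriv_lyapunov:
  "deriv (lyapunov b1 b2 x2) \<mu> =
     - 4 * (b2 * x2) * cos (\<mu> * b2 * x2) * sin (\<mu> * b2 * x2) / (1 - contrast\<^sup>2)"
proof (rule DERIV_imp_deriv)
  define c where "c = 1 - contrast\<^sup>2"
  have "c \<noteq> 0" using contrast_sq by (simp add: c_def)
  have "lyapunov b1 b2 x2 = (\<lambda>\<mu>. (2 * (cos (\<mu> * b2 * x2))\<^sup>2 - 1 - contrast\<^sup>2) / c)"
    using lyapunov_eq by (auto simp: c_def)
  then have "(lyapunov b1 b2 x2 has_real_derivative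
      - 4 * (b2 * x2) * cos (\<mu> * b2 * x2) * sin (\<mu> * b2 * x2) / c) (at \<mu>)"
    using \<open>c \<noteq> 0\<close> by (auto intro!: derivative_eq_intros simp: field_simps)
  then show "(lyapunov b1 b2 x2 has_real_derivative
      - 4 * (b2 * x2) * cos (\<mu> * b2 * x2) * sin (\<mu> * b2 * x2) / (1 - contrast\<^sup>2)) (at \<mu>)"
    unfolding c_def .
qed

text \<open>All gaps lie on the side below -1, since a value above 1 would require cos^2 >
  1.\<close>

lemma lyapunov_gap_iff: "\<bar>lyapunov b1 b2 x2 \<mu>\<bar> > 1 \<longleftrightarrow> (cos (\<mu> * b2 * x2))\<^sup>2 < contrast\<^sup>2"
proof -
  have "(cos (\<mu> * b2 * x2))\<^sup>2 \<le> 1" using sin_cos_squared_add[of "\<mu> * b2 * x2"] zero_le_power2[of "sin (\<mu> * b2 * x2)"] by linarith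
  then show ?thesis unfolding lyapunov_eq using contrast_sq
    by (auto simp: abs_if field_simps)
qed

text \<open>Together with \<open>deriv_lyapunov\<close>: edges with value 1 have a vanishing sine
  and are degenerate; those with value -1 are degenerate only for zero contrast.\<close>

lemma lyapunov_edge_iff:
  "lyapunov b1 b2 x2 \<mu> = 1 \<longleftrightarrow> (cos (\<mu> * b2 * x2))\<^sup>2 = 1"
  "lyapunov b1 b2 x2 \<mu> = - 1 \<longleftrightarrow> (cos (\<mu> * b2 * x2))\<^sup>2 = contrast\<^sup>2"
  unfolding lyapunov_eq using contrast_sq by (auto simp: field_simps)

lemma contrast_eq_0_iff: "contrast = 0 \<longleftrightarrow> b1 = b2"
  using b1 b2 by (auto simp: contrast_def)

lemma upper_half_plane_trivial_limit: "at (of_real \<mu>) within {\<nu>. Im \<nu> > 0} \<noteq> bot"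
proof -
  have "complex_of_real \<mu> islimpt {\<nu>. Im \<nu> > 0}"
    unfolding islimpt_approachable
  proof (intro allI impI)
    fix e :: real assume "0 < e"
    then show "\<exists>x'\<in>{\<nu>. Im \<nu> > 0}. x' \<noteq> of_real \<mu> \<and> dist x' (of_real \<mu>) < e"
      by (intro bexI[of _ "Complex \<mu> (e / 2)"]) (auto simp: complex_eq_iff dist_norm cmod_def)
  qed
  then show ?thesis by (simp add: trivial_limit_within)
qed

text \<open>The alternatives in the last hypothesis are the double fixed point and the attracting
  one of two. In the upper half plane the coefficient satisfies the fixed point equation and the
  multiplier bound, and \<open>cell_fixpt_tendsto\<close> carries both to the real axis.\<close>

lemma refl_half_eq:
  assumes ne: "b1 \<noteq> b2" and s: "s\<^sup>2 = contrast\<^sup>2 - (cos (\<mu> * b2 * x2))\<^sup>2"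
    and s0: "s = 0 \<or> s * sin (\<mu> * b2 * x2) > 0"
  shows "refl_half b1 b2 x2 \<mu> = cell_fixpt contrast (\<mu> * b2 * x2) s"
proof -
  have d: "contrast \<noteq> 0" using ne contrast_eq_0_iff by simp
  have "(refl_half_upper b1 b2 x2 \<longlongrightarrow> cell_fixpt contrast (\<mu> * b2 * x2) s)
      (at (of_real \<mu>) within {\<nu>. Im \<nu> > 0})"
  proof (rule cell_fixpt_tendsto[OF abs_contrast d s phase_real s0 tendsto_phase[OF tendsto_ident_at]])
    show "eventually (\<lambda>\<nu>. cmod (refl_half_upper b1 b2 x2 \<nu>) < 1 \<and>
        contrast - (1 + phase \<nu>) * refl_half_upper b1 b2 x2 \<nu>
          + contrast * phase \<nu> * (refl_half_upper b1 b2 x2 \<nu>)\<^sup>2 = 0 \<and>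
        cmod (phase \<nu> * (1 - contrast\<^sup>2)) \<le> cmod (cell_den contrast (phase \<nu>) 1 (refl_half_upper b1 b2 x2 \<nu>)))
      (at (of_real \<mu>) within {\<nu>. Im \<nu> > 0})"
      unfolding eventually_at_filter
    proof (intro always_eventually allI impI)
      fix \<nu> :: complex assume "\<nu> \<in> {\<nu>. Im \<nu> > 0}"
      then have Im: "Im \<nu> > 0" by simp
      note lt = cmod_phase_less[OF Im]
      obtain z where z: "cmod z < 1" "cell_map contrast (phase \<nu>) z = z"
        "cmod (phase \<nu> * (1 - contrast\<^sup>2)) < cmod (cell_den contrast (phase \<nu>) 1 z)"
        using cell_map_fixed_point[OF abs_contrast less_imp_le[OF lt] lt] by blast
      have "phase \<nu> \<noteq> 1" using lt by auto
      then have "contrast - (1 + phase \<nu>) * z + contrast * phase \<nu> * z\<^sup>2 = 0"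
        using z(2) cell_map_fixed_iff[OF abs_contrast less_imp_le[OF lt]] by simp
      moreover have "refl_half_upper b1 b2 x2 \<nu> = z"
        by (rule refl_half_upper_eq[OF ne Im z])
      ultimately show "cmod (refl_half_upper b1 b2 x2 \<nu>) < 1 \<and>
        contrast - (1 + phase \<nu>) * refl_half_upper b1 b2 x2 \<nu>
          + contrast * phase \<nu> * (refl_half_upper b1 b2 x2 \<nu>)\<^sup>2 = 0 \<and>
        cmod (phase \<nu> * (1 - contrast\<^sup>2)) \<le> cmod (cell_den contrast (phase \<nu>) 1 (refl_half_upper b1 b2 x2 \<nu>))"
        using z by (simp add: less_imp_le)
    qed
  qed
  then show ?thesis unfolding refl_half_def
    by (intro tendsto_Lim upper_half_plane_trivial_limit)
qed

end

theorem proposition2: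
  fixes b1 b2 x2 \<mu> :: real
  assumes "b1 > 0" and "b2 > 0" and "0 < x2" and "x2 < 1"
    and "b2 * x2 = b1 * (1 - x2)"
  defines "F \<equiv> lyapunov b1 b2 x2"
    and "f \<equiv> disk_map b1 b2 x2 \<mu>"
    and "rk \<equiv> (\<lambda>k. refl_fin b1 b2 x2 k \<mu>)"
    and "r \<equiv> refl_half b1 b2 x2 \<mu>"
  shows "(\<bar>F \<mu>\<bar> > 1 \<longrightarrow>
            (\<exists>z1 z2. z1 \<noteq> z2 \<and> {z. f z = z} = {z1, z2} \<and> cmod z1 = 1 \<and> cmod z2 = 1 \<and>
               rk \<longlonglongrightarrow> r \<and> (\<lambda>k. (f ^^ k) (rk 1)) \<longlonglongrightarrow> r \<and> (r = z1 \<or> r = z2)))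
       \<and> ((F \<mu> = 1 \<or> F \<mu> = -1) \<and> deriv F \<mu> \<noteq> 0 \<longrightarrow>
            (\<exists>z1. {z. f z = z} = {z1} \<and> zorder (\<lambda>z. f z - z) z1 = 2 \<and> cmod z1 = 1 \<and>
               r = z1 \<and> rk \<longlonglongrightarrow> r \<and> (\<lambda>k. (f ^^ k) (rk 1)) \<longlonglongrightarrow> r))
       \<and> ((F \<mu> = 1 \<or> F \<mu> = -1) \<and> deriv F \<mu> = 0 \<longrightarrow> (\<forall>k\<ge>1. rk k = 0))"
proof -
  interpret layered_medium b1 b2 x2 by unfold_locales (use assms in auto)
  define \<theta> where "\<theta> = \<mu> * b2 * x2"
  define \<eta> where "\<eta> = phase (of_real \<mu>)"
  have \<eta>: "\<eta> = (cis \<theta>)\<^sup>2" unfolding \<eta>_def \<theta>_def by (rule phase_real)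
  have f: "f = cell_map contrast \<eta>" unfolding f_def \<eta>_def by (rule disk_map_eq)
  have rk: "rk k = (f ^^ k) 0" for k unfolding f rk_def \<eta>_def by (rule refl_fin_eq)
  \<comment> \<open>\<open>rk 1\<close> is already the first iterate of 0, so the index shifts by
    one.\<close>
  have iter: "(f ^^ k) (rk 1) = rk (Suc k)" for k
    unfolding rk by (simp add: funpow_swap1)
  have lims: "(\<lambda>k. (f ^^ k) (rk 1)) \<longlonglongrightarrow> z" if "rk \<longlonglongrightarrow> z" for z
    unfolding iter using that by (rule LIMSEQ_Suc)
  note eqs = lyapunov_edge_iff[of \<mu>, folded \<theta>_def] deriv_lyapunov[of \<mu>, folded \<theta>_def]
  show ?thesis
  proof (intro conjI impI)
    assume "1 < \<bar>F \<mu>\<bar>"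
    then have lt: "(cos \<theta>)\<^sup>2 < contrast\<^sup>2" unfolding F_def \<theta>_def by (simp only: lyapunov_gap_iff)
    then have d: "contrast \<noteq> 0" by auto
    then have ne: "b1 \<noteq> b2" using contrast_eq_0_iff by simp
    \<comment> \<open>The sign makes \<open>s * sin \<theta>\<close> positive, which selects the
      attracting fixed point.\<close>
    define s where "s = sgn (sin \<theta>) * sqrt (contrast\<^sup>2 - (cos \<theta>)\<^sup>2)"
    have sin: "sin \<theta> \<noteq> 0"
    proof
      assume "sin \<theta> = 0"
      then have "(cos \<theta>)\<^sup>2 = 1" using sin_cos_squared_add[of \<theta>] by simp
      then show False using lt contrast_sq by linarith
    qed
    then have "(sgn (sin \<theta>))\<^sup>2 = 1" by (simp add: sgn_if)
    then have s: "s\<^sup>2 = contrast\<^sup>2 - (cos \<theta>)\<^sup>2" using lt by (simp add: s_def power_mult_distrib)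
    have "s * sin \<theta> = \<bar>sin \<theta>\<bar> * sqrt (contrast\<^sup>2 - (cos \<theta>)\<^sup>2)"
      by (simp add: s_def abs_sgn mult_ac)
    then have pos: "s * sin \<theta> > 0" using sin lt by simp
    have r: "r = cell_fixpt contrast \<theta> s"
      unfolding r_def \<theta>_def using ne s pos by (intro refl_half_eq) (auto simp: \<theta>_def)
    have "s \<noteq> 0" using pos by auto
    then have "cell_fixpt contrast \<theta> s \<noteq> cell_fixpt contrast \<theta> (- s)"
      using d by (simp add: cell_fixpt_def)
    moreover have "rk \<longlonglongrightarrow> r"
      unfolding r rk f by (rule cell_map_iterates_tendsto_hyperbolic[OF abs_contrast d s \<eta> pos])
    ultimately show "\<exists>z1 z2. z1 \<noteq> z2 \<and> {z. f z = z} = {z1, z2} \<and> cmod z1 = 1 \<and> cmod z2 = 1 \<and>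
        rk \<longlonglongrightarrow> r \<and> (\<lambda>k. (f ^^ k) (rk 1)) \<longlonglongrightarrow> r \<and> (r = z1 \<or> r = z2)"
      using cell_map_fixed_points[OF abs_contrast d s \<eta>] cmod_cell_fixpt[OF abs_contrast d s \<eta>] lims r
      unfolding f by blast
  next
    assume *: "(F \<mu> = 1 \<or> F \<mu> = -1) \<and> deriv F \<mu> \<noteq> 0"
    then have cs: "cos \<theta> \<noteq> 0" "sin \<theta> \<noteq> 0" unfolding F_def eqs by auto
    then have "(sin \<theta>)\<^sup>2 \<noteq> 0" by simp
    then have "(cos \<theta>)\<^sup>2 \<noteq> 1" using sin_cos_squared_add[of \<theta>] by linarith
    then have eq: "(cos \<theta>)\<^sup>2 = contrast\<^sup>2" using * unfolding F_def eqs by auto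
    then have d: "contrast \<noteq> 0" using cs by auto
    then have ne: "b1 \<noteq> b2" using contrast_eq_0_iff by simp
    have s: "0\<^sup>2 = contrast\<^sup>2 - (cos \<theta>)\<^sup>2" using eq by simp
    note ctx = abs_contrast d s \<eta>
    have r: "r = cell_fixpt contrast \<theta> 0"
      unfolding r_def \<theta>_def using ne s by (intro refl_half_eq) (auto simp: \<theta>_def)
    have "rk \<longlonglongrightarrow> r"
      unfolding r rk f by (rule cell_map_iterates_tendsto_parabolic[OF ctx refl])
    then show "\<exists>z1. {z. f z = z} = {z1} \<and> zorder (\<lambda>z. f z - z) z1 = 2 \<and> cmod z1 = 1 \<and>
        r = z1 \<and> rk \<longlonglongrightarrow> r \<and> (\<lambda>k. (f ^^ k) (rk 1)) \<longlonglongrightarrow> r"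
      using cell_map_fixed_points[OF ctx] cmod_cell_fixpt(1)[OF ctx] zorder_cell_map_parabolic[OF ctx refl] lims r
      unfolding f by simp
  next
    assume *: "(F \<mu> = 1 \<or> F \<mu> = -1) \<and> deriv F \<mu> = 0"
    \<comment> \<open>The two sources of degeneracy: a vanishing sine, or a vanishing cosine at
      value -1, which forces zero contrast.\<close>
    have "\<eta> = 1 \<or> contrast = 0"
    proof (cases "(cos \<theta>)\<^sup>2 = 1")
      case True
      then have "(sin \<theta>)\<^sup>2 = 0" using sin_cos_squared_add[of \<theta>] by linarith
      then have "(cis \<theta>)\<^sup>2 = 1" using True by (simp add: complex_eq_iff power2_eq_square)
      then show ?thesis using \<eta> by simp
    next
      case False
      then have eq: "(cos \<theta>)\<^sup>2 = contrast\<^sup>2" and "cos \<theta> = 0 \<or> sin \<theta> = 0"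
        using * b2 x2 contrast_sq unfolding F_def eqs by auto
      moreover have "(sin \<theta>)\<^sup>2 \<noteq> 0" using False sin_cos_squared_add[of \<theta>] by linarith
      ultimately show ?thesis by simp
    qed
    \<comment> \<open>For \<eta> = 1 the reflections at the two interfaces cancel; for zero contrast
      there are none. Either way the starting value of the iteration is fixed.\<close>
    then have "f 0 = 0" unfolding f by (auto simp: cell_map_def)
    then have "rk k = 0" for k unfolding rk by (induction k) auto
    then show "\<forall>k\<ge>1. rk k = 0" by simp
  qed
qed

end
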